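(* Consider a Markov decision process $(\mathbb{X},\mathbb{A},\{A(x):x\in\mathbb{X}\},c,q)$ satisfying the standing assumptions listed in the context (in particular $c\ge 0$), and let Assumption ${\rm S}^*$ hold: (1) for each $x\in\mathbb{X}$ the function $a\mapsto c(x,a)$ is inf-compact on $A(x)$; (2) for each $x\in\mathbb{X}$ the transition probability $q(\,\cdot\,|x,a)$ is setwise continuous in $a\in A(x)$, that is, for every bounded measurable $f:\mathbb{X}\to\mathbb{R}$ the function $a\mapsto\int_{\mathbb{X}}f(z)q(dz|x,a)$ is continuous on $A(x)$. Then: (i) the functions $(x,\alpha)\mapsto v_\alpha(x)$ and $(x,\alpha)\mapsto v_{t,\alpha}(x)$, $t=0,1,\ldots$, belong to $\mathbb{M}(\mathbb{X}\times[0,1])$, and $v_{t,\alpha}(x)\uparrow v_\alpha(x)$ as $t\to\infty$ for all $(x,\alpha)\in\mathbb{X}\times[0,1]$; (ii) for each $x\in\mathbb{X}$ the functions $\alpha\mapsto v_\alpha(x)$ and $\alpha\mapsto v_{t,\alpha}(x)$, $t=1,2,\ldots$, where $\alpha\in[0,1]$, are nondecreasing and lower semi-continuous; (iii) if $t=0,1,\ldots$, $\alpha\in[0,1]$, and $x\in\mathbb{X}$, then $v_{t+1,\alpha}(x)=\min_{a\in A(x)}\eta^{\alpha}_{v_{t,\alpha}}(x,a)$, and the nonempty sets $A_{t,\alpha}(x):=\{a\in A(x): v_{t+1,\alpha}(x)=\eta^{\alpha}_{v_{t,\alpha}}(x,a)\}$ satisfy: (a) $\{(x,\alpha,a): a\in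 A_{t,\alpha}(x)\}\in\mathcal{B}(\mathbb{X}\times[0,1]\times\mathbb{A})$, and (b) $A_{t,\alpha}(x)=A(x)$ if $v_{t+1,\alpha}(x)=+\infty$, and $A_{t,\alpha}(x)$ is compact if $v_{t+1,\alpha}(x)<+\infty$; (iv) for $T=1,2,\ldots$ and $\alpha\in[0,1]$, if for a $T$-horizon Markov policy $(\phi_0,\ldots,\phi_{T-1})$ the inclusions $\phi_{T-1-t}(x)\in A_{t,\alpha}(x)$ hold for all $x\in\mathbb{X}$ and all $t=0,\ldots,T-1$, then this policy is $T$-horizon optimal for the discount factor $\alpha$; and, in addition, there exist Markov optimal $T$-horizon policies $(\phi_0^\alpha,\ldots,\phi_{T-1}^\alpha)$ for the discount factor $\alpha$ such that for each $t=0,\ldots,T-1$ the mapping $(x,\alpha)\mapsto\phi_t^\alpha(x)$ from $\mathbb{X}\times[0,1]$ to $\mathbb{A}$ is Borel measurable; (v) if $\alpha\in[0,1]$ and $x\in\mathbb{X}$, then $v_\alpha(x)=\min_{a\in A(x)}\eta^{\alpha}_{v_\alpha}(x,a)$, and the nonempty sets $A_\alpha(x):=\{a\in A(x): v_\alpha(x)=\eta^\alpha_{v_\alpha}(x,a)\}$ satisfy: (a) $\{(x,\alpha,a): a\in A_\alpha(x)\}\in\mathcal{B}(\mathbb{X}\times[0,1]\times\mathbb{A})$, and (b) $A_\alpha(x)=A(x)$ if $v_\alpha(x)=+\infty$, and $A_\alpha(x)$ is compact if $v_\alpha(x)<+\infty$; (vi) for a discount factor $\alpha\in[0,1]$, a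 stationary policy $\phi$ is optimal for the infinite-horizon problem with this discount factor if and only if $\phi(x)\in A_\alpha(x)$ for all $x\in\mathbb{X}$; and for each $\alpha\in[0,1]$ there exists a stationary policy $\phi_\alpha$ which is optimal for the infinite-horizon problem with discount factor $\alpha$, and such that $(x,\alpha)\mapsto\phi_\alpha(x)$ is a Borel measurable mapping from $\mathbb{X}\times[0,1]$ to $\mathbb{A}$.
   Context: A Borel space is a Borel subset of a Polish space, with Borel $\sigma$-algebra $\mathcal{B}(\cdot)$. $\overline{\mathbb{R}}=\mathbb{R}\cup\{+\infty\}$. A function $f:E\to\overline{\mathbb{R}}$ on a subset $E$ of a metric space is inf-compact on $E$ if $\{e\in E: f(e)\le\lambda\}$ is compact for every $\lambda\in\mathbb{R}$. For a Borel space $\mathbb{S}$, $\mathbb{M}(\mathbb{S})$ is the set of all nonnegative Borel measurable functions $f:\mathbb{S}\to\overline{\mathbb{R}}$. MDP and standing assumptions: $\mathbb{X}$ (states) and $\mathbb{A}$ (actions) are Borel spaces; $A(x)\subset\mathbb{A}$, $x\in\mathbb{X}$, are nonempty Borel sets of feasible actions; (a) ${\rm Gr}(A)=\{(x,a): x\in\mathbb{X}, a\in A(x)\}\in\mathcal{B}(\mathbb{X}\times\mathbb{A})$; (b) there exists a Borel mapping $\varphi:\mathbb{X}\to\mathbb{A}$ with $\varphi(x)\in A(x)$ for all $x$; (c) the one-step cost $c:{\rm Gr}(A)\to\overline{\mathbb{R}}$ is Borel measurable and $c\ge 0$; (d) $q(\,\cdot\,|x,a)$ is a probability measure on $(\mathbb{X},\mathcal{B}(\mathbb{X}))$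 for each $(x,a)\in{\rm Gr}(A)$, and $(x,a)\mapsto q(B|x,a)$ is Borel measurable on ${\rm Gr}(A)$ for each $B\in\mathcal{B}(\mathbb{X})$. Policies: $\mathbb{H}_t=(\mathbb{X}\times\mathbb{A})^t\times\mathbb{X}$ is the set of histories up to epoch $t=0,1,\ldots$. A randomized decision rule at epoch $t$ is a regular transition probability $\pi_t(\,\cdot\,|h_t)$ from $\mathbb{H}_t$ to $\mathbb{A}$ concentrated on $A(x_t)$. A policy is a sequence $\pi=\{\pi_t\}_{t=0,1,\ldots}$ of decision rules; $\Pi$ is the set of all policies. A policy is nonrandomized if each $\pi_t(\,\cdot\,|h_t)$ is concentrated at one point; a nonrandomized policy is Markov if decisions depend only on the current state and time (i.e., it is given by Borel mappings $\phi_t:\mathbb{X}\to\mathbb{A}$ with $\phi_t(x)\in A(x)$); a Markov policy is stationary if decisions depend only on the current state (i.e., it is a Borel $\phi:\mathbb{X}\to\mathbb{A}$ with $\phi(x)\in A(x)$). A $T$-horizon policy specifies decisions at epochs $0,\ldots,T-1$. For an initial state $x$ and policy $\pi$, $\mathbb{E}_x^\pi$ is the expectation with respect to the probability on trajectories $(x_0,a_0,x_1,a_1,\ldots)$ with $x_0=x$ determined by $\pi$ and $q$ (Ionescu Tulcea theorem). Costs: for $\alpha\in[0,1]$, $v^\pi_{0,\alpha}(x)=0$, $v^\pi_{T,\alpha}(x)=\mathbb{E}^\pi_x\sum_{t=0}^{T-1}\alpha^t c(x_t,a_t)$ for $T=1,2,\ldots$ and for $T=\infty$, with $v^\pi_\alpha:=v^\pi_{\infty,\alpha}$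 (here $0^0=1$). Values: $v_{T,\alpha}(x)=\inf_{\pi\in\Pi}v^\pi_{T,\alpha}(x)$ and $v_\alpha(x)=\inf_{\pi\in\Pi}v^\pi_\alpha(x)$. A policy is optimal for a criterion if its cost equals the corresponding value for all $x\in\mathbb{X}$. For $\alpha\ge0$ and $w\in\mathbb{M}(\mathbb{X})$, $\eta^\alpha_w(x,a)=c(x,a)+\alpha\int_{\mathbb{X}}w(z)q(dz|x,a)$, $(x,a)\in{\rm Gr}(A)$, with the convention $0\cdot(+\infty)=0$. *)

theory Defs
  imports "HOL-Probability.Probability"
begin

section \<open>Function classes on Borel spaces\<close>

text \<open>
  A Borel space is a Borel subset \<open>S\<close> of a type of class \<open>polish_space\<close>, with the
  trace \<open>\<sigma>\<close>-algebra \<open>restrict_space borel S\<close>.  The nonnegative elements of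
  \<open>\<real> \<union> {\<infinity>}\<close> are the type \<^typ>\<open>ennreal\<close>, in which \<open>0 * \<infinity> = 0\<close>; nonnegativity of costs
  and of members of \<open>\<bbbM>(S)\<close> is therefore part of their type.
\<close>

definition nonneg_borel :: "'s::topological_space set \<Rightarrow> ('s \<Rightarrow> ennreal) set" where
  "nonneg_borel S = borel_measurable (restrict_space borel S)"

definition inf_compact_on :: "'s::metric_space set \<Rightarrow> ('s \<Rightarrow> ereal) \<Rightarrow> bool" where
  "inf_compact_on E f \<longleftrightarrow> (\<forall>l::real. compact {e\<in>E. f e \<le> ereal l})"

definition lsc_on :: "'s::topological_space set \<Rightarrow> ('s \<Rightarrow> 'r::complete_linorder) \<Rightarrow> bool" where
  "lsc_on S f \<longleftrightarrow> (\<forall>x\<in>S. f x \<le> Liminf (at x within S) f)"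

definition is_minimum :: "'r::order \<Rightarrow> 's set \<Rightarrow> ('s \<Rightarrow> 'r) \<Rightarrow> bool" where
  "is_minimum m S f \<longleftrightarrow> (\<exists>s\<in>S. f s = m) \<and> (\<forall>s\<in>S. m \<le> f s)"


section \<open>Markov decision processes\<close>

record ('x, 'a) mdp =
  states :: "'x set"
  actions :: "'a set"
  feasible :: "'x \<Rightarrow> 'a set"
  cost :: "'x \<times> 'a \<Rightarrow> ennreal"
  transition :: "'x \<times> 'a \<Rightarrow> 'x measure"

definition graph :: "('x, 'a) mdp \<Rightarrow> ('x \<times> 'a) set" where
  "graph M = Sigma (states M) (feasible M)"

abbreviation state_space :: "('x::polish_space, 'a) mdp \<Rightarrow> 'x measure" where
  "state_space M \<equiv> restrict_space borel (states M)"

abbreviation action_space :: "('x, 'a::polish_space) mdp \<Rightarrow> 'a measure" where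
  "action_space M \<equiv> restrict_space borel (actions M)"

text \<open>
  Borel mappings \<open>\<phi>\<close> with \<open>\<phi>(x) \<in> A(x)\<close>; these are also the stationary policies.
\<close>
definition selectors :: "('x::polish_space, 'a::polish_space) mdp \<Rightarrow> ('x \<Rightarrow> 'a) set" where
  "selectors M = {\<phi> \<in> state_space M \<rightarrow>\<^sub>M action_space M. \<forall>x\<in>states M. \<phi> x \<in> feasible M x}"

text \<open>
  Measurability into \<open>prob_algebra N\<close> says that the values are probability measures on \<open>N\<close>
  and that \<open>y \<mapsto> k y B\<close> is measurable for every measurable \<open>B\<close>, i.e. that \<open>k\<close> is
  a transition probability.  The cost and the transition probability are constrained on the
  graph of \<open>A\<close> only.
\<close>
locale markov_decision_process =
  fixes M :: "('x::polish_space, 'a::polish_space) mdp"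
  assumes states_borel: "states M \<in> sets borel"
    and actions_borel: "actions M \<in> sets borel"
    and feasible_borel: "\<And>x. x \<in> states M \<Longrightarrow> feasible M x \<in> sets (action_space M)"
    and feasible_nonempty: "\<And>x. x \<in> states M \<Longrightarrow> feasible M x \<noteq> {}"
    and graph_borel: "graph M \<in> sets (restrict_space borel (states M \<times> actions M))"
    and selector_exists: "selectors M \<noteq> {}"
    and cost_borel: "cost M \<in> borel_measurable (restrict_space borel (graph M))"
    and transition_kernel:
      "transition M \<in> restrict_space borel (graph M) \<rightarrow>\<^sub>M prob_algebra (state_space M)"

definition assumption_S_star :: "('x::polish_space, 'a::polish_space) mdp \<Rightarrow> bool" where
  "assumption_S_star M \<longleftrightarrow>
     (\<forall>x\<in>states M. inf_compact_on (feasible M x) (\<lambda>a. enn2ereal (cost M (x, a)))) \<and>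
     (\<forall>x\<in>states M. \<forall>f\<in>borel_measurable (state_space M). bounded (f ` states M) \<longrightarrow>
        continuous_on (feasible M x) (\<lambda>a. \<integral>z. (f z :: real) \<partial>transition M (x, a)))"


section \<open>Policies and strategic measures\<close>

text \<open>
  A history \<open>(x\<^sub>0, a\<^sub>0, \<dots>, x\<^sub>t\<^sub>-\<^sub>1, a\<^sub>t\<^sub>-\<^sub>1, x\<^sub>t)\<close> is encoded as a pair \<open>(\<omega>, x\<^sub>t)\<close> where
  \<open>\<omega> i = (x\<^sub>i, a\<^sub>i)\<close> for \<open>i < t\<close>.
\<close>

abbreviation step_space :: "('x::polish_space, 'a::polish_space) mdp \<Rightarrow> ('x \<times> 'a) measure" where
  "step_space M \<equiv> state_space M \<Otimes>\<^sub>M action_space M"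

definition history_space ::
    "('x::polish_space, 'a::polish_space) mdp \<Rightarrow> nat \<Rightarrow> ((nat \<Rightarrow> 'x \<times> 'a) \<times> 'x) measure" where
  "history_space M t = (\<Pi>\<^sub>M i\<in>{0..<t}. step_space M) \<Otimes>\<^sub>M state_space M"

type_synonym ('x, 'a) policy = "nat \<Rightarrow> (nat \<Rightarrow> 'x \<times> 'a) \<times> 'x \<Rightarrow> 'a measure"

definition policies :: "('x::polish_space, 'a::polish_space) mdp \<Rightarrow> ('x, 'a) policy set" where
  "policies M = {\<pi>. \<forall>t. \<pi> t \<in> history_space M t \<rightarrow>\<^sub>M prob_algebra (action_space M) \<and>
     (\<forall>h\<in>space (history_space M t). emeasure (\<pi> t h) (feasible M (snd h)) = 1)}"

definition markov_policy ::
    "('x::polish_space, 'a::polish_space) mdp \<Rightarrow> (nat \<Rightarrow> 'x \<Rightarrow> 'a) \<Rightarrow> ('x, 'a) policy" where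
  "markov_policy M \<phi> = (\<lambda>t h. return (action_space M) (\<phi> t (snd h)))"

text \<open>
  Policies are defined on all histories in \<open>(\<bbbX> \<times> \<bbbA>)\<^sup>t \<times> \<bbbX>\<close>, whereas \<open>q\<close> is given on the graph
  only.  To obtain kernels on the whole history space, \<open>q\<close> is extended by Dirac measures;
  the extension has no influence because the graph has probability one at every epoch.
\<close>
definition transition_ext ::
    "('x::polish_space, 'a::polish_space) mdp \<Rightarrow> 'x \<times> 'a \<Rightarrow> 'x measure" where
  "transition_ext M p = (if p \<in> graph M then transition M p else return (state_space M) (fst p))"

definition next_state ::
    "('x::polish_space, 'a::polish_space) mdp \<Rightarrow> 'x \<Rightarrow> nat \<Rightarrow> (nat \<Rightarrow> 'x \<times> 'a) \<Rightarrow> 'x measure" where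
  "next_state M x t \<omega> =
     (case t of 0 \<Rightarrow> return (state_space M) x | Suc s \<Rightarrow> transition_ext M (\<omega> s))"

text \<open>Conditional law of \<open>(x\<^sub>t, a\<^sub>t)\<close> given \<open>(x\<^sub>0, a\<^sub>0, \<dots>, x\<^sub>t\<^sub>-\<^sub>1, a\<^sub>t\<^sub>-\<^sub>1)\<close>, initial state \<open>x\<close>.\<close>
definition step_kernel ::
    "('x::polish_space, 'a::polish_space) mdp \<Rightarrow> ('x, 'a) policy \<Rightarrow> 'x \<Rightarrow>
      nat \<Rightarrow> (nat \<Rightarrow> 'x \<times> 'a) \<Rightarrow> ('x \<times> 'a) measure" where
  "step_kernel M \<pi> x t \<omega> =
     next_state M x t \<omega> \<bind> (\<lambda>y. \<pi> t (\<omega>, y) \<bind> (\<lambda>a. return (step_space M) (y, a)))"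

text \<open>
  The measure on trajectories given by the Ionescu Tulcea theorem: the projective limit of the
  finite-dimensional laws \<open>Ionescu_Tulcea.CI\<close>.
\<close>
definition trajectory ::
    "('x::polish_space, 'a::polish_space) mdp \<Rightarrow> ('x, 'a) policy \<Rightarrow> 'x \<Rightarrow>
      (nat \<Rightarrow> 'x \<times> 'a) measure" where
  "trajectory M \<pi> x =
     projective_family.lim UNIV (Ionescu_Tulcea.CI (step_kernel M \<pi> x) (\<lambda>_. step_space M))
       (\<lambda>_. step_space M)"

lemma sets_pair_restrict_borel:
  fixes S :: "'s::second_countable_topology set" and R :: "'r::second_countable_topology set"
  shows "sets (restrict_space borel S \<Otimes>\<^sub>M restrict_space borel R) =
    sets (restrict_space borel (S \<times> R))" (is "sets ?P = sets ?B")
proof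
  have sp: "space ?P = S \<times> R" "space ?B = S \<times> R"
    by (simp_all add: space_pair_measure space_restrict_space)
  have f: "fst \<in> ?P \<rightarrow>\<^sub>M borel" and g: "snd \<in> ?P \<rightarrow>\<^sub>M borel"
    by (rule measurable_compose[OF measurable_fst measurable_restrict_space1], simp)
      (rule measurable_compose[OF measurable_snd measurable_restrict_space1], simp)
  have "(\<lambda>p. (fst p, snd p)) \<in> ?P \<rightarrow>\<^sub>M borel"
    by (rule borel_measurable_Pair[OF f g])
  then have 1: "(\<lambda>p. p) \<in> ?P \<rightarrow>\<^sub>M ?B"
    by (intro measurable_restrict_space2) (auto simp: sp)
  have f': "(fst :: 's \<times> 'r \<Rightarrow> 's) \<in> borel \<rightarrow>\<^sub>M borel" and g': "(snd :: 's \<times> 'r \<Rightarrow> 'r) \<in> borel \<rightarrow>\<^sub>M borel"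
    by (intro borel_measurable_continuous_onI continuous_intros)+
  have "fst \<in> ?B \<rightarrow>\<^sub>M restrict_space borel S" "snd \<in> ?B \<rightarrow>\<^sub>M restrict_space borel R"
    by (intro measurable_restrict_space2 measurable_restrict_space1 f' g'; auto simp: sp)+
  then have "(\<lambda>p. (fst p, snd p)) \<in> ?B \<rightarrow>\<^sub>M ?P"
    by (rule measurable_Pair)
  then have 2: "(\<lambda>p. p) \<in> ?B \<rightarrow>\<^sub>M ?P" by simp
  show "sets ?P \<subseteq> sets ?B"
  proof
    fix C assume C: "C \<in> sets ?P"
    then show "C \<in> sets ?B"
      using measurable_sets[OF 2 C] sets.sets_into_space[OF C] by (simp add: sp Int_absorb2)
  qed
  show "sets ?B \<subseteq> sets ?P"
  proof
    fix C assume C: "C \<in> sets ?B"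
    then show "C \<in> sets ?P"
      using measurable_sets[OF 1 C] sets.sets_into_space[OF C] by (simp add: sp Int_absorb2)
  qed
qed

lemma (in markov_decision_process) transition_ext_kernel:
  "transition_ext M \<in> step_space M \<rightarrow>\<^sub>M prob_algebra (state_space M)"
proof -
  have G: "graph M \<in> sets (step_space M)"
    using graph_borel by (simp add: sets_pair_restrict_borel)
  have sub: "graph M \<subseteq> states M \<times> actions M"
    using sets.sets_into_space[OF graph_borel] by (simp add: space_restrict_space)
  have "sets (restrict_space (step_space M) (graph M)) =
      sets (restrict_space (restrict_space borel (states M \<times> actions M)) (graph M))"
    by (rule sets_restrict_space_cong) (rule sets_pair_restrict_borel)
  also have "\<dots> = sets (restrict_space borel (graph M))"
    using sub by (simp add: sets_restrict_restrict_space Int_absorb1)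
  finally have r: "sets (restrict_space (step_space M) (graph M)) =
      sets (restrict_space borel (graph M))" .
  have 1: "transition M \<in> restrict_space (step_space M) (graph M) \<rightarrow>\<^sub>M prob_algebra (state_space M)"
    using transition_kernel by (simp add: measurable_cong_sets[OF r refl])
  have 2: "(\<lambda>p. return (state_space M) (fst p)) \<in>
      restrict_space (step_space M) (- graph M) \<rightarrow>\<^sub>M prob_algebra (state_space M)"
    by (intro measurable_restrict_space1 measurable_compose[OF measurable_fst measurable_return_prob_space])
  have "{p \<in> space (step_space M). p \<in> graph M} = graph M"
    using sets.sets_into_space[OF G] by auto
  then show ?thesis
    unfolding transition_ext_def[abs_def]
    using G 1 2 by (subst measurable_If_restrict_space_iff) (simp_all add: Compl_eq)
qed

lemma (in markov_decision_process) Ionescu_Tulcea_step_kernel: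
  assumes "\<pi> \<in> policies M" and "x \<in> states M"
  shows "Ionescu_Tulcea (step_kernel M \<pi> x) (\<lambda>_. step_space M)"
proof -
  have K: "step_kernel M \<pi> x t \<in> (\<Pi>\<^sub>M i\<in>{0..<t}. step_space M) \<rightarrow>\<^sub>M prob_algebra (step_space M)" for t
  proof -
    have [measurable]: "\<pi> t \<in> history_space M t \<rightarrow>\<^sub>M prob_algebra (action_space M)"
      using assms(1) by (simp add: policies_def)
    have n: "next_state M x t \<in> (\<Pi>\<^sub>M i\<in>{0..<t}. step_space M) \<rightarrow>\<^sub>M prob_algebra (state_space M)"
    proof (cases t)
      case 0
      then show ?thesis
        using assms(2)
        by (auto simp: next_state_def[abs_def] space_prob_algebra space_restrict_space
            intro!: measurable_const prob_space_return)
    next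
      case (Suc s)
      then show ?thesis
        by (auto simp: next_state_def[abs_def]
            intro!: measurable_compose[OF _ transition_ext_kernel] measurable_component_singleton)
    qed
    have p: "(\<lambda>(\<omega>, y). \<pi> t (\<omega>, y) \<bind> (\<lambda>a. return (step_space M) (y, a))) \<in>
        history_space M t \<rightarrow>\<^sub>M prob_algebra (step_space M)"
      unfolding split_beta
    proof (rule measurable_bind_prob_space2[where N = "action_space M"])
      show "(\<lambda>p. \<pi> t (fst p, snd p)) \<in> history_space M t \<rightarrow>\<^sub>M prob_algebra (action_space M)"
        by simp
      have "(\<lambda>(p, a). (snd p, a)) \<in> history_space M t \<Otimes>\<^sub>M action_space M \<rightarrow>\<^sub>M step_space M"
        unfolding history_space_def split_beta by measurable
      from measurable_compose[OF this measurable_return_prob_space]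
      show "(\<lambda>(p, a). return (step_space M) (snd p, a)) \<in>
          history_space M t \<Otimes>\<^sub>M action_space M \<rightarrow>\<^sub>M prob_algebra (step_space M)"
        by (simp add: split_beta)
    qed
    show ?thesis
      unfolding step_kernel_def[abs_def]
      by (rule measurable_bind_prob_space2[OF n]) (use p in \<open>simp add: history_space_def\<close>)
  qed
  show ?thesis
  proof (rule Ionescu_Tulcea.intro)
    show "step_kernel M \<pi> x t \<in> (\<Pi>\<^sub>M i\<in>{0..<t}. step_space M) \<rightarrow>\<^sub>M subprob_algebra (step_space M)" for t
      by (rule measurable_prob_algebraD[OF K])
    show "prob_space (step_kernel M \<pi> x t \<omega>)"
      if "\<omega> \<in> space (\<Pi>\<^sub>M i\<in>{0..<t}. step_space M)" for t \<omega>
      using measurable_space[OF K that] by (simp add: space_prob_algebra)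
  qed
qed

lemma markov_policy_in_policies:
  assumes "\<And>t. \<phi> t \<in> selectors M" "\<And>x. x \<in> states M \<Longrightarrow> feasible M x \<in> sets (action_space M)"
  shows "markov_policy M \<phi> \<in> policies M"
proof -
  have "markov_policy M \<phi> t \<in> history_space M t \<rightarrow>\<^sub>M prob_algebra (action_space M)" for t
  proof -
    have [measurable]: "\<phi> t \<in> state_space M \<rightarrow>\<^sub>M action_space M"
      using assms(1)[of t] by (simp add: selectors_def)
    show ?thesis
      unfolding markov_policy_def history_space_def by measurable
  qed
  moreover have "emeasure (markov_policy M \<phi> t h) (feasible M (snd h)) = 1"
    if "h \<in> space (history_space M t)" for t h
  proof -
    have "snd h \<in> states M"
      using that by (auto simp: history_space_def space_pair_measure space_restrict_space)
    then show ?thesis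
      using assms(1)[of t] assms(2)[of "snd h"]
      by (simp add: markov_policy_def selectors_def indicator_def)
  qed
  ultimately show ?thesis
    by (simp add: policies_def)
qed


section \<open>Costs, values and optimality\<close>

definition fin_cost ::
    "('x::polish_space, 'a::polish_space) mdp \<Rightarrow> ('x, 'a) policy \<Rightarrow> nat \<Rightarrow> real \<Rightarrow> 'x \<Rightarrow> ennreal" where
  "fin_cost M \<pi> T \<alpha> x = (\<integral>\<^sup>+\<omega>. (\<Sum>t<T. ennreal (\<alpha> ^ t) * cost M (\<omega> t)) \<partial>trajectory M \<pi> x)"

definition inf_cost ::
    "('x::polish_space, 'a::polish_space) mdp \<Rightarrow> ('x, 'a) policy \<Rightarrow> real \<Rightarrow> 'x \<Rightarrow> ennreal" where
  "inf_cost M \<pi> \<alpha> x = (\<integral>\<^sup>+\<omega>. (\<Sum>t. ennreal (\<alpha> ^ t) * cost M (\<omega> t)) \<partial>trajectory M \<pi> x)"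

definition fin_value ::
    "('x::polish_space, 'a::polish_space) mdp \<Rightarrow> nat \<Rightarrow> real \<Rightarrow> 'x \<Rightarrow> ennreal" where
  "fin_value M T \<alpha> x = (INF \<pi>\<in>policies M. fin_cost M \<pi> T \<alpha> x)"

definition inf_value ::
    "('x::polish_space, 'a::polish_space) mdp \<Rightarrow> real \<Rightarrow> 'x \<Rightarrow> ennreal" where
  "inf_value M \<alpha> x = (INF \<pi>\<in>policies M. inf_cost M \<pi> \<alpha> x)"

definition eta ::
    "('x, 'a) mdp \<Rightarrow> real \<Rightarrow> ('x \<Rightarrow> ennreal) \<Rightarrow> 'x \<times> 'a \<Rightarrow> ennreal" where
  "eta M \<alpha> w p = cost M p + ennreal \<alpha> * (\<integral>\<^sup>+z. w z \<partial>transition M p)"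

definition fin_opt_actions ::
    "('x::polish_space, 'a::polish_space) mdp \<Rightarrow> nat \<Rightarrow> real \<Rightarrow> 'x \<Rightarrow> 'a set" where
  "fin_opt_actions M t \<alpha> x =
     {a \<in> feasible M x. fin_value M (Suc t) \<alpha> x = eta M \<alpha> (fin_value M t \<alpha>) (x, a)}"

definition inf_opt_actions ::
    "('x::polish_space, 'a::polish_space) mdp \<Rightarrow> real \<Rightarrow> 'x \<Rightarrow> 'a set" where
  "inf_opt_actions M \<alpha> x =
     {a \<in> feasible M x. inf_value M \<alpha> x = eta M \<alpha> (inf_value M \<alpha>) (x, a)}"

text \<open>
  A \<open>T\<close>-horizon Markov policy \<open>(\<phi>\<^sub>0, \<dots>, \<phi>\<^sub>T\<^sub>-\<^sub>1)\<close> is a sequence \<open>\<phi>\<close> of which only the first \<open>T\<close>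
  members are used.  Its cost is that of any policy which follows it at epochs
  \<open>0, \<dots>, T - 1\<close>; such policies exist since \<open>selectors M\<close> is nonempty.
\<close>
definition is_horizon_markov ::
    "('x::polish_space, 'a::polish_space) mdp \<Rightarrow> nat \<Rightarrow> (nat \<Rightarrow> 'x \<Rightarrow> 'a) \<Rightarrow> bool" where
  "is_horizon_markov M T \<phi> \<longleftrightarrow> (\<forall>t<T. \<phi> t \<in> selectors M)"

definition follows_until ::
    "('x::polish_space, 'a::polish_space) mdp \<Rightarrow> nat \<Rightarrow> (nat \<Rightarrow> 'x \<Rightarrow> 'a) \<Rightarrow> ('x, 'a) policy \<Rightarrow> bool" where
  "follows_until M T \<phi> \<pi> \<longleftrightarrow>
     (\<forall>t<T. \<forall>h\<in>space (history_space M t). \<pi> t h = markov_policy M \<phi> t h)"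

definition horizon_optimal ::
    "('x::polish_space, 'a::polish_space) mdp \<Rightarrow> nat \<Rightarrow> real \<Rightarrow> (nat \<Rightarrow> 'x \<Rightarrow> 'a) \<Rightarrow> bool" where
  "horizon_optimal M T \<alpha> \<phi> \<longleftrightarrow>
     (\<forall>\<pi>\<in>policies M. follows_until M T \<phi> \<pi> \<longrightarrow>
        (\<forall>x\<in>states M. fin_cost M \<pi> T \<alpha> x = fin_value M T \<alpha> x))"

definition stationary_optimal ::
    "('x::polish_space, 'a::polish_space) mdp \<Rightarrow> real \<Rightarrow> ('x \<Rightarrow> 'a) \<Rightarrow> bool" where
  "stationary_optimal M \<alpha> \<phi> \<longleftrightarrow>
     (\<forall>x\<in>states M. inf_cost M (markov_policy M (\<lambda>_. \<phi>)) \<alpha> x = inf_value M \<alpha> x)"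

end

theory Submission
  imports Defs
begin

text \<open>
  The theorem is dynamic programming for nonnegative costs.  Let \<open>L\<^sub>\<alpha> w (x) = inf\<^sub>a \<eta>\<^sup>\<alpha>\<^sub>w(x, a)\<close> be the
  one-step operator, \<open>V\<^sub>0 = 0\<close>, \<open>V\<^sub>t\<^sub>+\<^sub>1 = L\<^sub>\<alpha> V\<^sub>t\<close> and \<open>V = sup\<^sub>t V\<^sub>t\<close>.  Everything rests on three
  properties of \<open>L\<^sub>\<alpha>\<close>.

  \<^item> For fixed \<open>x\<close> the function \<open>a \<mapsto> \<eta>\<^sup>\<alpha>\<^sub>w(x, a)\<close> has compact sublevel sets
    (\<open>inf_compact_eta\<close>): setwise continuity makes \<open>a \<mapsto> \<integral>min(w, k) dq\<close> continuous, adding a continuous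
    function to an inf-compact one keeps it inf-compact, and so does the supremum over \<open>k\<close>.  Hence
    minima are attained and sets of minimizers are compact.
  \<^item> \<open>L\<^sub>\<alpha>\<close> commutes with increasing limits of \<open>(\<alpha>, w)\<close> (\<open>bellman_SUP\<close>): the integral does by monotone
    convergence, and the infimum does because nested nonempty compact sublevel sets have a common
    point.  With \<open>\<alpha>\<close> fixed this gives \<open>L\<^sub>\<alpha> V = V\<close>; with \<open>\<alpha>\<^sub>n\<close> increasing to \<open>\<alpha>\<close> it gives left continuity of
    the values in the discount factor, which for a nondecreasing function is lower semicontinuity.
  \<^item> \<open>L\<^sub>\<alpha> w\<close> is Borel in \<open>(x, \<alpha>)\<close> and a minimizer can be chosen Borel in \<open>(x, \<alpha>)\<close>
    (\<open>bellman_measurable_selection\<close>).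

  The last point is descriptive set theory: a Borel set with compact sections has a Borel
  projection and a Borel selector.  This is proved from Novikov's separation theorem: a sequence of
  analytic sets with empty intersection can be enlarged to Borel sets with empty intersection.
  Separation yields two Borel descriptions of a Borel set \<open>K\<close> with compact sections: its complement is
  a countable union of rectangles \<open>B\<^sub>n \<times> V\<^sub>n\<close> with \<open>B\<^sub>n\<close> Borel and \<open>V\<^sub>n\<close> open, and for each \<open>i\<close> there is an
  integer-valued Borel function \<open>N\<^sub>i\<close> such that the first \<open>N\<^sub>i(x)\<close> balls of radius \<open>1/(i+1)\<close> around a
  dense sequence cover the section at \<open>x\<close>.  By completeness, a section is nonempty iff all finite
  stages of this description are, and each finite stage involves only countably many Borel
  conditions on \<open>x\<close> (\<open>compact_sections_projection_borel\<close>).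

  The values are identified with value iteration through the strategic measures.  Only the laws of
  the single pairs \<open>(x\<^sub>t, a\<^sub>t)\<close> matter: telescoping \<open>E \<alpha>\<^sup>k V\<^sub>T\<^sub>-\<^sub>k(x\<^sub>k)\<close> shows that every policy costs at least
  \<open>V\<^sub>T\<close> over \<open>T\<close> epochs (\<open>cost_lower_bound\<close>), with equality for Markov policies of minimizers
  (\<open>cost_markov\<close>).  Over the infinite horizon every policy then costs at least \<open>V\<close>, while the stationary
  policy of minimizers of \<open>\<eta>\<^sup>\<alpha>\<^sub>V\<close> costs at most \<open>V\<close>, since \<open>V(x)\<close> equals its \<open>T\<close>-epoch cost plus a nonnegative
  remainder.  Conversely the cost of any stationary policy \<open>\<phi>\<close> solves \<open>v(x) = \<eta>\<^sup>\<alpha>\<^sub>v(x, \<phi>(x))\<close>, so an optimal one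
  selects minimizers.
\<close>

section \<open>Borel sets as projections of closed sets\<close>

text \<open>
  In a Polish space these are the analytic sets.  The witness space is homeomorphic to its own
  countable power and has a countable discrete factor; closure under countable intersections and
  unions relies on these two facts.
\<close>
definition closed_projection :: "'x::metric_space set \<Rightarrow> bool" where
  "closed_projection B \<longleftrightarrow> (\<exists>C :: ('x \<times> (nat \<Rightarrow> nat discrete)) set. closed C \<and> B = fst ` C)"

lemma closed_projection_closed: "closed F \<Longrightarrow> closed_projection F"
  unfolding closed_projection_def
  by (intro exI[of _ "F \<times> UNIV"] conjI closed_Times) auto

lemma closed_projection_UN:
  fixes B :: "nat \<Rightarrow> 'x::metric_space set"
  assumes "\<And>n. closed_projection (B n)"
  shows "closed_projection (\<Union>n. B n)"
proof -
  obtain C :: "nat \<Rightarrow> ('x \<times> (nat \<Rightarrow> nat discrete)) set"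
    where C: "\<And>n. closed (C n)" "\<And>n. B n = fst ` C n"
    using assms unfolding closed_projection_def by metis
  define g :: "'x \<times> (nat \<Rightarrow> nat discrete) \<Rightarrow> 'x \<times> (nat \<Rightarrow> nat discrete)"
    where "g = (\<lambda>(x, w). (x, \<lambda>k. w (Suc k)))"
  \<comment> \<open>The first coordinate of the witness says which set contains the point; the others are its witness there.\<close>
  define D where "D = {p. g p \<in> C (of_discrete (snd p 0))}"
  have g: "continuous_on UNIV g"
    unfolding g_def split_beta
    by (intro continuous_intros continuous_on_compose2[OF continuous_on_product_coordinates continuous_on_snd]) auto
  have h: "continuous_on UNIV (\<lambda>p :: 'x \<times> (nat \<Rightarrow> nat discrete). snd p 0)"
    by (intro continuous_on_compose2[OF continuous_on_product_coordinates continuous_on_snd]) (auto intro!: continuous_intros)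
  have "- D = (\<Union>n. (\<lambda>p. snd p 0) -` {discrete n} \<inter> g -` (- C n))"
    by (auto simp: D_def discrete_inverse of_discrete_inverse)
  moreover have "open \<dots>"
    using C(1) by (intro open_UN ballI open_Int open_vimage g h open_discrete) auto
  ultimately have "closed D"
    by (simp add: closed_def)
  moreover have "(\<Union>n. B n) = fst ` D"
  proof (intro set_eqI iffI)
    fix x assume "x \<in> (\<Union>n. B n)"
    then obtain n w where "(x, w) \<in> C n"
      using C(2) by force
    then have "(x, case_nat (discrete n) w) \<in> D"
      by (simp add: D_def g_def discrete_inverse)
    then show "x \<in> fst ` D" by force
  next
    fix x assume "x \<in> fst ` D"
    then show "x \<in> (\<Union>n. B n)"
      using C(2) by (force simp: D_def g_def)
  qed
  ultimately show ?thesis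
    unfolding closed_projection_def by blast
qed

lemma closed_projection_INT:
  fixes B :: "nat \<Rightarrow> 'x::metric_space set"
  assumes "\<And>n. closed_projection (B n)"
  shows "closed_projection (\<Inter>n. B n)"
proof -
  obtain C :: "nat \<Rightarrow> ('x \<times> (nat \<Rightarrow> nat discrete)) set"
    where C: "\<And>n. closed (C n)" "\<And>n. B n = fst ` C n"
    using assms unfolding closed_projection_def by metis
  define g :: "nat \<Rightarrow> 'x \<times> (nat \<Rightarrow> nat discrete) \<Rightarrow> 'x \<times> (nat \<Rightarrow> nat discrete)"
    where "g = (\<lambda>n (x, w). (x, \<lambda>k. w (prod_encode (n, k))))"
  \<comment> \<open>A single witness encodes, through the pairing function, one witness for every set.\<close>
  define D where "D = (\<Inter>n. g n -` C n)"
  have g: "continuous_on UNIV (g n)" for n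
    unfolding g_def split_beta
    by (intro continuous_intros continuous_on_compose2[OF continuous_on_product_coordinates continuous_on_snd]) auto
  have "closed D"
    unfolding D_def using C(1) by (intro closed_INT ballI closed_vimage g) auto
  moreover have "(\<Inter>n. B n) = fst ` D"
  proof (intro set_eqI iffI)
    fix x assume "x \<in> (\<Inter>n. B n)"
    then have "\<forall>n. \<exists>w. (x, w) \<in> C n"
      using C(2) by force
    then obtain w where w: "\<And>n. (x, w n) \<in> C n" by metis
    have "(x, \<lambda>m. case prod_decode m of (n, k) \<Rightarrow> w n k) \<in> D"
      using w by (simp add: D_def g_def)
    then show "x \<in> fst ` D" by force
  next
    fix x assume "x \<in> fst ` D"
    then show "x \<in> (\<Inter>n. B n)"
      using C(2) by (force simp: D_def g_def)
  qed
  ultimately show ?thesis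
    unfolding closed_projection_def by blast
qed

lemma closed_projection_open:
  fixes U :: "'x::metric_space set"
  assumes "open U"
  shows "closed_projection U"
proof (cases "U = UNIV")
  case True
  then show ?thesis by (simp add: closed_projection_closed)
next
  case False
  have "U = (\<Union>n::nat. {x. 1 / Suc n \<le> infdist x (- U)})"
  proof (intro set_eqI iffI)
    fix x assume "x \<in> U"
    then have "0 < infdist x (- U)"
      using False assms infdist_pos_not_in_closed[of "- U" x] by auto
    then obtain n where "1 / Suc n < infdist x (- U)"
      using nat_approx_posE by blast
    then show "x \<in> (\<Union>n::nat. {x. 1 / Suc n \<le> infdist x (- U)})"
      by (auto intro!: exI[of _ n])
  next
    fix x assume "x \<in> (\<Union>n::nat. {x. 1 / Suc n \<le> infdist x (- U)})"
    then obtain n :: nat where "1 / Suc n \<le> infdist x (- U)" by auto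
    then have "0 < infdist x (- U)"
      by (rule less_le_trans[rotated]) simp
    then show "x \<in> U"
      by (metis ComplI infdist_zero less_irrefl)
  qed
  moreover have "closed {x. 1 / Suc n \<le> infdist x (- U)}" for n
    by (intro closed_Collect_le continuous_intros)
  then have "closed_projection (\<Union>n::nat. {x. 1 / Suc n \<le> infdist x (- U)})"
    by (intro closed_projection_UN closed_projection_closed)
  ultimately show ?thesis by simp
qed

text \<open>
  Closed projections are not closed under complements, so the induction over Borel sets carries a
  set together with its complement.
\<close>
lemma borel_closed_projection:
  assumes "B \<in> sets borel"
  shows "closed_projection B"
proof -
  have "B \<in> sigma_sets UNIV {S. open S}"
    using assms by (simp add: sets_borel)
  then have "closed_projection B \<and> closed_projection (- B)"
  proof induction
    case (Basic S)
    then show ?case by (auto intro: closed_projection_open closed_projection_closed)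
  next
    case Empty
    then show ?case by (auto intro: closed_projection_closed)
  next
    case (Compl S)
    then show ?case by (simp add: Compl_eq_Diff_UNIV[symmetric])
  next
    case (Union S)
    then show ?case
      by (auto simp: Compl_UN intro!: closed_projection_UN closed_projection_INT)
  qed
  then show ?thesis ..
qed

section \<open>Novikov's separation theorem\<close>

definition borel_separated :: "(nat \<Rightarrow> 'x::topological_space set) \<Rightarrow> bool" where
  "borel_separated E \<longleftrightarrow> (\<exists>B. (\<forall>n. B n \<in> sets borel \<and> E n \<subseteq> B n) \<and> (\<Inter>n. B n) = {})"

lemma borel_separated_if_empty:
  assumes "E i = {}"
  shows "borel_separated E"
  unfolding borel_separated_def
proof (intro exI[of _ "\<lambda>n. if n = i then {} else UNIV"] conjI allI)
  show "(\<Inter>n. if n = i then {} else UNIV) = {}"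
    using INF_lower[of i UNIV "\<lambda>n. if n = i then {} else UNIV"] by simp
qed (use assms in auto)

lemma borel_separated_if_disjoint_opens:
  assumes "open U" "open V" "U \<inter> V = {}" "E i \<subseteq> U" "E j \<subseteq> V"
  shows "borel_separated E"
proof (cases "i = j")
  case True
  then show ?thesis
    using assms by (intro borel_separated_if_empty[of _ i]) auto
next
  case False
  then show ?thesis
    unfolding borel_separated_def
  proof (intro exI[of _ "\<lambda>n. if n = i then U else if n = j then V else UNIV"] conjI allI)
    show "(\<Inter>n. if n = i then U else if n = j then V else UNIV) = {}" (is "(\<Inter>n. ?B n) = {}")
    proof -
      have "(\<Inter>n. ?B n) \<subseteq> ?B i \<inter> ?B j" by (intro Int_greatest INF_lower UNIV_I)
      then show ?thesis using False assms(3) by simp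
    qed
  qed (use assms in auto)
qed

text \<open>
  For unions in the \<open>i\<close>-th place take the union of the \<open>i\<close>-th separating sets and the intersection of
  all others.  Contrapositively, a sequence that cannot be separated stays so when one of its
  members is replaced by a suitable piece of a countable decomposition.
\<close>
lemma borel_separated_UN:
  assumes "\<And>j::nat. borel_separated (E(i := D j))"
  shows "borel_separated (E(i := \<Union>j. D j))"
proof -
  obtain B where B: "\<And>j n. B j n \<in> sets borel" "\<And>j n. (E(i := D j)) n \<subseteq> B j n"
      "\<And>j. (\<Inter>n. B j n) = {}"
    using assms unfolding borel_separated_def by metis
  define B' where "B' n = (if n = i then \<Union>j. B j i else \<Inter>j. B j n)" for n
  have "B' n \<in> sets borel" for n
    using B(1) by (auto simp: B'_def)
  moreover have "(E(i := \<Union>j. D j)) n \<subseteq> B' n" for n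
  proof (cases "n = i")
    case True
    then show ?thesis using B(2)[of _ i] by (auto simp: B'_def)
  next
    case False
    then show ?thesis using B(2)[where n = n] by (simp add: B'_def INT_greatest)
  qed
  moreover have "(\<Inter>n. B' n) = {}"
  proof (rule ccontr)
    assume "(\<Inter>n. B' n) \<noteq> {}"
    then obtain x where x: "\<And>n. x \<in> B' n" by auto
    from x[of i] obtain j where "x \<in> B j i" by (auto simp: B'_def)
    moreover have "x \<in> B j n" if "n \<noteq> i" for n
      using x[of n] that by (auto simp: B'_def)
    ultimately have "x \<in> B j n" for n
      by (cases "n = i") auto
    then have "x \<in> (\<Inter>n. B j n)" by simp
    then show False using B(3) by simp
  qed
  ultimately show ?thesis
    unfolding borel_separated_def by blast
qed

lemma small_closed_cover:
  fixes e :: real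
  assumes "0 < e"
  obtains F :: "nat \<Rightarrow> 'z::{metric_space, second_countable_topology} set"
  where "\<And>j. closed (F j)" "\<And>j p q. p \<in> F j \<Longrightarrow> q \<in> F j \<Longrightarrow> dist p q < e" "(\<Union>j. F j) = UNIV"
proof -
  obtain D :: "'z set" where D: "countable D" "\<And>X. open X \<Longrightarrow> X \<noteq> {} \<Longrightarrow> \<exists>d\<in>D. d \<in> X"
    by (rule countable_dense_setE) blast
  have "D \<noteq> {}" using D(2)[of UNIV] by auto
  define F where "F j = cball (from_nat_into D j) (e / 3)" for j
  show thesis
  proof (rule that)
    show "closed (F j)" for j by (simp add: F_def)
    show "dist p q < e" if "p \<in> F j" "q \<in> F j" for j p q
      using that assms dist_triangle3[of p q "from_nat_into D j"] by (simp add: F_def)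
    show "(\<Union>j. F j) = UNIV"
    proof (intro set_eqI iffI UNIV_I)
      fix z :: 'z
      obtain d where "d \<in> D" "d \<in> ball z (e / 3)"
        using D(2)[of "ball z (e / 3)"] assms by auto
      moreover from \<open>d \<in> D\<close> obtain j where "d = from_nat_into D j"
        by (metis D(1) from_nat_into_surj)
      ultimately show "z \<in> (\<Union>j. F j)"
        by (intro UN_I[of j]) (simp_all add: F_def dist_commute)
    qed
  qed
qed

text \<open>
  Finitely many members of a nonseparable sequence can be cut down to small diameter, one after
  another.
\<close>
lemma refine_not_borel_separated:
  fixes C :: "nat \<Rightarrow> ('x::{metric_space, second_countable_topology} \<times> 'w::{metric_space, second_countable_topology}) set"
  assumes "0 < e" "\<And>i. closed (C i)" "\<not> borel_separated (\<lambda>i. fst ` C i)"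
  shows "\<exists>C'. (\<forall>i. closed (C' i) \<and> C' i \<subseteq> C i) \<and> \<not> borel_separated (\<lambda>i. fst ` C' i) \<and>
    (\<forall>i<k. \<forall>p\<in>C' i. \<forall>q\<in>C' i. dist p q < e)"
proof (induction k)
  case 0
  then show ?case using assms by (intro exI[of _ C]) simp
next
  case (Suc k)
  then obtain C' where C': "\<And>i. closed (C' i)" "\<And>i. C' i \<subseteq> C i" "\<not> borel_separated (\<lambda>i. fst ` C' i)"
      "\<And>i p q. i < k \<Longrightarrow> p \<in> C' i \<Longrightarrow> q \<in> C' i \<Longrightarrow> dist p q < e"
    by blast
  obtain F :: "nat \<Rightarrow> ('x \<times> 'w) set" where F: "\<And>j. closed (F j)" 
      "\<And>j p q. p \<in> F j \<Longrightarrow> q \<in> F j \<Longrightarrow> dist p q < e" "(\<Union>j. F j) = UNIV"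
    using small_closed_cover[OF assms(1)] by blast
  have "(\<lambda>i. fst ` C' i) = (\<lambda>i. fst ` C' i)(k := \<Union>j. fst ` (C' k \<inter> F j))"
  proof -
    have "C' k = (\<Union>j. C' k \<inter> F j)" using F(3) by auto
    then have "fst ` C' k = (\<Union>j. fst ` (C' k \<inter> F j))" by (metis image_UN)
    then show ?thesis by (simp add: fun_eq_iff)
  qed
  then obtain j where j: "\<not> borel_separated ((\<lambda>i. fst ` C' i)(k := fst ` (C' k \<inter> F j)))"
    using borel_separated_UN[of "\<lambda>i. fst ` C' i" k "\<lambda>j. fst ` (C' k \<inter> F j)"] C'(3) by metis
  moreover have "(\<lambda>i. fst ` C' i)(k := fst ` (C' k \<inter> F j)) = (\<lambda>i. fst ` (C'(k := C' k \<inter> F j)) i)"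
    by (simp add: fun_eq_iff)
  ultimately show ?case
    using C' F by (intro exI[of _ "C'(k := C' k \<inter> F j)"]) (auto simp: less_Suc_eq)
qed

text \<open>
  Suppose the projections are not separable.  Repeated refinement shrinks every \<open>C i\<close> to a point
  \<open>p i\<close>, keeping nonseparability.  Since the projections have no common point, two of the points
  \<open>fst (p i)\<close> differ, and disjoint neighbourhoods of them separate a sufficiently fine stage.
\<close>
lemma novikov_separation_closed:
  fixes C :: "nat \<Rightarrow> ('x::{complete_space, second_countable_topology} \<times> 'w::{complete_space, second_countable_topology}) set"
  assumes "\<And>i. closed (C i)" "(\<Inter>i. fst ` C i) = {}"
  shows "borel_separated (\<lambda>i. fst ` C i)"
proof (rule ccontr)
  assume ns: "\<not> borel_separated (\<lambda>i. fst ` C i)"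
  let ?P = "\<lambda>k::nat. \<lambda>C'. (\<forall>i. closed (C' i) \<and> C' i \<subseteq> C i) \<and> \<not> borel_separated (\<lambda>i. fst ` C' i)"
  \<comment> \<open>At stage \<open>k\<close> only the first \<open>k\<close> sets are made small; each index is reached eventually.\<close>
  let ?Q = "\<lambda>(k::nat) C' C''. (\<forall>i. C'' i \<subseteq> C' i) \<and> (\<forall>i<k. \<forall>p\<in>C'' i. \<forall>q\<in>C'' i. dist p q < 1 / Suc k)"
  have "\<exists>K. \<forall>k. ?P k (K k) \<and> ?Q k (K k) (K (Suc k))"
  proof (rule dependent_nat_choice)
    show "\<exists>C'. ?P 0 C'"
      using assms(1) ns by (intro exI[of _ C]) simp
    show "\<exists>C''. ?P (Suc k) C'' \<and> ?Q k C' C''" if "?P k C'" for k C'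
    proof -
      have "\<exists>C''. (\<forall>i. closed (C'' i) \<and> C'' i \<subseteq> C' i) \<and> \<not> borel_separated (\<lambda>i. fst ` C'' i) \<and>
          (\<forall>i<k. \<forall>p\<in>C'' i. \<forall>q\<in>C'' i. dist p q < 1 / Suc k)"
        using that by (intro refine_not_borel_separated) auto
      then obtain C'' where "\<forall>i. closed (C'' i) \<and> C'' i \<subseteq> C' i" "\<not> borel_separated (\<lambda>i. fst ` C'' i)"
          "\<forall>i<k. \<forall>p\<in>C'' i. \<forall>q\<in>C'' i. dist p q < 1 / Suc k"
        by blast
      then show ?thesis using that by (intro exI[of _ C'']) (simp, blast)
    qed
  qed
  then obtain K where K: "\<forall>k. ?P k (K k) \<and> ?Q k (K k) (K (Suc k))" ..
  have K_closed: "closed (K k i)" and K_sub: "K k i \<subseteq> C i" and K_sep: "\<not> borel_separated (\<lambda>i. fst ` K k i)"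
    and K_dec: "K (Suc k) i \<subseteq> K k i" for k i
    using K by simp_all
  have K_small: "dist p q < 1 / Suc k" if "i < k" "p \<in> K (Suc k) i" "q \<in> K (Suc k) i" for p q i k
    using K that by simp
  have dec: "K n i \<subseteq> K m i" if "m \<le> n" for m n i
    by (rule lift_Suc_antimono_le[of "\<lambda>k. K k i", OF K_dec that])
  have small: "\<exists>n. \<forall>p\<in>K n i. \<forall>q\<in>K n i. dist p q < e" if "0 < e" for i e
  proof -
    obtain n0 where n0: "1 / Suc n0 < e"
      using nat_approx_posE[OF \<open>0 < e\<close>] by blast
    define n where "n = max n0 (Suc i)"
    have "1 / Suc n \<le> 1 / Suc n0"
      by (simp add: n_def frac_le)
    moreover have "dist p q < 1 / Suc n" if "p \<in> K (Suc n) i" "q \<in> K (Suc n) i" for p q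
      using K_small[of i n p q] that by (simp add: n_def)
    ultimately show ?thesis
      using n0 by (intro exI[of _ "Suc n"]) force
  qed
  have ne: "K n i \<noteq> {}" for n i
    using K_sep[of n] borel_separated_if_empty[of "\<lambda>i. fst ` K n i" i] by auto
  have "\<exists>p. \<forall>n. p \<in> K n i" for i
  proof -
    obtain a where "\<And>n. a \<in> K n i"
      by (rule decreasing_closed_nest[of "\<lambda>n. K n i", OF K_closed ne]) (use dec small that in blast)+
    then show ?thesis by (intro exI[of _ a]) simp
  qed
  then obtain p where p: "\<And>i n. p i \<in> K n i" by metis
  have "fst (p i) \<in> fst ` C i" for i
    using p[of i 0] K_sub[of 0 i] by auto
  then obtain i where "fst (p i) \<noteq> fst (p 0)"
    using assms(2) by (metis (no_types, lifting) INT_I empty_iff)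
  then obtain U V where UV: "open U" "open V" "fst (p i) \<in> U" "fst (p 0) \<in> V" "U \<inter> V = {}"
    by (meson hausdorff)
  have inside: "\<exists>n. \<forall>m\<ge>n. fst ` K m i \<subseteq> U" if U: "open U" "fst (p i) \<in> U" for i U
  proof -
    obtain e where e: "0 < e" "ball (fst (p i)) e \<subseteq> U"
      using U by (meson open_contains_ball)
    obtain n where n: "\<forall>r\<in>K n i. \<forall>q\<in>K n i. dist r q < e"
      using small[OF e(1), of i] by (elim exE) (rule that)
    have "fst ` K m i \<subseteq> U" if "n \<le> m" for m
    proof
      fix x assume "x \<in> fst ` K m i"
      then obtain q where q: "q \<in> K n i" "x = fst q"
        using dec[OF \<open>n \<le> m\<close>, of i] by auto
      then have "dist (p i) q < e" using n p by blast
      then have "dist (fst (p i)) x < e"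
        using dist_fst_le[of "p i" q] q by simp
      then show "x \<in> U" using e by auto
    qed
    then show ?thesis by blast
  qed
  obtain n1 n2 where "\<forall>m\<ge>n1. fst ` K m i \<subseteq> U" "\<forall>m\<ge>n2. fst ` K m 0 \<subseteq> V"
    using inside[OF UV(1,3)] inside[OF UV(2,4)] by blast
  then have "borel_separated (\<lambda>i. fst ` K (max n1 n2) i)"
    using UV by (intro borel_separated_if_disjoint_opens[of U V _ i 0]) auto
  then show False using K_sep by simp
qed

theorem novikov_separation:
  fixes E :: "nat \<Rightarrow> ('x::{complete_space, second_countable_topology} \<times> 'w::{complete_space, second_countable_topology}) set"
  assumes "\<And>i. E i \<in> sets borel" "(\<Inter>i. fst ` E i) = {}"
  shows "borel_separated (\<lambda>i. fst ` E i)"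
proof -
  obtain C :: "nat \<Rightarrow> (('x \<times> 'w) \<times> (nat \<Rightarrow> nat discrete)) set"
    where C: "\<And>i. closed (C i)" "\<And>i. E i = fst ` C i"
    using borel_closed_projection[OF assms(1)] unfolding closed_projection_def by metis
  define g :: "'x \<times> 'w \<times> (nat \<Rightarrow> nat discrete) \<Rightarrow> ('x \<times> 'w) \<times> (nat \<Rightarrow> nat discrete)"
    where "g = (\<lambda>(x, w, v). ((x, w), v))"
  have "continuous_on UNIV g"
    unfolding g_def split_beta by (intro continuous_intros)
  then have "closed (g -` C i)" for i
    using C(1) by (intro closed_vimage) auto
  moreover have eq: "fst ` E i = fst ` (g -` C i)" for i
  proof (intro set_eqI iffI)
    fix x assume "x \<in> fst ` E i"
    then obtain w v where "((x, w), v) \<in> C i"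
      by (auto simp: C(2))
    then have "(x, w, v) \<in> g -` C i" by (simp add: g_def)
    then show "x \<in> fst ` (g -` C i)" by force
  next
    fix x assume "x \<in> fst ` (g -` C i)"
    then show "x \<in> fst ` E i"
      by (auto simp: C(2) g_def intro!: rev_image_eqI)
  qed
  ultimately show ?thesis
    using assms(2) novikov_separation_closed[of "\<lambda>i. g -` C i"] by simp
qed

corollary lusin_separation:
  fixes E F :: "('x::{complete_space, second_countable_topology} \<times> 'w::{complete_space, second_countable_topology}) set"
  assumes "E \<in> sets borel" "F \<in> sets borel" "fst ` E \<inter> fst ` F = {}"
  obtains B where "B \<in> sets borel" "fst ` E \<subseteq> B" "fst ` F \<inter> B = {}"
proof -
  have "borel_separated (\<lambda>i::nat. fst ` (if i = 0 then E else F))"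
  proof (rule novikov_separation)
    have "(\<Inter>i::nat. fst ` (if i = 0 then E else F)) \<subseteq> fst ` E \<inter> fst ` F"
      using INF_lower[of "0::nat" UNIV "\<lambda>i. fst ` (if i = 0 then E else F)"]
        INF_lower[of "1::nat" UNIV "\<lambda>i. fst ` (if i = 0 then E else F)"] by simp
    then show "(\<Inter>i::nat. fst ` (if i = 0 then E else F)) = {}"
      using assms(3) by simp
  qed (use assms in simp)
  then obtain B where B: "\<And>n. B n \<in> sets borel" "\<And>n::nat. fst ` (if n = 0 then E else F) \<subseteq> B n" "(\<Inter>n. B n) = {}"
    unfolding borel_separated_def by blast
  have "fst ` F \<inter> B 0 = {}"
  proof (rule ccontr)
    assume "fst ` F \<inter> B 0 \<noteq> {}"
    then obtain x where x: "x \<in> fst ` F" "x \<in> B 0" by blast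
    have "x \<in> B n" for n
      using x B(2)[of n] by (cases "n = 0") auto
    then show False using B(3) by blast
  qed
  with B(1)[of 0] B(2)[of 0] that show thesis by simp
qed

section \<open>Borel sets with open or compact sections\<close>

lemma
  shows fst_borel_measurable: "(fst :: 'x::second_countable_topology \<times> 'y::second_countable_topology \<Rightarrow> 'x) \<in> borel_measurable borel"
    and snd_borel_measurable: "(snd :: 'x::second_countable_topology \<times> 'y::second_countable_topology \<Rightarrow> 'y) \<in> borel_measurable borel"
  by (intro borel_measurable_continuous_onI continuous_intros)+

text \<open>
  The set \<open>Z n\<close> of all \<open>x\<close> with \<open>{x} \<times> V n \<subseteq> A\<close> is only coanalytic, but the rectangles \<open>Z n \<times> V n\<close> exhaust
  \<open>A\<close>.  Novikov's theorem for the analytic remainders \<open>A - Z n \<times> V n\<close> gives Borel sets \<open>A - C n\<close> inside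
  the rectangles which still exhaust \<open>A\<close>; then Lusin's theorem puts a Borel set \<open>B n\<close> between the
  projection of \<open>A - C n\<close> and \<open>Z n\<close>.
\<close>
theorem borel_open_sections_as_rectangles:
  fixes A :: "('x::{complete_space, second_countable_topology} \<times> 'y::{complete_space, second_countable_topology}) set"
    and V :: "nat \<Rightarrow> 'y set"
  assumes A: "A \<in> sets borel" and V: "\<And>n. open (V n)"
    and cover: "\<And>x y. (x, y) \<in> A \<Longrightarrow> \<exists>n. y \<in> V n \<and> {x} \<times> V n \<subseteq> A"
  obtains B where "\<And>n. B n \<in> sets borel" "A = (\<Union>n. B n \<times> V n)"
proof -
  define W where "W n = {(x, y). y \<in> V n \<and> (x, y) \<notin> A}" for n
  define Z where "Z n = - fst ` W n" for n
  have meas1: "(\<lambda>p :: ('x \<times> 'y) \<times> 'y. (fst (fst p), snd p)) \<in> borel_measurable borel"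
    by (intro borel_measurable_continuous_onI continuous_intros)
  have [measurable]: "V n \<in> sets borel" for n
    using V by simp
  have VB: "snd -` V n \<in> sets (borel :: ('x \<times> 'y) measure)" for n
    using measurable_sets[OF snd_borel_measurable, of "V n"] by simp
  have W: "W n \<in> sets borel" for n
  proof -
    have "W n = snd -` V n - A" by (auto simp: W_def)
    then show ?thesis using A VB by auto
  qed
  \<comment> \<open>Borel in the product with one further copy of \<open>'y\<close>, and projecting onto \<open>A - Z n \<times> V n\<close>.\<close>
  define E where "E n = {p :: ('x \<times> 'y) \<times> 'y. fst p \<in> A \<and> (snd (fst p) \<notin> V n \<or> (fst (fst p), snd p) \<in> W n)}" for n
  have "E n \<in> sets borel" for n
  proof -
    have "E n = (fst -` A) \<inter> (fst -` (- (snd -` V n)) \<union> (\<lambda>p. (fst (fst p), snd p)) -` W n)"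
      by (auto simp: E_def)
    moreover have "fst -` A \<in> sets (borel :: (('x \<times> 'y) \<times> 'y) measure)"
      "fst -` (- (snd -` V n)) \<in> sets (borel :: (('x \<times> 'y) \<times> 'y) measure)"
      "(\<lambda>p. (fst (fst p), snd p)) -` W n \<in> sets (borel :: (('x \<times> 'y) \<times> 'y) measure)"
      using measurable_sets[OF fst_borel_measurable A]
        measurable_sets[OF fst_borel_measurable borel_comp[OF VB[of n]]]
        measurable_sets[OF meas1 W[of n]] by (simp_all only: space_borel Int_UNIV_right)
    ultimately show ?thesis by auto
  qed
  moreover have fE: "fst ` E n = A - Z n \<times> V n" for n
  proof (intro set_eqI iffI)
    fix p assume "p \<in> fst ` E n"
    then obtain y where "fst (p, y) \<in> A" "snd p \<notin> V n \<or> (fst p, y) \<in> W n"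
      by (auto simp: E_def)
    then show "p \<in> A - Z n \<times> V n"
      by (auto simp: Z_def intro: rev_image_eqI)
  next
    fix p assume p: "p \<in> A - Z n \<times> V n"
    obtain x y where xy: "p = (x, y)" by (cases p)
    have "\<exists>y'. y \<notin> V n \<or> (x, y') \<in> W n"
      using p by (auto simp: Z_def xy)
    then obtain y' where "((x, y), y') \<in> E n"
      using p xy by (auto simp: E_def)
    then show "p \<in> fst ` E n" using xy by force
  qed
  moreover have "(\<Inter>n. fst ` E n) = {}"
  proof -
    have "\<exists>n. p \<notin> fst ` E n" for p
    proof (cases p)
      case (Pair x y)
      have "\<exists>n. (x, y) \<notin> fst ` E n"
      proof (cases "(x, y) \<in> A")
        case True
        then obtain n where n: "y \<in> V n" "{x} \<times> V n \<subseteq> A" using cover by blast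
        then have "x \<in> Z n" by (auto simp: Z_def W_def)
        then show ?thesis using n fE by blast
      next
        case False
        then show ?thesis using fE by blast
      qed
      then show ?thesis using Pair by simp
    qed
    then show ?thesis by blast
  qed
  ultimately have "borel_separated (\<lambda>n. fst ` E n)"
    using novikov_separation[of E] by blast
  then obtain C where C: "\<And>n. C n \<in> sets borel" "\<And>n. fst ` E n \<subseteq> C n" "(\<Inter>n. C n) = {}"
    unfolding borel_separated_def by metis
  have D: "A - C n \<subseteq> Z n \<times> V n" for n
    using C(2)[of n] fE[of n] by blast
  have "\<exists>B. B \<in> sets borel \<and> fst ` (A - C n) \<subseteq> B \<and> fst ` W n \<inter> B = {}" for n
  proof (rule lusin_separation[of "A - C n" "W n"])
    show "A - C n \<in> sets borel" using A C(1) by auto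
    show "W n \<in> sets borel" by (rule W)
    show "fst ` (A - C n) \<inter> fst ` W n = {}"
    proof -
      have "fst p \<notin> fst ` W n" if "p \<in> A - C n" for p
        using subsetD[OF D that] by (simp add: Z_def mem_Times_iff)
      then show ?thesis by blast
    qed
  qed blast
  then obtain B where B: "\<And>n. B n \<in> sets borel" "\<And>n. fst ` (A - C n) \<subseteq> B n" "\<And>n. fst ` W n \<inter> B n = {}"
    by metis
  have "A = (\<Union>n. B n \<times> V n)"
  proof (intro set_eqI iffI)
    fix p assume p: "p \<in> A"
    then obtain n where "p \<notin> C n" using C(3) by blast
    then have "p \<in> B n \<times> V n"
      using p D[of n] B(2)[of n] by (auto simp: mem_Times_iff)
    then show "p \<in> (\<Union>n. B n \<times> V n)" by auto
  next
    fix p assume "p \<in> (\<Union>n. B n \<times> V n)"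
    then obtain n where n: "fst p \<in> B n" "snd p \<in> V n" by auto
    show "p \<in> A"
    proof (rule ccontr)
      assume "p \<notin> A"
      then have "p \<in> W n" using n(2) by (auto simp: W_def split: prod.split)
      then show False using n(1) B(3)[of n] by blast
    qed
  qed
  with B(1) that show thesis by blast
qed

text \<open>
  The least \<open>n\<close> with \<open>K `` {x} \<subseteq> U n\<close> need not depend measurably on \<open>x\<close>; separating the analytic sets
  of those \<open>x\<close> where \<open>n\<close> fails gives a measurable choice.
\<close>
lemma borel_sections_measurable_bound:
  fixes K :: "('x::{complete_space, second_countable_topology} \<times> 'y::{complete_space, second_countable_topology}) set"
    and U :: "nat \<Rightarrow> 'y set"
  assumes K: "K \<in> sets borel" and U: "\<And>n. open (U n)"
    and bound: "\<And>x. \<exists>n. K `` {x} \<subseteq> U n"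
  obtains N :: "'x \<Rightarrow> nat" where "N \<in> borel \<rightarrow>\<^sub>M count_space UNIV" "\<And>x. K `` {x} \<subseteq> U (N x)"
proof -
  have "borel_separated (\<lambda>n. fst ` (K - snd -` U n))"
  proof (rule novikov_separation)
    show "K - snd -` U n \<in> sets borel" for n
      using K measurable_sets[OF snd_borel_measurable, of "U n"] U by auto
    show "(\<Inter>n. fst ` (K - snd -` U n)) = {}"
    proof -
      have "\<exists>n. x \<notin> fst ` (K - snd -` U n)" for x
        using bound[of x] by (force simp: subset_eq)
      then show ?thesis by auto
    qed
  qed
  then obtain B where B: "\<And>n. B n \<in> sets borel" "\<And>n. fst ` (K - snd -` U n) \<subseteq> B n" "(\<Inter>n. B n) = {}"
    unfolding borel_separated_def by metis
  define N where "N x = (LEAST n. x \<notin> B n)" for x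
  have N: "x \<notin> B (N x)" for x
  proof -
    have "\<exists>n. x \<notin> B n" using B(3) by blast
    then show ?thesis unfolding N_def by (rule LeastI_ex)
  qed
  show thesis
  proof (rule that)
    have [measurable]: "Measurable.pred borel (\<lambda>x. x \<notin> B n)" for n
      using B(1) by measurable
    show "N \<in> borel \<rightarrow>\<^sub>M count_space UNIV"
      unfolding N_def by measurable
    show "K `` {x} \<subseteq> U (N x)" for x
    proof
      fix y assume "y \<in> K `` {x}"
      then show "y \<in> U (N x)"
        using N[of x] B(2)[of "N x"] by (force simp: image_subset_iff)
    qed
  qed
qed

text \<open>
  Only countably many sets \<open>W i c\<close> occur, so nonemptiness is decided by countably many values of the
  functions \<open>h i\<close>, whatever the sets are.
\<close>
lemma countable_valued_section_borel:
  fixes h :: "nat \<Rightarrow> 'x \<Rightarrow> 'c::countable" and W :: "nat \<Rightarrow> 'c \<Rightarrow> 'y set"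
  assumes [measurable]: "\<And>i. h i \<in> M \<rightarrow>\<^sub>M count_space UNIV"
  shows "Measurable.pred M (\<lambda>x. S \<inter> (\<Inter>i<n. W i (h i x)) \<noteq> {})"
proof (induction n arbitrary: S)
  case 0
  then show ?case by simp
next
  case (Suc n)
  have eq: "(S \<inter> (\<Inter>i<Suc n. W i (h i x)) \<noteq> {}) \<longleftrightarrow>
      (\<exists>c. h n x = c \<and> (S \<inter> W n c) \<inter> (\<Inter>i<n. W i (h i x)) \<noteq> {})" for x
    by (simp add: lessThan_Suc INT_insert Int_assoc)
  show ?case
    unfolding eq using Suc[of "S \<inter> W n c" for c] by measurable
qed

text \<open>
  Kuratowski's form of Cantor's intersection theorem: a sequence of points \<open>y n \<in> F n\<close> is totally
  bounded, hence has compact closure.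
\<close>
lemma totally_bounded_nest:
  fixes F :: "nat \<Rightarrow> 'y::complete_space set"
  assumes closed: "\<And>n. closed (F n)" and ne: "\<And>n. F n \<noteq> {}" and dec: "\<And>m n. m \<le> n \<Longrightarrow> F n \<subseteq> F m"
    and tb: "\<And>e. 0 < e \<Longrightarrow> \<exists>n T. finite T \<and> F n \<subseteq> (\<Union>t\<in>T. ball t e)"
  shows "(\<Inter>n. F n) \<noteq> {}"
proof -
  have "\<forall>n. \<exists>y. y \<in> F n" using ne by auto
  then obtain y where y: "\<And>n. y n \<in> F n" by metis
  define Q where "Q = closure (range y)"
  have "\<exists>T. finite T \<and> Q \<subseteq> (\<Union>t\<in>T. ball t e)" if "0 < e" for e
  proof -
    obtain n T where T: "finite T" "F n \<subseteq> (\<Union>t\<in>T. ball t (e / 2))"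
      using tb[of "e / 2"] \<open>0 < e\<close> by auto
    let ?T = "T \<union> y ` {..<n}"
    have "range y \<subseteq> (\<Union>t\<in>?T. cball t (e / 2))"
    proof safe
      fix k
      show "y k \<in> (\<Union>t\<in>?T. cball t (e / 2))"
      proof (cases "k < n")
        case True
        then show ?thesis using \<open>0 < e\<close> by (intro UN_I[of "y k"]) auto
      next
        case False
        then have "y k \<in> F n" using y[of k] dec[of n k] by auto
        then obtain t where "t \<in> T" "y k \<in> ball t (e / 2)" using T(2) by blast
        then show ?thesis by (intro UN_I[of t]) auto
      qed
    qed
    moreover have "closed (\<Union>t\<in>?T. cball t (e / 2))"
      using T(1) by (intro closed_UN) auto
    ultimately have "Q \<subseteq> (\<Union>t\<in>?T. cball t (e / 2))"
      unfolding Q_def by (rule closure_minimal)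
    also have "\<dots> \<subseteq> (\<Union>t\<in>?T. ball t e)"
      using \<open>0 < e\<close> by (intro UN_mono) auto
    finally show ?thesis using T(1) by (intro exI[of _ ?T]) auto
  qed
  then have "compact Q"
    by (simp add: compact_eq_totally_bounded Q_def complete_eq_closed)
  then have "Q \<inter> (\<Inter>n\<in>UNIV. F n) \<noteq> {}"
  proof (rule compact_imp_fip_image)
    show "closed (F n)" for n by (rule closed)
    show "Q \<inter> (\<Inter>n\<in>I. F n) \<noteq> {}" if "finite I" for I
    proof -
      have "y (Max (insert 0 I)) \<in> F n" if "n \<in> I" for n
        using y dec[of n "Max (insert 0 I)"] that \<open>finite I\<close> by (meson Max_ge finite_insert insertI2 subsetD)
      moreover have "y (Max (insert 0 I)) \<in> Q"
        unfolding Q_def by (intro subsetD[OF closure_subset] rangeI)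
      ultimately have "y (Max (insert 0 I)) \<in> Q \<inter> (\<Inter>n\<in>I. F n)" by simp
      then show ?thesis by blast
    qed
  qed
  then show ?thesis by blast
qed
lemma nested_compact_nonempty:
  fixes F :: "nat \<Rightarrow> 'a::t2_space set"
  assumes "\<And>n. compact (F n)" "\<And>n. F n \<noteq> {}" "\<And>n. F (Suc n) \<subseteq> F n"
  shows "(\<Inter>n. F n) \<noteq> {}"
proof -
  have dec: "F n \<subseteq> F m" if "m \<le> n" for m n
    by (rule lift_Suc_antimono_le[of F, OF assms(3) that])
  have "F 0 \<inter> (\<Inter>n\<in>UNIV. F n) \<noteq> {}"
  proof (rule compact_imp_fip_image[OF assms(1)])
    show "closed (F n)" for n
      by (rule compact_imp_closed[OF assms(1)])
    show "F 0 \<inter> (\<Inter>n\<in>I. F n) \<noteq> {}" if "finite I" for I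
    proof -
      obtain a where a: "a \<in> F (Max (insert 0 I))" using assms(2) by blast
      have "a \<in> F n" if "n \<in> insert 0 I" for n
        using subsetD[OF dec a] Max_ge[OF _ that] \<open>finite I\<close> by simp
      then have "a \<in> F 0 \<inter> (\<Inter>n\<in>I. F n)" by simp
      then show ?thesis by blast
    qed
  qed
  then show ?thesis by blast
qed

lemma dense_enumeration:
  obtains d :: "nat \<Rightarrow> 'y::{metric_space, second_countable_topology}"
  where "\<And>y e. 0 < e \<Longrightarrow> \<exists>j. dist y (d j) < e"
proof -
  obtain D :: "'y set" where D: "countable D" "\<And>X. open X \<Longrightarrow> X \<noteq> {} \<Longrightarrow> \<exists>d\<in>D. d \<in> X"
    by (rule countable_dense_setE) blast
  show thesis
  proof (rule that[of "from_nat_into D"])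
    fix y :: 'y and e :: real assume "0 < e"
    then obtain d where "d \<in> D" "d \<in> ball y e"
      using D(2)[of "ball y e"] by auto
    moreover from \<open>d \<in> D\<close> obtain j where "d = from_nat_into D j"
      by (metis D(1) from_nat_into_surj)
    ultimately show "\<exists>j. dist y (from_nat_into D j) < e"
      by (intro exI[of _ j]) simp
  qed
qed

lemma compact_sections_open_complement:
  fixes K :: "('x::{complete_space, second_countable_topology} \<times> 'y::{complete_space, second_countable_topology}) set"
  assumes K: "K \<in> sets borel" and cpt: "\<And>x. compact (K `` {x})"
  obtains B and V :: "nat \<Rightarrow> 'y set" where "\<And>n. B n \<in> sets borel" "\<And>n. open (V n)" "- K = (\<Union>n. B n \<times> V n)"
proof -
  obtain \<B> :: "'y set set" where base: "countable \<B>" "topological_basis \<B>"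
    using ex_countable_basis by blast
  have "\<B> \<noteq> {}"
    using base(2) by (metis UNIV_I empty_iff open_UNIV topological_basisE)
  define V where "V = from_nat_into \<B>"
  have V: "open (V n)" for n
    using base(2) from_nat_into[OF \<open>\<B> \<noteq> {}\<close>] by (simp add: V_def topological_basis_open)
  have "\<exists>n. y \<in> V n \<and> {x} \<times> V n \<subseteq> - K" if "(x, y) \<in> - K" for x y
  proof -
    have "open (- (K `` {x}))" using compact_imp_closed[OF cpt] by (rule open_Compl)
    moreover have "y \<in> - (K `` {x})" using that by simp
    ultimately obtain U where U: "U \<in> \<B>" "y \<in> U" "U \<subseteq> - (K `` {x})"
      by (rule topological_basisE[OF base(2)])
    from U(1) obtain n where "V n = U"
      unfolding V_def by (metis base(1) from_nat_into_surj)
    then show ?thesis using U by (intro exI[of _ n]) auto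
  qed
  then obtain B where "\<And>n. B n \<in> sets borel" "- K = (\<Union>n. B n \<times> V n)"
    by (rule borel_open_sections_as_rectangles[OF borel_comp[OF K] V]) (assumption | rule that)+
  from this(1) V this(2) show thesis by (rule that)
qed

text \<open>
  \<open>F x n\<close> is the \<open>n\<close>-th finite stage of the description of the section at \<open>x\<close>: it lies in finite unions
  of balls of radii \<open>1, \<dots>, 1/n\<close> and avoids those \<open>V i\<close> with \<open>i < n\<close> and \<open>x \<in> B i\<close>.  The balls make the stages
  totally bounded in the limit, so the section is nonempty as soon as all stages are.
\<close>
theorem compact_sections_projection_borel:
  fixes K :: "('x::{complete_space, second_countable_topology} \<times> 'y::{complete_space, second_countable_topology}) set"
  assumes K: "K \<in> sets borel" and cpt: "\<And>x. compact (K `` {x})"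
  shows "fst ` K \<in> sets borel"
proof -
  obtain B and V :: "nat \<Rightarrow> 'y set" where B: "\<And>n. B n \<in> sets borel" and V: "\<And>n. open (V n)" 
    and KBV: "- K = (\<Union>n. B n \<times> V n)"
    using compact_sections_open_complement[OF assms] by blast
  obtain d :: "nat \<Rightarrow> 'y" where d: "\<And>y e. 0 < e \<Longrightarrow> \<exists>j. dist y (d j) < e"
    by (rule dense_enumeration) blast
  define U where "U i n = (\<Union>j<n. ball (d j) (1 / Suc i))" for i n :: nat
  have "\<exists>n. K `` {x} \<subseteq> U i n" for i x
  proof -
    have "K `` {x} \<subseteq> (\<Union>j. ball (d j) (1 / Suc i))"
    proof
      fix y
      obtain j where "dist y (d j) < 1 / Suc i" using d[of "1 / Suc i" y] by auto
      then show "y \<in> (\<Union>j. ball (d j) (1 / Suc i))"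
        by (intro UN_I[of j]) (simp_all add: dist_commute)
    qed
    then obtain J where J: "finite J" "K `` {x} \<subseteq> (\<Union>j\<in>J. ball (d j) (1 / Suc i))"
      by (rule compactE_image[OF cpt, rotated]) (use that in auto)
    have "j < Suc (Max J)" if "j \<in> J" for j
      using Max_ge[OF J(1) that] by simp
    then have "J \<subseteq> {..<Suc (Max J)}" by auto
    then have "(\<Union>j\<in>J. ball (d j) (1 / Suc i)) \<subseteq> U i (Suc (Max J))"
      unfolding U_def by (rule UN_mono) simp
    then show ?thesis using J(2) by blast
  qed
  moreover have "open (U i n)" for i n
    unfolding U_def by auto
  ultimately have "\<forall>i. \<exists>N. N \<in> borel \<rightarrow>\<^sub>M count_space UNIV \<and> (\<forall>x. K `` {x} \<subseteq> U i (N x))"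
    using borel_sections_measurable_bound[OF K] by metis
  then obtain N where N: "\<And>i. N i \<in> borel \<rightarrow>\<^sub>M count_space UNIV" "\<And>i x. K `` {x} \<subseteq> U i (N i x)"
    by metis
  define h where "h i x = (N i x, x \<in> B i)" for i x
  define W where "W i c = (\<Union>j<fst c. cball (d j) (1 / Suc i)) \<inter> (if snd c then - V i else UNIV)" for i and c :: "nat \<times> bool"
  define F where "F x n = (\<Inter>i<n. W i (h i x))" for x n
  have closed_W: "closed (W i c)" for i c
    unfolding W_def using V by (intro closed_Int closed_UN) auto
  have UW: "U i n \<subseteq> (\<Union>j<n. cball (d j) (1 / Suc i))" for i n
    unfolding U_def by (intro UN_mono) auto
  have K_eq: "K `` {x} = (\<Inter>n. F x n)" for x
  proof
    have "K `` {x} \<subseteq> W i (h i x)" for i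
    proof
      fix y assume y: "y \<in> K `` {x}"
      then have "y \<in> (\<Union>j<N i x. cball (d j) (1 / Suc i))"
        using N(2)[of x i] UW[of i "N i x"] by (meson subsetD)
      moreover have "y \<notin> V i" if "x \<in> B i"
      proof
        assume "y \<in> V i"
        then have "(x, y) \<in> - K" using that KBV by blast
        then show False using y by simp
      qed
      ultimately show "y \<in> W i (h i x)"
        by (simp add: W_def h_def)
    qed
    then show "K `` {x} \<subseteq> (\<Inter>n. F x n)"
      unfolding F_def by blast
    show "(\<Inter>n. F x n) \<subseteq> K `` {x}"
    proof
      fix y assume y: "y \<in> (\<Inter>n. F x n)"
      have yW: "y \<in> W n (h n x)" for n
      proof -
        have "y \<in> F x (Suc n)" using y by blast
        then show ?thesis by (simp add: F_def lessThan_Suc)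
      qed
      show "y \<in> K `` {x}"
      proof (rule ccontr)
        assume "y \<notin> K `` {x}"
        then have "(x, y) \<in> (\<Union>n. B n \<times> V n)" using KBV by auto
        then obtain n where "x \<in> B n" "y \<in> V n" by blast
        then show False using yW[of n] by (simp add: W_def h_def)
      qed
    qed
  qed
  have nonempty_iff: "x \<in> fst ` K \<longleftrightarrow> (\<forall>n. UNIV \<inter> F x n \<noteq> {})" for x
  proof
    assume "x \<in> fst ` K"
    then obtain y where "y \<in> K `` {x}" by auto
    then show "\<forall>n. UNIV \<inter> F x n \<noteq> {}"
      unfolding K_eq by blast
  next
    assume ne: "\<forall>n. UNIV \<inter> F x n \<noteq> {}"
    have "(\<Inter>n. F x n) \<noteq> {}"
    proof (rule totally_bounded_nest)
      show "closed (F x n)" for n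
        unfolding F_def by (intro closed_INT ballI closed_W)
      show "F x n \<noteq> {}" for n using ne by simp
      show "F x n \<subseteq> F x m" if "m \<le> n" for m n
        unfolding F_def using that by (intro INF_superset_mono) auto
      show "\<exists>n T. finite T \<and> F x n \<subseteq> (\<Union>t\<in>T. ball t e)" if e: "0 < e" for e
      proof -
        obtain i where i: "1 / Suc i < e" using nat_approx_posE[OF e] by blast
        have "F x (Suc i) \<subseteq> W i (h i x)"
          unfolding F_def by (simp add: lessThan_Suc)
        also have "\<dots> \<subseteq> (\<Union>j<N i x. cball (d j) (1 / Suc i))"
          by (simp add: W_def h_def)
        also have "\<dots> \<subseteq> (\<Union>j<N i x. ball (d j) e)"
          using i by (intro UN_mono) auto
        finally have "F x (Suc i) \<subseteq> (\<Union>t\<in>d ` {..<N i x}. ball t e)" by simp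
        then show ?thesis
          by (intro exI[of _ "Suc i"] exI[of _ "d ` {..<N i x}"]) simp
      qed
    qed
    then show "x \<in> fst ` K"
      unfolding K_eq[symmetric] by force
  qed
  have h: "h i \<in> borel \<rightarrow>\<^sub>M count_space UNIV" for i
  proof -
    note N(1)[measurable]
    have [measurable]: "Measurable.pred borel (\<lambda>x. x \<in> B i)" using B by measurable
    show ?thesis unfolding h_def by measurable
  qed
  have [measurable]: "Measurable.pred borel (\<lambda>x. UNIV \<inter> F x n \<noteq> {})" for n
    unfolding F_def by (rule countable_valued_section_borel[OF h])
  have "Measurable.pred borel (\<lambda>x. x \<in> fst ` K)"
    unfolding nonempty_iff by measurable
  then show ?thesis
    by (simp add: pred_def)
qed

lemma compact_sections_closed_slice:
  assumes "K \<in> sets borel" "\<And>x. compact (K `` {x})" "closed F"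
  shows "fst ` {(x :: 'x::{complete_space, second_countable_topology}, y :: 'y::{complete_space, second_countable_topology}). (x, y) \<in> K \<and> y \<in> F} \<in> sets borel"
proof (rule compact_sections_projection_borel)
  let ?K = "{(x, y). (x, y) \<in> K \<and> y \<in> F}"
  have "?K = K \<inter> snd -` F" by auto
  then show "?K \<in> sets borel"
    using assms(1) measurable_sets[OF snd_borel_measurable, of F] assms(3) by auto
  show "compact (?K `` {x})" for x
  proof -
    have "?K `` {x} = K `` {x} \<inter> F" by auto
    then show ?thesis using assms(2,3) compact_Int_closed by metis
  qed
qed

text \<open>
  Successive approximation: at stage \<open>n\<close> the section is cut with the ball of radius \<open>1/(n+1)\<close> around the
  first point of a dense sequence whose ball it meets.  That index is a Borel function because the
  projections of the cut sets are Borel, and the centres converge to the only remaining point.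
\<close>
theorem compact_sections_borel_selector:
  fixes K :: "('x::{complete_space, second_countable_topology} \<times> 'y::{complete_space, second_countable_topology}) set"
  assumes K: "K \<in> sets borel" and cpt: "\<And>x. compact (K `` {x})"
  obtains s where "s \<in> borel_measurable borel" "\<And>x. x \<in> fst ` K \<Longrightarrow> (x, s x) \<in> K"
proof -
  obtain d :: "nat \<Rightarrow> 'y" where d: "\<And>y e. 0 < e \<Longrightarrow> \<exists>j. dist y (d j) < e"
    by (rule dense_enumeration) blast
  define r :: "nat \<Rightarrow> real" where "r n = 1 / Suc n" for n
  have r_pos: "0 < r n" for n by (simp add: r_def)
  define N where "N n L x = (LEAST j. x \<in> fst ` {(x, y). (x, y) \<in> L \<and> y \<in> cball (d j) (r n)})" for n and L :: "('x \<times> 'y) set" and x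
  define S where "S n L = {(x, y). (x, y) \<in> L \<and> y \<in> cball (d (N n L x)) (r n)}" for n and L :: "('x \<times> 'y) set"
  define KK where "KK = rec_nat K S"
  have KK: "KK 0 = K" "KK (Suc n) = S n (KK n)" for n by (simp_all add: KK_def)
  have N_meas: "N n L \<in> borel \<rightarrow>\<^sub>M count_space UNIV"
    if "L \<in> sets borel" "\<And>x. compact (L `` {x})" for n L
  proof -
    have [measurable]: "Measurable.pred borel (\<lambda>x. x \<in> fst ` {(x, y). (x, y) \<in> L \<and> y \<in> cball (d j) (r n)})" for j
      using compact_sections_closed_slice[OF that closed_cball, of "d j" "r n"] by (simp add: pred_def)
    show ?thesis unfolding N_def by measurable
  qed
  have N_ex: "\<exists>y. (x, y) \<in> L \<and> y \<in> cball (d (N n L x)) (r n)" if "x \<in> fst ` L" for n L x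
  proof -
    obtain y where y: "(x, y) \<in> L" using \<open>x \<in> fst ` L\<close> by auto
    obtain j where "dist y (d j) < r n" using d[OF r_pos] by blast
    then have "y \<in> cball (d j) (r n)" by (simp add: dist_commute)
    with y have "x \<in> fst ` {(x, y). (x, y) \<in> L \<and> y \<in> cball (d j) (r n)}" by force
    then have "x \<in> fst ` {(x', y). (x', y) \<in> L \<and> y \<in> cball (d (N n L x)) (r n)}"
      unfolding N_def by (rule LeastI)
    then show ?thesis by auto
  qed
  have dN_meas: "(\<lambda>x. d (N n L x)) \<in> borel_measurable borel"
    if "L \<in> sets borel" "\<And>x. compact (L `` {x})" for n L
    using N_meas[OF that] by (rule measurable_compose) simp
  have S_sets: "S n L \<in> sets borel" if "L \<in> sets borel" "\<And>x. compact (L `` {x})" for n L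
  proof -
    have "(\<lambda>p :: 'x \<times> 'y. dist (d (N n L (fst p))) (snd p)) \<in> borel_measurable borel"
      using measurable_compose[OF fst_borel_measurable dN_meas[OF that]] snd_borel_measurable
      by (rule borel_measurable_dist)
    then have "{p \<in> space borel. dist (d (N n L (fst p))) (snd p) \<le> r n} \<in> sets borel"
      by (rule borel_measurable_le) simp
    moreover have "S n L = L \<inter> {p \<in> space borel. dist (d (N n L (fst p))) (snd p) \<le> r n}"
      by (auto simp: S_def)
    ultimately show ?thesis using that(1) by auto
  qed
  have S_cpt: "compact (S n L `` {x})" if "\<And>x. compact (L `` {x})" for n L x
  proof -
    have "S n L `` {x} = L `` {x} \<inter> cball (d (N n L x)) (r n)" by (auto simp: S_def)
    then show ?thesis using that compact_Int_closed[OF _ closed_cball] by metis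
  qed
  have KK_ok: "KK n \<in> sets borel \<and> (\<forall>x. compact (KK n `` {x}))" for n
    by (induction n) (simp_all add: KK K cpt S_sets S_cpt)
  then have KK_sets: "KK n \<in> sets borel" and KK_cpt: "compact (KK n `` {x})" for n x by simp_all
  have KK_ne: "x \<in> fst ` KK n" if "x \<in> fst ` K" for x n
  proof (induction n)
    case 0
    then show ?case using that by (simp add: KK)
  next
    case (Suc n)
    obtain y where "(x, y) \<in> KK n" "y \<in> cball (d (N n (KK n) x)) (r n)"
      using N_ex[OF Suc] by blast
    then have "(x, y) \<in> KK (Suc n)" by (simp add: KK S_def)
    then show ?case by force
  qed
  have KK_dec: "KK (Suc n) \<subseteq> KK n" for n
    by (auto simp: KK S_def)
  \<comment> \<open>Off the projection the index is arbitrary, so a constant is used there to force convergence.\<close>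
  define s' where "s' x n = (if x \<in> fst ` K then d (N n (KK n) x) else d 0)" for x n
  define s where "s x = lim (s' x)" for x
  have lim: "s' x \<longlonglongrightarrow> s x \<and> (x \<in> fst ` K \<longrightarrow> (x, s x) \<in> K)" for x
  proof (cases "x \<in> fst ` K")
    case False
    then have "s' x = (\<lambda>n. d 0)" by (simp add: s'_def fun_eq_iff)
    then show ?thesis using False by (simp add: s_def)
  next
    case True
    have "(\<Inter>n. KK n `` {x}) \<noteq> {}"
    proof (rule nested_compact_nonempty)
      show "compact (KK n `` {x})" for n
        by (rule KK_cpt)
      show "KK n `` {x} \<noteq> {}" for n
        using KK_ne[OF True, of n] by auto
      show "KK (Suc n) `` {x} \<subseteq> KK n `` {x}" for n
        using KK_dec by blast
    qed
    then obtain y where y: "\<And>n. (x, y) \<in> KK n" by blast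
    have "norm (dist (s' x n) y) \<le> r n" for n
    proof -
      have "(x, y) \<in> S n (KK n)" using y[of "Suc n"] by (simp add: KK)
      then show ?thesis using True by (simp add: s'_def S_def)
    qed
    then have "\<forall>\<^sub>F n in sequentially. norm (dist (s' x n) y) \<le> r n"
      by (rule always_eventually[OF allI])
    moreover have "r \<longlonglongrightarrow> 0"
      unfolding r_def by (rule LIMSEQ_Suc) (rule lim_1_over_n)
    ultimately have "(\<lambda>n. dist (s' x n) y) \<longlonglongrightarrow> 0"
      by (rule Lim_null_comparison)
    then have lim_y: "s' x \<longlonglongrightarrow> y" by (rule tendsto_dist_iff[THEN iffD2])
    moreover from lim_y have "s x = y" unfolding s_def by (rule limI)
    ultimately show ?thesis using y[of 0] by (simp add: KK)
  qed
  have "(\<lambda>x. s' x n) \<in> borel_measurable borel" for n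
  proof -
    have [measurable]: "Measurable.pred borel (\<lambda>x. x \<in> fst ` K)"
      using compact_sections_projection_borel[OF K cpt] by (simp add: pred_def)
    show ?thesis
      unfolding s'_def using dN_meas[OF KK_sets KK_cpt, of n] by measurable
  qed
  then have "s \<in> borel_measurable borel"
    by (rule borel_measurable_LIMSEQ_metric[where f = "\<lambda>n x. s' x n"]) (simp add: lim)
  then show thesis by (rule that) (simp add: lim)
qed

section \<open>Minima of inf-compact functions\<close>

text \<open>
  Inf-compactness for nonnegative functions: negative levels give empty sets, and the finite
  elements of \<^typ>\<open>ennreal\<close> are the remaining real levels.
\<close>
definition inf_compact :: "'y::topological_space set \<Rightarrow> ('y \<Rightarrow> ennreal) \<Rightarrow> bool" where
  "inf_compact A f \<longleftrightarrow> (\<forall>l<\<infinity>. compact {a \<in> A. f a \<le> l})"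

lemma inf_compact_attains:
  fixes A :: "'y::t2_space set"
  assumes f: "inf_compact A f" and A: "A \<noteq> {}"
  shows "\<exists>a\<in>A. f a = (INF a\<in>A. f a)"
proof (cases "(INF a\<in>A. f a) < \<infinity>")
  case True
  define m where "m = (INF a\<in>A. f a)"
  define F where "F n = {a \<in> A. f a \<le> m + ennreal (1 / Suc n)}" for n :: nat
  have m: "m < \<infinity>" using True by (simp add: m_def)
  have "(\<Inter>n. F n) \<noteq> {}"
  proof (rule nested_compact_nonempty)
    show "compact (F n)" for n
      using f m by (simp add: F_def inf_compact_def ennreal_add_eq_top less_top)
    show "F n \<noteq> {}" for n
    proof -
      have "(INF a\<in>A. f a) < m + ennreal (1 / Suc n)"
        using m unfolding m_def[symmetric]
        by (cases m) (auto simp: ennreal_plus[symmetric] ennreal_less_iff simp del: ennreal_plus)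
      then show ?thesis
        unfolding INF_less_iff F_def by (auto intro: less_imp_le)
    qed
    show "F (Suc n) \<subseteq> F n" for n
    proof -
      have "ennreal (1 / Suc (Suc n)) \<le> ennreal (1 / Suc n)"
        by (intro ennreal_leI frac_le) auto
      then have "m + ennreal (1 / Suc (Suc n)) \<le> m + ennreal (1 / Suc n)"
        by (rule add_left_mono)
      then show ?thesis unfolding F_def by (auto intro: order_trans)
    qed
  qed
  then obtain a where a: "\<And>n. a \<in> F n" by blast
  have "f a \<le> m"
  proof (rule LIMSEQ_le_const)
    have "(\<lambda>n. m + ennreal (1 / Suc n)) \<longlonglongrightarrow> m + ennreal 0"
      by (intro tendsto_intros tendsto_ennrealI LIMSEQ_Suc[OF lim_1_over_n])
    then show "(\<lambda>n. m + ennreal (1 / Suc n)) \<longlonglongrightarrow> m" by simp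
    show "\<exists>N. \<forall>n\<ge>N. f a \<le> m + ennreal (1 / Suc n)"
      using a by (simp add: F_def)
  qed
  moreover have "a \<in> A" using a[of 0] by (simp add: F_def)
  ultimately show ?thesis
    unfolding m_def[symmetric] by (intro bexI[of _ a] antisym) (auto simp: m_def intro: INF_lower)
next
  case False
  then have "(INF a\<in>A. f a) = \<infinity>" by (simp add: less_top[symmetric])
  moreover obtain a where "a \<in> A" using A by blast
  ultimately show ?thesis
    using INF_lower[of a A f] by (intro bexI[of _ a]) (simp_all add: top_unique)
qed

lemma compact_INT_t2:
  fixes F :: "'i \<Rightarrow> 'a::t2_space set"
  assumes "I \<noteq> {}" "\<And>i. i \<in> I \<Longrightarrow> compact (F i)"
  shows "compact (\<Inter>i\<in>I. F i)"
proof -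
  obtain j where "j \<in> I" using assms(1) by blast
  then have "(\<Inter>i\<in>I. F i) = F j \<inter> (\<Inter>i\<in>I. F i)" by blast
  moreover have "compact (F j \<inter> (\<Inter>i\<in>I. F i))"
    using assms(2) \<open>j \<in> I\<close> by (intro compact_Int_closed closed_INT ballI compact_imp_closed) auto
  ultimately show ?thesis by simp
qed

lemma inf_compact_SUP:
  fixes f :: "nat \<Rightarrow> 'y::t2_space \<Rightarrow> ennreal"
  assumes "\<And>n. inf_compact A (f n)"
  shows "inf_compact A (\<lambda>a. SUP n. f n a)"
  unfolding inf_compact_def
proof (intro allI impI)
  fix l :: ennreal assume l: "l < \<infinity>"
  have "{a \<in> A. (SUP n. f n a) \<le> l} = (\<Inter>n. {a \<in> A. f n a \<le> l})"
    by (auto simp: SUP_le_iff)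
  moreover have "compact (\<Inter>n. {a \<in> A. f n a \<le> l})"
    using assms l by (intro compact_INT_t2) (auto simp: inf_compact_def)
  ultimately show "compact {a \<in> A. (SUP n. f n a) \<le> l}" by simp
qed

text \<open>
  Infimum and increasing limit commute: if all infima are at most \<open>m < \<infinity>\<close>, the sets \<open>{f n \<le> m}\<close> are
  nonempty, compact and decreasing, and at a common point the supremum is at most \<open>m\<close>.
\<close>
lemma INF_SUP_inf_compact:
  fixes f :: "nat \<Rightarrow> 'y::t2_space \<Rightarrow> ennreal"
  assumes ic: "\<And>n. inf_compact A (f n)" and mono: "\<And>n a. a \<in> A \<Longrightarrow> f n a \<le> f (Suc n) a" and A: "A \<noteq> {}"
  shows "(INF a\<in>A. SUP n. f n a) = (SUP n. INF a\<in>A. f n a)"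
proof (rule antisym)
  show "(SUP n. INF a\<in>A. f n a) \<le> (INF a\<in>A. SUP n. f n a)"
    by (intro SUP_least INF_greatest) (meson INF_lower SUP_upper UNIV_I order_trans)
  define m where "m = (SUP n. INF a\<in>A. f n a)"
  show "(INF a\<in>A. SUP n. f n a) \<le> (SUP n. INF a\<in>A. f n a)"
  proof (cases "m < \<infinity>")
    case True
    have "(\<Inter>n. {a \<in> A. f n a \<le> m}) \<noteq> {}"
    proof (rule nested_compact_nonempty)
      show "compact {a \<in> A. f n a \<le> m}" for n
        using ic True by (simp add: inf_compact_def)
      show "{a \<in> A. f n a \<le> m} \<noteq> {}" for n
      proof -
        obtain a where "a \<in> A" "f n a = (INF a\<in>A. f n a)"
          using inf_compact_attains[OF ic A] by blast
        moreover have "(INF a\<in>A. f n a) \<le> m"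
          unfolding m_def by (rule SUP_upper) simp
        ultimately have "a \<in> {a \<in> A. f n a \<le> m}" by simp
        then show ?thesis by blast
      qed
      show "{a \<in> A. f (Suc n) a \<le> m} \<subseteq> {a \<in> A. f n a \<le> m}" for n
        using mono by (auto intro: order_trans)
    qed
    then obtain a where "a \<in> A" "\<And>n. f n a \<le> m" by blast
    then show ?thesis
      unfolding m_def[symmetric] by (intro INF_lower2[of a] SUP_least)
  next
    case False
    then have "m = \<infinity>" by (simp add: less_top[symmetric])
    then show ?thesis unfolding m_def[symmetric] by simp
  qed
qed

text \<open>
  The sublevel sets of the minimum are the projections of the sublevel sets of \<open>f\<close>, and the set of
  pairs \<open>(x, y)\<close> at which \<open>f\<close> attains a finite minimum has compact sections.
\<close>
theorem inf_compact_borel_minimum: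
  fixes f :: "'x::{complete_space, second_countable_topology} \<times> 'y::{complete_space, second_countable_topology} \<Rightarrow> ennreal"
  assumes f: "f \<in> borel_measurable borel" and ic: "\<And>x. inf_compact UNIV (\<lambda>y. f (x, y))"
  obtains s where "s \<in> borel_measurable borel" "(\<lambda>x. INF y. f (x, y)) \<in> borel_measurable borel"
    "\<And>x. (INF y. f (x, y)) < \<infinity> \<Longrightarrow> f (x, s x) = (INF y. f (x, y))"
proof -
  define m where "m x = (INF y. f (x, y))" for x
  have att: "\<exists>y. f (x, y) = m x" for x
    using inf_compact_attains[OF ic] unfolding m_def by blast
  have m_le: "m x \<le> f (x, y)" for x y
    unfolding m_def by (rule INF_lower) simp
  have "m \<in> borel_measurable borel"
  proof (rule borel_measurableI_le)
    fix l :: ennreal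
    show "{x \<in> space borel. m x \<le> l} \<in> sets borel"
    proof (cases "l < \<infinity>")
      case True
      have "fst ` {p \<in> space borel. f p \<le> l} \<in> sets borel"
      proof (rule compact_sections_projection_borel)
        show "{p \<in> space borel. f p \<le> l} \<in> sets borel"
          using f by measurable
        show "compact ({p \<in> space borel. f p \<le> l} `` {x})" for x
        proof -
          have "{p \<in> space borel. f p \<le> l} `` {x} = {y \<in> UNIV. f (x, y) \<le> l}" by auto
          then show ?thesis using ic[of x] True by (simp add: inf_compact_def)
        qed
      qed
      moreover have "fst ` {p \<in> space borel. f p \<le> l} = {x \<in> space borel. m x \<le> l}"
      proof (intro set_eqI iffI)
        fix x assume "x \<in> fst ` {p \<in> space borel. f p \<le> l}"
        then obtain y where "f (x, y) \<le> l" by auto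
        then show "x \<in> {x \<in> space borel. m x \<le> l}" using m_le[of x y] by simp
      next
        fix x assume x: "x \<in> {x \<in> space borel. m x \<le> l}"
        obtain y where "f (x, y) = m x" using att by blast
        then have "(x, y) \<in> {p \<in> space borel. f p \<le> l}" using x by simp
        then show "x \<in> fst ` {p \<in> space borel. f p \<le> l}" by force
      qed
      ultimately show ?thesis by simp
    next
      case False
      then have "l = \<infinity>" by (simp add: less_top[symmetric])
      then show ?thesis by simp
    qed
  qed
  note m = this
  define K where "K = {p \<in> space borel. f p = m (fst p) \<and> m (fst p) < \<infinity>}"
  have mf: "(\<lambda>p :: 'x \<times> 'y. m (fst p)) \<in> borel_measurable borel"
    using fst_borel_measurable m by (rule measurable_compose)
  have K: "K \<in> sets borel"
    unfolding K_def using f mf by measurable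
  have "compact (K `` {x})" for x
  proof (cases "m x < \<infinity>")
    case True
    then have "K `` {x} = {y \<in> UNIV. f (x, y) \<le> m x}"
      using m_le by (auto simp: K_def intro: antisym)
    then show ?thesis using ic[of x] True by (simp add: inf_compact_def)
  next
    case False
    then have "K `` {x} = {}" by (auto simp: K_def)
    then show ?thesis by simp
  qed
  then obtain s where s: "s \<in> borel_measurable borel" "\<And>x. x \<in> fst ` K \<Longrightarrow> (x, s x) \<in> K"
    using compact_sections_borel_selector[OF K] by blast
  have "f (x, s x) = m x" if "m x < \<infinity>" for x
  proof -
    obtain y where "f (x, y) = m x" using att by blast
    then have "(x, y) \<in> K" using that by (simp add: K_def)
    then have "x \<in> fst ` K" by force
    then show ?thesis using s(2)[of x] by (simp add: K_def)
  qed
  with s(1) m show thesis using that unfolding m_def by blast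
qed

section \<open>The law of a controlled process\<close>

context markov_decision_process
begin

text \<open>
  The cost is measurable on the graph only.  As the trajectory stays in the graph almost surely,
  extending it by zero changes no expectation and gives a function measurable on the step space.
\<close>
definition cost_ext :: "'x \<times> 'a \<Rightarrow> ennreal" where
  "cost_ext p = (if p \<in> graph M then cost M p else 0)"

definition eta_ext :: "real \<Rightarrow> ('x \<Rightarrow> ennreal) \<Rightarrow> 'x \<times> 'a \<Rightarrow> ennreal" where
  "eta_ext \<alpha> w p = cost_ext p + ennreal \<alpha> * (\<integral>\<^sup>+z. w z \<partial>transition_ext M p)"

lemma graph_subset: "graph M \<subseteq> states M \<times> actions M"
  using sets.sets_into_space[OF graph_borel] by (simp add: space_restrict_space)

lemma graph_step [measurable]: "graph M \<in> sets (step_space M)"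
  using graph_borel by (simp add: sets_pair_restrict_borel)

lemma sets_restrict_step_graph:
  "sets (restrict_space (step_space M) (graph M)) = sets (restrict_space borel (graph M))"
proof -
  have "sets (restrict_space (step_space M) (graph M)) =
      sets (restrict_space (restrict_space borel (states M \<times> actions M)) (graph M))"
    by (rule sets_restrict_space_cong) (rule sets_pair_restrict_borel)
  also have "\<dots> = sets (restrict_space borel (graph M))"
    using graph_subset by (simp add: sets_restrict_restrict_space Int_absorb1)
  finally show ?thesis .
qed

lemma cost_ext_measurable [measurable]: "cost_ext \<in> borel_measurable (step_space M)"
proof -
  have "cost M \<in> borel_measurable (restrict_space (step_space M) (graph M))"
    using cost_borel by (simp add: measurable_cong_sets[OF sets_restrict_step_graph refl])
  moreover have "graph M \<inter> space (step_space M) \<in> sets (step_space M)"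
    by simp
  ultimately show ?thesis
    unfolding cost_ext_def[abs_def] by (subst (asm) measurable_restrict_space_iff[where c = 0]) auto
qed

lemma transition_ext_subprob: "transition_ext M \<in> step_space M \<rightarrow>\<^sub>M subprob_algebra (state_space M)"
  by (rule measurable_prob_algebraD[OF transition_ext_kernel])

lemma integral_transition_ext_measurable [measurable]:
  assumes "w \<in> borel_measurable (state_space M)"
  shows "(\<lambda>p. \<integral>\<^sup>+z. w z \<partial>transition_ext M p) \<in> borel_measurable (step_space M)"
  using measurable_compose[OF transition_ext_subprob nn_integral_measurable_subprob_algebra[OF assms]] .

lemma eta_ext_measurable [measurable]:
  "w \<in> borel_measurable (state_space M) \<Longrightarrow> eta_ext \<alpha> w \<in> borel_measurable (step_space M)"
  unfolding eta_ext_def[abs_def] by measurable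

lemma eta_ext_eq: "p \<in> graph M \<Longrightarrow> eta_ext \<alpha> w p = eta M \<alpha> w p"
  by (simp add: eta_ext_def eta_def cost_ext_def transition_ext_def)

end

text \<open>
  Both criteria depend only on the laws of the single pairs \<open>\<omega> t = (x\<^sub>t, a\<^sub>t)\<close>.  The lemmas below
  describe these laws: the state \<open>x\<^sub>t\<^sub>+\<^sub>1\<close> has the law of \<open>\<omega> t\<close> composed with the transition kernel, the pair
  almost surely lies in the graph, and under a Markov decision rule \<open>a\<^sub>t\<close> may be replaced by \<open>\<phi>\<^sub>t(x\<^sub>t)\<close> in expectations.
\<close>
locale controlled_process = markov_decision_process M
  for M :: "('x::polish_space, 'a::polish_space) mdp" +
  fixes \<pi> :: "('x, 'a) policy" and x :: 'x
  assumes policy: "\<pi> \<in> policies M" and initial: "x \<in> states M"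
begin

sublocale IT: Ionescu_Tulcea "step_kernel M \<pi> x" "\<lambda>_. step_space M"
  by (rule Ionescu_Tulcea_step_kernel[OF policy initial])

abbreviation "P \<equiv> trajectory M \<pi> x"

lemma sets_P [measurable_cong]: "sets P = sets (\<Pi>\<^sub>M i\<in>UNIV. step_space M)"
  unfolding trajectory_def by (rule IT.PF.sets_lim)

lemma initial_history: "(\<lambda>_. undefined) \<in> space (\<Pi>\<^sub>M i\<in>{0..<0::nat}. step_space M)"
  by (auto simp: space_PiM)

lemma measurable_coordinate:
  assumes "i \<in> J" "f \<in> borel_measurable (step_space M)"
  shows "(\<lambda>\<omega>. f (\<omega> i)) \<in> borel_measurable (\<Pi>\<^sub>M i\<in>J. step_space M)"
  using measurable_compose[OF measurable_component_singleton[of i J "\<lambda>_. step_space M"] assms(2)] assms(1)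
  by simp

lemma nn_integral_coordinate:
  assumes f [measurable]: "f \<in> borel_measurable (step_space M)"
  shows "(\<integral>\<^sup>+\<omega>. f (\<omega> t) \<partial>P) = (\<integral>\<^sup>+\<omega>. f (\<omega> t) \<partial>IT.C 0 (Suc t) (\<lambda>_. undefined))"
proof -
  let ?J = "{0..<Suc t}"
  have upto: "IT.up_to ?J = Suc t"
    by (rule antisym) (use IT.up_to_iff[of ?J "Suc t"] IT.up_to_less[of ?J t] in auto)
  have [measurable]: "(\<lambda>\<omega>. f (\<omega> t)) \<in> borel_measurable (\<Pi>\<^sub>M i\<in>?J. step_space M)"
    by (rule measurable_coordinate) (simp_all add: f)
  have r: "(\<lambda>\<omega>. restrict \<omega> ?J) \<in> P \<rightarrow>\<^sub>M (\<Pi>\<^sub>M i\<in>?J. step_space M)"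
    by (simp add: measurable_cong_sets[OF sets_P refl] measurable_restrict_subset)
  have sC: "sets (IT.C 0 (Suc t) (\<lambda>_. undefined)) = sets (\<Pi>\<^sub>M i\<in>?J. step_space M)"
    using IT.sets_C[OF initial_history, of "Suc t"] by simp
  have r': "(\<lambda>\<omega>. restrict \<omega> ?J) \<in> IT.C 0 (Suc t) (\<lambda>_. undefined) \<rightarrow>\<^sub>M (\<Pi>\<^sub>M i\<in>?J. step_space M)"
    unfolding measurable_cong_sets[OF sC refl] by (rule measurable_restrict_subset) simp
  have "(\<integral>\<^sup>+\<omega>. f (\<omega> t) \<partial>P) = (\<integral>\<^sup>+\<omega>. f (\<omega> t) \<partial>distr P (\<Pi>\<^sub>M i\<in>?J. step_space M) (\<lambda>\<omega>. restrict \<omega> ?J))"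
    by (subst nn_integral_distr[OF r]) simp_all
  also have "distr P (\<Pi>\<^sub>M i\<in>?J. step_space M) (\<lambda>\<omega>. restrict \<omega> ?J) = IT.CI ?J"
    unfolding trajectory_def by (rule IT.distr_lim) simp
  also have "(\<integral>\<^sup>+\<omega>. f (\<omega> t) \<partial>IT.CI ?J) = (\<integral>\<^sup>+\<omega>. f (\<omega> t) \<partial>IT.C 0 (Suc t) (\<lambda>_. undefined))"
    unfolding IT.CI_def upto by (subst nn_integral_distr[OF r']) simp_all
  finally show ?thesis .
qed

lemma nn_integral_coordinate_kernel:
  assumes f [measurable]: "f \<in> borel_measurable (step_space M)"
  shows "(\<integral>\<^sup>+\<omega>. f (\<omega> t) \<partial>P) =
    (\<integral>\<^sup>+\<omega>. (\<integral>\<^sup>+p. f p \<partial>step_kernel M \<pi> x t \<omega>) \<partial>IT.C 0 t (\<lambda>_. undefined))"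
proof -
  have ft: "(\<lambda>\<omega>. f (\<omega> t)) \<in> borel_measurable (\<Pi>\<^sub>M i\<in>{0..<Suc t}. step_space M)"
    by (rule measurable_coordinate) (simp_all add: f)
  have sC: "sets (IT.C 0 t (\<lambda>_. undefined)) = sets (\<Pi>\<^sub>M i\<in>{0..<t}. step_space M)"
    using IT.sets_C[OF initial_history, of t] by simp
  have "(\<integral>\<^sup>+\<omega>. f (\<omega> t) \<partial>P) = (\<integral>\<^sup>+\<omega>. (\<integral>\<^sup>+\<omega>'. f (\<omega>' t) \<partial>IT.eP t \<omega>) \<partial>IT.C 0 t (\<lambda>_. undefined))"
    unfolding nn_integral_coordinate[OF f] IT.C.simps
    by (subst nn_integral_bind[OF ft]) (simp_all add: measurable_cong_sets[OF sC refl] IT.measurable_eP)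
  also have "\<dots> = (\<integral>\<^sup>+\<omega>. (\<integral>\<^sup>+p. f p \<partial>step_kernel M \<pi> x t \<omega>) \<partial>IT.C 0 t (\<lambda>_. undefined))"
  proof (rule nn_integral_cong)
    fix \<omega> assume "\<omega> \<in> space (IT.C 0 t (\<lambda>_. undefined))"
    then have "\<omega> \<in> space (\<Pi>\<^sub>M i\<in>{0..<t}. step_space M)"
      using sets_eq_imp_space_eq[OF sC] by simp
    then show "(\<integral>\<^sup>+\<omega>'. f (\<omega>' t) \<partial>IT.eP t \<omega>) = (\<integral>\<^sup>+p. f p \<partial>step_kernel M \<pi> x t \<omega>)"
      by (subst IT.nn_integral_eP[OF _ ft]) simp_all
  qed
  finally show ?thesis .
qed

lemma next_state_kernel:
  assumes "\<omega> \<in> space (\<Pi>\<^sub>M i\<in>{0..<t}. step_space M)"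
  shows "next_state M x t \<omega> \<in> space (prob_algebra (state_space M))"
proof (cases t)
  case 0
  then show ?thesis
    using initial by (simp add: next_state_def space_prob_algebra prob_space_return space_restrict_space)
next
  case (Suc s)
  then have "\<omega> s \<in> space (step_space M)"
    using assms by (auto simp: space_PiM)
  then show ?thesis
    using measurable_space[OF transition_ext_kernel] Suc by (simp add: next_state_def)
qed

lemma decision_rule_kernel:
  assumes "\<omega> \<in> space (\<Pi>\<^sub>M i\<in>{0..<t}. step_space M)"
  shows "(\<lambda>y. \<pi> t (\<omega>, y)) \<in> state_space M \<rightarrow>\<^sub>M prob_algebra (action_space M)"
proof -
  have "\<pi> t \<in> history_space M t \<rightarrow>\<^sub>M prob_algebra (action_space M)"
    using policy by (simp add: policies_def)
  moreover have "(\<lambda>y. (\<omega>, y)) \<in> state_space M \<rightarrow>\<^sub>M history_space M t"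
    unfolding history_space_def using assms by simp
  ultimately show ?thesis by (rule measurable_compose[rotated])
qed

lemma nn_integral_step_kernel:
  assumes \<omega>: "\<omega> \<in> space (\<Pi>\<^sub>M i\<in>{0..<t}. step_space M)"
    and f [measurable]: "f \<in> borel_measurable (step_space M)"
  shows "(\<integral>\<^sup>+p. f p \<partial>step_kernel M \<pi> x t \<omega>) =
    (\<integral>\<^sup>+y. (\<integral>\<^sup>+a. f (y, a) \<partial>\<pi> t (\<omega>, y)) \<partial>next_state M x t \<omega>)"
proof -
  have n: "sets (next_state M x t \<omega>) = sets (state_space M)"
    using next_state_kernel[OF \<omega>] by (simp add: space_prob_algebra)
  have k: "(\<lambda>y. \<pi> t (\<omega>, y)) \<in> state_space M \<rightarrow>\<^sub>M prob_algebra (action_space M)"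
    by (rule decision_rule_kernel[OF \<omega>])
  have b: "(\<lambda>y. \<pi> t (\<omega>, y) \<bind> (\<lambda>a. return (step_space M) (y, a))) \<in> state_space M \<rightarrow>\<^sub>M subprob_algebra (step_space M)"
  proof (rule measurable_prob_algebraD, rule measurable_bind_prob_space2[OF k])
    show "(\<lambda>(y, a). return (step_space M) (y, a)) \<in> state_space M \<Otimes>\<^sub>M action_space M \<rightarrow>\<^sub>M prob_algebra (step_space M)"
      by (simp add: split_beta measurable_return_prob_space)
  qed
  have "(\<integral>\<^sup>+p. f p \<partial>step_kernel M \<pi> x t \<omega>) =
      (\<integral>\<^sup>+y. (\<integral>\<^sup>+p. f p \<partial>(\<pi> t (\<omega>, y) \<bind> (\<lambda>a. return (step_space M) (y, a)))) \<partial>next_state M x t \<omega>)"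
    unfolding step_kernel_def
    by (rule nn_integral_bind[OF f]) (simp add: measurable_cong_sets[OF n refl] b)
  also have "\<dots> = (\<integral>\<^sup>+y. (\<integral>\<^sup>+a. f (y, a) \<partial>\<pi> t (\<omega>, y)) \<partial>next_state M x t \<omega>)"
  proof (rule nn_integral_cong)
    fix y assume "y \<in> space (next_state M x t \<omega>)"
    then have y: "y \<in> space (state_space M)"
      using sets_eq_imp_space_eq[OF n] by simp
    then have s: "sets (\<pi> t (\<omega>, y)) = sets (action_space M)"
      using measurable_space[OF k y] by (simp add: space_prob_algebra)
    have [measurable]: "(\<lambda>a. (y, a)) \<in> action_space M \<rightarrow>\<^sub>M step_space M"
      using y by simp
    have "(\<lambda>a. return (step_space M) (y, a)) \<in> \<pi> t (\<omega>, y) \<rightarrow>\<^sub>M subprob_algebra (step_space M)"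
      unfolding measurable_cong_sets[OF s refl]
      by (rule measurable_compose[OF _ return_measurable]) measurable
    then have "(\<integral>\<^sup>+p. f p \<partial>(\<pi> t (\<omega>, y) \<bind> (\<lambda>a. return (step_space M) (y, a)))) =
        (\<integral>\<^sup>+a. (\<integral>\<^sup>+p. f p \<partial>return (step_space M) (y, a)) \<partial>\<pi> t (\<omega>, y))"
      by (rule nn_integral_bind[OF f])
    also have "\<dots> = (\<integral>\<^sup>+a. f (y, a) \<partial>\<pi> t (\<omega>, y))"
    proof (rule nn_integral_cong)
      fix a assume "a \<in> space (\<pi> t (\<omega>, y))"
      then have "(y, a) \<in> space (step_space M)"
        using sets_eq_imp_space_eq[OF s] y by (simp add: space_pair_measure)
      then show "(\<integral>\<^sup>+p. f p \<partial>return (step_space M) (y, a)) = f (y, a)"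
        by (rule nn_integral_return) simp
    qed
    finally show "(\<integral>\<^sup>+p. f p \<partial>(\<pi> t (\<omega>, y) \<bind> (\<lambda>a. return (step_space M) (y, a)))) =
        (\<integral>\<^sup>+a. f (y, a) \<partial>\<pi> t (\<omega>, y))" .
  qed
  finally show ?thesis .
qed

lemma space_C: "space (IT.C 0 t (\<lambda>_. undefined)) = space (\<Pi>\<^sub>M i\<in>{0..<t}. step_space M)"
  using IT.space_C[OF initial_history, of t] by simp

lemma nn_integral_coordinate_decision:
  assumes "f \<in> borel_measurable (step_space M)"
  shows "(\<integral>\<^sup>+\<omega>. f (\<omega> t) \<partial>P) = (\<integral>\<^sup>+\<omega>. (\<integral>\<^sup>+y. (\<integral>\<^sup>+a. f (y, a) \<partial>\<pi> t (\<omega>, y)) \<partial>next_state M x t \<omega>)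
    \<partial>IT.C 0 t (\<lambda>_. undefined))"
  unfolding nn_integral_coordinate_kernel[OF assms]
  by (intro nn_integral_cong nn_integral_step_kernel[OF _ assms]) (simp add: space_C)

lemma space_next_state:
  "\<omega> \<in> space (\<Pi>\<^sub>M i\<in>{0..<t}. step_space M) \<Longrightarrow> space (next_state M x t \<omega>) = states M"
  using next_state_kernel[of \<omega> t] sets_eq_imp_space_eq[of "next_state M x t \<omega>" "state_space M"]
  by (simp add: space_prob_algebra space_restrict_space)

lemma decision_rule_prob:
  assumes "\<omega> \<in> space (\<Pi>\<^sub>M i\<in>{0..<t}. step_space M)" "y \<in> states M"
  shows "prob_space (\<pi> t (\<omega>, y))" "sets (\<pi> t (\<omega>, y)) = sets (action_space M)"
  using measurable_space[OF decision_rule_kernel[OF assms(1)], of y] assms(2)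
  by (simp_all add: space_prob_algebra space_restrict_space)

lemma nn_integral_state:
  assumes w [measurable]: "w \<in> borel_measurable (state_space M)"
  shows "(\<integral>\<^sup>+\<omega>. w (fst (\<omega> t)) \<partial>P) =
    (\<integral>\<^sup>+\<omega>. (\<integral>\<^sup>+y. w y \<partial>next_state M x t \<omega>) \<partial>IT.C 0 t (\<lambda>_. undefined))"
proof -
  have "(\<integral>\<^sup>+\<omega>. w (fst (\<omega> t)) \<partial>P) = (\<integral>\<^sup>+\<omega>. (\<integral>\<^sup>+y. (\<integral>\<^sup>+a. w y \<partial>\<pi> t (\<omega>, y)) \<partial>next_state M x t \<omega>)
      \<partial>IT.C 0 t (\<lambda>_. undefined))"
    by (subst nn_integral_coordinate_decision[of "\<lambda>p. w (fst p)"]) simp_all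
  also have "\<dots> = (\<integral>\<^sup>+\<omega>. (\<integral>\<^sup>+y. w y \<partial>next_state M x t \<omega>) \<partial>IT.C 0 t (\<lambda>_. undefined))"
  proof (intro nn_integral_cong)
    fix \<omega> y assume "\<omega> \<in> space (IT.C 0 t (\<lambda>_. undefined))" "y \<in> space (next_state M x t \<omega>)"
    then have "prob_space (\<pi> t (\<omega>, y))"
      by (intro decision_rule_prob) (simp_all add: space_C space_next_state)
    then show "(\<integral>\<^sup>+a. w y \<partial>\<pi> t (\<omega>, y)) = w y"
      by (simp add: prob_space.emeasure_space_1)
  qed
  finally show ?thesis .
qed

lemma nn_integral_initial_state:
  assumes w [measurable]: "w \<in> borel_measurable (state_space M)"
  shows "(\<integral>\<^sup>+\<omega>. w (fst (\<omega> 0)) \<partial>P) = w x"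
proof -
  have "(\<integral>\<^sup>+\<omega>. w (fst (\<omega> 0)) \<partial>P) = (\<integral>\<^sup>+\<omega>. w x \<partial>IT.C 0 0 (\<lambda>_. undefined))"
    unfolding nn_integral_state[OF w] next_state_def
    using initial by (simp add: nn_integral_return space_restrict_space)
  also have "\<dots> = w x"
    using IT.prob_space_C[OF initial_history, of 0] by (simp add: prob_space.emeasure_space_1 del: IT.C.simps)
  finally show ?thesis .
qed

lemma nn_integral_next_state:
  assumes w [measurable]: "w \<in> borel_measurable (state_space M)"
  shows "(\<integral>\<^sup>+\<omega>. w (fst (\<omega> (Suc t))) \<partial>P) = (\<integral>\<^sup>+\<omega>. (\<integral>\<^sup>+z. w z \<partial>transition_ext M (\<omega> t)) \<partial>P)"
  unfolding nn_integral_state[OF w] next_state_def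
  using nn_integral_coordinate[OF integral_transition_ext_measurable[OF w], of t] by simp

text \<open>
  Every decision rule is concentrated on the feasible actions, whatever the history is.
\<close>
lemma AE_feasible: "AE \<omega> in P. \<omega> t \<in> graph M"
proof -
  have "(\<integral>\<^sup>+\<omega>. indicator (- graph M) (\<omega> t) \<partial>P) = 0"
  proof -
    have "(\<integral>\<^sup>+\<omega>. (\<integral>\<^sup>+y. (\<integral>\<^sup>+a. indicator (- graph M) (y, a) \<partial>\<pi> t (\<omega>, y)) \<partial>next_state M x t \<omega>)
        \<partial>IT.C 0 t (\<lambda>_. undefined)) = (\<integral>\<^sup>+\<omega>. (\<integral>\<^sup>+y. 0 \<partial>next_state M x t \<omega>) \<partial>IT.C 0 t (\<lambda>_. undefined))"
    proof (intro nn_integral_cong)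
      fix \<omega> y assume *: "\<omega> \<in> space (IT.C 0 t (\<lambda>_. undefined))" "y \<in> space (next_state M x t \<omega>)"
      then have \<omega>: "\<omega> \<in> space (\<Pi>\<^sub>M i\<in>{0..<t}. step_space M)" and y: "y \<in> states M"
        by (simp_all add: space_C space_next_state)
      interpret D: prob_space "\<pi> t (\<omega>, y)" by (rule decision_rule_prob[OF \<omega> y])
      have "(\<omega>, y) \<in> space (history_space M t)"
        using \<omega> y by (simp add: history_space_def space_pair_measure space_restrict_space)
      then have "emeasure (\<pi> t (\<omega>, y)) (feasible M y) = 1"
        using policy by (force simp: policies_def)
      then have "AE a in \<pi> t (\<omega>, y). a \<in> feasible M y"
        using feasible_borel[OF y] decision_rule_prob(2)[OF \<omega> y]
        by (intro D.AE_prob_1) (simp_all add: measure_def)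
      then have "AE a in \<pi> t (\<omega>, y). indicator (- graph M) (y, a) = (0::ennreal)"
        using y by (auto simp: graph_def)
      then show "(\<integral>\<^sup>+a. indicator (- graph M) (y, a) \<partial>\<pi> t (\<omega>, y)) = 0"
        by (subst nn_integral_cong_AE[where v = "\<lambda>_. 0"]) simp_all
    qed
    then show ?thesis
      by (subst nn_integral_coordinate_decision[of "indicator (- graph M)"]) simp_all
  qed
  moreover have "(\<lambda>\<omega>. indicator (- graph M) (\<omega> t) :: ennreal) \<in> borel_measurable P"
    by measurable
  ultimately have "AE \<omega> in P. indicator (- graph M) (\<omega> t) = (0::ennreal)"
    by (simp add: nn_integral_0_iff_AE)
  then show ?thesis
    by (auto simp: indicator_def split: if_splits)
qed

lemma nn_integral_markov_decision:
  assumes follows: "\<And>h. h \<in> space (history_space M t) \<Longrightarrow> \<pi> t h = markov_policy M \<phi> t h"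
    and \<phi>: "\<phi> t \<in> selectors M" and f [measurable]: "f \<in> borel_measurable (step_space M)"
  shows "(\<integral>\<^sup>+\<omega>. f (\<omega> t) \<partial>P) = (\<integral>\<^sup>+\<omega>. f (fst (\<omega> t), \<phi> t (fst (\<omega> t))) \<partial>P)"
proof -
  have [measurable]: "\<phi> t \<in> state_space M \<rightarrow>\<^sub>M action_space M"
    using \<phi> by (simp add: selectors_def)
  have g [measurable]: "(\<lambda>y. f (y, \<phi> t y)) \<in> borel_measurable (state_space M)"
    by measurable
  have "(\<integral>\<^sup>+\<omega>. f (\<omega> t) \<partial>P) =
      (\<integral>\<^sup>+\<omega>. (\<integral>\<^sup>+y. f (y, \<phi> t y) \<partial>next_state M x t \<omega>) \<partial>IT.C 0 t (\<lambda>_. undefined))"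
    unfolding nn_integral_coordinate_decision[OF f]
  proof (intro nn_integral_cong)
    fix \<omega> y assume *: "\<omega> \<in> space (IT.C 0 t (\<lambda>_. undefined))" "y \<in> space (next_state M x t \<omega>)"
    then have \<omega>: "\<omega> \<in> space (\<Pi>\<^sub>M i\<in>{0..<t}. step_space M)" and y: "y \<in> states M"
      by (simp_all add: space_C space_next_state)
    have h: "(\<omega>, y) \<in> space (history_space M t)"
      using \<omega> y by (simp add: history_space_def space_pair_measure space_restrict_space)
    have "\<phi> t y \<in> space (action_space M)"
      using y by (intro measurable_space[of "\<phi> t" "state_space M"]) (simp_all add: space_restrict_space)
    moreover have "(\<lambda>a. f (y, a)) \<in> borel_measurable (action_space M)"
      using y by (intro measurable_compose[OF _ f]) (simp add: space_restrict_space)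
    ultimately show "(\<integral>\<^sup>+a. f (y, a) \<partial>\<pi> t (\<omega>, y)) = f (y, \<phi> t y)"
      unfolding follows[OF h] markov_policy_def by (simp add: nn_integral_return)
  qed
  also have "\<dots> = (\<integral>\<^sup>+\<omega>. f (fst (\<omega> t), \<phi> t (fst (\<omega> t))) \<partial>P)"
    by (rule nn_integral_state[OF g, symmetric])
  finally show ?thesis .
qed

lemma fin_cost_eq_sum:
  "fin_cost M \<pi> T \<alpha> x = (\<Sum>t<T. ennreal (\<alpha> ^ t) * (\<integral>\<^sup>+\<omega>. cost_ext (\<omega> t) \<partial>P))"
proof -
  have "fin_cost M \<pi> T \<alpha> x = (\<integral>\<^sup>+\<omega>. (\<Sum>t<T. ennreal (\<alpha> ^ t) * cost_ext (\<omega> t)) \<partial>P)"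
    unfolding fin_cost_def
  proof (rule nn_integral_cong_AE)
    have "AE \<omega> in P. \<forall>t. \<omega> t \<in> graph M"
      unfolding AE_all_countable using AE_feasible by blast
    then show "AE \<omega> in P. (\<Sum>t<T. ennreal (\<alpha> ^ t) * cost M (\<omega> t)) = (\<Sum>t<T. ennreal (\<alpha> ^ t) * cost_ext (\<omega> t))"
      by eventually_elim (simp add: cost_ext_def)
  qed
  then show ?thesis
    by (simp add: nn_integral_sum nn_integral_cmult)
qed

lemma inf_cost_eq_SUP: "inf_cost M \<pi> \<alpha> x = (SUP T. fin_cost M \<pi> T \<alpha> x)"
proof -
  have "inf_cost M \<pi> \<alpha> x = (\<integral>\<^sup>+\<omega>. (\<Sum>t. ennreal (\<alpha> ^ t) * cost_ext (\<omega> t)) \<partial>P)"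
    unfolding inf_cost_def
  proof (rule nn_integral_cong_AE)
    have "AE \<omega> in P. \<forall>t. \<omega> t \<in> graph M"
      unfolding AE_all_countable using AE_feasible by blast
    then show "AE \<omega> in P. (\<Sum>t. ennreal (\<alpha> ^ t) * cost M (\<omega> t)) = (\<Sum>t. ennreal (\<alpha> ^ t) * cost_ext (\<omega> t))"
      by eventually_elim (simp add: cost_ext_def)
  qed
  also have "\<dots> = (\<Sum>t. ennreal (\<alpha> ^ t) * (\<integral>\<^sup>+\<omega>. cost_ext (\<omega> t) \<partial>P))"
    by (simp add: nn_integral_suminf nn_integral_cmult)
  finally show ?thesis
    by (simp add: suminf_eq_SUP fin_cost_eq_sum)
qed

lemma nn_integral_eta_ext:
  assumes w [measurable]: "w \<in> borel_measurable (state_space M)" and \<alpha>: "0 \<le> \<alpha>"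
  shows "ennreal (\<alpha> ^ t) * (\<integral>\<^sup>+\<omega>. eta_ext \<alpha> w (\<omega> t) \<partial>P) =
    ennreal (\<alpha> ^ t) * (\<integral>\<^sup>+\<omega>. cost_ext (\<omega> t) \<partial>P) + ennreal (\<alpha> ^ Suc t) * (\<integral>\<^sup>+\<omega>. w (fst (\<omega> (Suc t))) \<partial>P)"
proof -
  have "(\<integral>\<^sup>+\<omega>. eta_ext \<alpha> w (\<omega> t) \<partial>P) =
      (\<integral>\<^sup>+\<omega>. cost_ext (\<omega> t) \<partial>P) + ennreal \<alpha> * (\<integral>\<^sup>+\<omega>. (\<integral>\<^sup>+z. w z \<partial>transition_ext M (\<omega> t)) \<partial>P)"
    unfolding eta_ext_def by (simp add: nn_integral_add nn_integral_cmult)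
  then show ?thesis
    using \<alpha> unfolding nn_integral_next_state[OF w]
    by (simp add: distrib_left ennreal_mult mult_ac)
qed

text \<open>
  Telescoping: by the hypothesis and the law of the next state, the expected cost up to epoch \<open>k\<close> plus
  the expectation of \<open>\<alpha>\<^sup>k w\<^sub>k(x\<^sub>k)\<close> is nondecreasing in \<open>k\<close>.
\<close>
lemma cost_lower_bound:
  assumes w: "\<And>k. w k \<in> borel_measurable (state_space M)" and \<alpha>: "0 \<le> \<alpha>"
    and le: "\<And>k y a. k < T \<Longrightarrow> (y, a) \<in> graph M \<Longrightarrow> w k y \<le> eta M \<alpha> (w (Suc k)) (y, a)"
  shows "w 0 x \<le> fin_cost M \<pi> T \<alpha> x + ennreal (\<alpha> ^ T) * (\<integral>\<^sup>+\<omega>. w T (fst (\<omega> T)) \<partial>P)"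
  using le
proof (induction T)
  case 0
  then show ?case by (simp add: fin_cost_eq_sum nn_integral_initial_state[OF w])
next
  case (Suc T)
  have "(\<integral>\<^sup>+\<omega>. w T (fst (\<omega> T)) \<partial>P) \<le> (\<integral>\<^sup>+\<omega>. eta_ext \<alpha> (w (Suc T)) (\<omega> T) \<partial>P)"
  proof (rule nn_integral_mono_AE)
    show "AE \<omega> in P. w T (fst (\<omega> T)) \<le> eta_ext \<alpha> (w (Suc T)) (\<omega> T)"
      using AE_feasible[of T]
    proof eventually_elim
      case (elim \<omega>)
      then show ?case
        using Suc.prems[of T "fst (\<omega> T)" "snd (\<omega> T)"] by (simp add: eta_ext_eq)
    qed
  qed
  then have "ennreal (\<alpha> ^ T) * (\<integral>\<^sup>+\<omega>. w T (fst (\<omega> T)) \<partial>P) \<le>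
      ennreal (\<alpha> ^ T) * (\<integral>\<^sup>+\<omega>. cost_ext (\<omega> T) \<partial>P) + ennreal (\<alpha> ^ Suc T) * (\<integral>\<^sup>+\<omega>. w (Suc T) (fst (\<omega> (Suc T))) \<partial>P)"
    unfolding nn_integral_eta_ext[OF w \<alpha>, symmetric] by (rule mult_left_mono) simp
  then have "fin_cost M \<pi> T \<alpha> x + ennreal (\<alpha> ^ T) * (\<integral>\<^sup>+\<omega>. w T (fst (\<omega> T)) \<partial>P) \<le>
      fin_cost M \<pi> (Suc T) \<alpha> x + ennreal (\<alpha> ^ Suc T) * (\<integral>\<^sup>+\<omega>. w (Suc T) (fst (\<omega> (Suc T))) \<partial>P)"
    by (simp add: fin_cost_eq_sum add.assoc add_left_mono)
  with Suc show ?case by (meson less_SucI order_trans)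
qed

text \<open>
  The same telescoping sum is constant when all decisions attain equality.
\<close>
lemma cost_markov:
  assumes w: "\<And>k. w k \<in> borel_measurable (state_space M)" and \<alpha>: "0 \<le> \<alpha>"
    and eq: "\<And>k y. k < T \<Longrightarrow> y \<in> states M \<Longrightarrow> w k y = eta M \<alpha> (w (Suc k)) (y, \<phi> k y)"
    and \<phi>: "\<And>k. k < T \<Longrightarrow> \<phi> k \<in> selectors M" and follows: "follows_until M T \<phi> \<pi>"
  shows "w 0 x = fin_cost M \<pi> T \<alpha> x + ennreal (\<alpha> ^ T) * (\<integral>\<^sup>+\<omega>. w T (fst (\<omega> T)) \<partial>P)"
  using eq \<phi> follows
proof (induction T)
  case 0
  then show ?case by (simp add: fin_cost_eq_sum nn_integral_initial_state[OF w])
next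
  case (Suc T)
  have \<phi>T: "\<phi> T \<in> selectors M" using Suc.prems by simp
  have "(\<integral>\<^sup>+\<omega>. w T (fst (\<omega> T)) \<partial>P) = (\<integral>\<^sup>+\<omega>. eta_ext \<alpha> (w (Suc T)) (fst (\<omega> T), \<phi> T (fst (\<omega> T))) \<partial>P)"
  proof (rule nn_integral_cong_AE)
    show "AE \<omega> in P. w T (fst (\<omega> T)) = eta_ext \<alpha> (w (Suc T)) (fst (\<omega> T), \<phi> T (fst (\<omega> T)))"
      using AE_feasible[of T]
    proof eventually_elim
      case (elim \<omega>)
      then have y: "fst (\<omega> T) \<in> states M" by (auto simp: graph_def)
      then have "(fst (\<omega> T), \<phi> T (fst (\<omega> T))) \<in> graph M"
        using \<phi>T by (auto simp: selectors_def graph_def)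
      then show ?case
        using Suc.prems(1)[of T, OF _ y] by (simp add: eta_ext_eq)
    qed
  qed
  also have "\<dots> = (\<integral>\<^sup>+\<omega>. eta_ext \<alpha> (w (Suc T)) (\<omega> T) \<partial>P)"
  proof (rule nn_integral_markov_decision[of T \<phi>, OF _ \<phi>T, symmetric])
    show "\<pi> T h = markov_policy M \<phi> T h" if "h \<in> space (history_space M T)" for h
      using Suc.prems(3) that by (simp add: follows_until_def)
  qed (simp add: w eta_ext_measurable)
  finally have "ennreal (\<alpha> ^ T) * (\<integral>\<^sup>+\<omega>. w T (fst (\<omega> T)) \<partial>P) =
      ennreal (\<alpha> ^ T) * (\<integral>\<^sup>+\<omega>. cost_ext (\<omega> T) \<partial>P) + ennreal (\<alpha> ^ Suc T) * (\<integral>\<^sup>+\<omega>. w (Suc T) (fst (\<omega> (Suc T))) \<partial>P)"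
    unfolding nn_integral_eta_ext[OF w \<alpha>, symmetric] by simp
  then have "fin_cost M \<pi> T \<alpha> x + ennreal (\<alpha> ^ T) * (\<integral>\<^sup>+\<omega>. w T (fst (\<omega> T)) \<partial>P) =
      fin_cost M \<pi> (Suc T) \<alpha> x + ennreal (\<alpha> ^ Suc T) * (\<integral>\<^sup>+\<omega>. w (Suc T) (fst (\<omega> (Suc T))) \<partial>P)"
    by (simp add: fin_cost_eq_sum add.assoc)
  moreover have "w 0 x = fin_cost M \<pi> T \<alpha> x + ennreal (\<alpha> ^ T) * (\<integral>\<^sup>+\<omega>. w T (fst (\<omega> T)) \<partial>P)"
    using Suc.prems by (intro Suc.IH) (auto simp: follows_until_def)
  ultimately show ?case by simp
qed
end

section \<open>The one-step operator\<close>

text \<open>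
  For \<open>c a \<le> l\<close> the inequality \<open>c a + h a \<le> l\<close> says that every \<open>q \<ge> 0\<close> satisfies \<open>h a \<le> q\<close> or \<open>c a + q \<le> l\<close>.
  This writes the sublevel set as an intersection of compact sets: the first condition is closed
  in \<open>{c \<le> l}\<close>, the second is a sublevel set of \<open>c\<close>.
\<close>
lemma inf_compact_add_continuous:
  fixes A :: "'y::metric_space set" and c :: "'y \<Rightarrow> ennreal" and h :: "'y \<Rightarrow> real"
  assumes c: "inf_compact A c" and h: "continuous_on A h" "\<And>a. a \<in> A \<Longrightarrow> 0 \<le> h a"
  shows "inf_compact A (\<lambda>a. c a + ennreal (h a))"
  unfolding inf_compact_def
proof (intro allI impI)
  fix l :: ennreal assume l: "l < \<infinity>"
  define C where "C = {a \<in> A. c a \<le> l}"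
  have C: "compact C" using c l by (simp add: inf_compact_def C_def)
  define F where "F q = {a \<in> C. h a \<le> q} \<union> {a \<in> A. c a + ennreal q \<le> l}" for q :: real
  have F: "compact (F q)" if q: "0 \<le> q" for q
  proof -
    have "continuous_on C h"
      using h(1) by (rule continuous_on_subset) (auto simp: C_def)
    then have "closed (C \<inter> h -` {..q})"
      using compact_imp_closed[OF C] by (intro continuous_closed_preimage) auto
    then have "compact (C \<inter> (C \<inter> h -` {..q}))"
      using C by (rule compact_Int_closed[rotated])
    moreover have "C \<inter> (C \<inter> h -` {..q}) = {a \<in> C. h a \<le> q}" by auto
    moreover have "compact {a \<in> A. c a + ennreal q \<le> l}"
    proof (cases "ennreal q \<le> l")
      case True
      have "c a + ennreal q \<le> l \<longleftrightarrow> c a \<le> l - ennreal q" for a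
        using True l by (cases "c a"; cases l)
          (auto simp: q ennreal_plus[symmetric] ennreal_minus top_unique simp del: ennreal_plus)
      moreover have "l - ennreal q < \<infinity>"
        using l by (simp add: ennreal_minus_eq_top less_top[symmetric])
      ultimately show ?thesis
        using c by (simp add: inf_compact_def)
    next
      case False
      then have "\<not> c a + ennreal q \<le> l" for a
        by (meson add_increasing order_refl order_trans zero_le)
      then show ?thesis by simp
    qed
    ultimately show ?thesis unfolding F_def by (metis compact_Un)
  qed
  have "{a \<in> A. c a + ennreal (h a) \<le> l} = (\<Inter>q\<in>{0..}. F q)"
  proof (intro set_eqI iffI)
    fix a assume a: "a \<in> {a \<in> A. c a + ennreal (h a) \<le> l}"
    have "c a \<le> c a + ennreal (h a)" by (simp add: add_increasing2)
    also have "\<dots> \<le> l" using a by simp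
    finally have aC: "a \<in> C"
      using a by (simp add: C_def)
    have "a \<in> F q" if "0 \<le> q" for q
    proof (cases "h a \<le> q")
      case True
      then show ?thesis using aC by (simp add: F_def)
    next
      case False
      have "c a + ennreal q \<le> c a + ennreal (h a)"
        using False by (intro add_left_mono ennreal_leI) simp
      also have "\<dots> \<le> l" using a by simp
      finally show ?thesis using a by (simp add: F_def)
    qed
    then show "a \<in> (\<Inter>q\<in>{0..}. F q)" by simp
  next
    fix a assume aF: "a \<in> (\<Inter>q\<in>{0..}. F q)"
    have aA: "a \<in> A" and cl: "c a \<le> l"
    proof -
      have "a \<in> F 0" using aF by simp
      then show "a \<in> A" "c a \<le> l" by (auto simp: F_def C_def)
    qed
    obtain r L where r: "c a = ennreal r" "0 \<le> r" and L: "l = ennreal L" "0 \<le> L"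
      using cl l by (cases "c a"; cases l) (auto simp: top_unique)
    have rL: "r \<le> L" using cl r L by simp
    have "r + h a \<le> L"
    proof (rule ccontr)
      assume "\<not> r + h a \<le> L"
      then have gt: "L < r + h a" by simp
      \<comment> \<open>The midpoint of \<open>L - r\<close> and \<open>h a\<close> violates both alternatives.\<close>
      define q where "q = (L - r + h a) / 2"
      have q: "0 \<le> q" "q < h a" "L < r + q"
        using gt rL h(2)[OF aA] by (auto simp: q_def field_simps)
      then have "a \<in> F q" using aF by simp
      then show False
        using q r L by (auto simp: F_def ennreal_plus[symmetric] simp del: ennreal_plus)
    qed
    then show "a \<in> {a \<in> A. c a + ennreal (h a) \<le> l}"
      using aA r L h(2)[OF aA] by (simp add: ennreal_plus[symmetric] del: ennreal_plus)
  qed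
  moreover have "compact (\<Inter>q\<in>{0..}. F q)"
    using F by (intro compact_INT_t2) auto
  ultimately show "compact {a \<in> A. c a + ennreal (h a) \<le> l}" by simp
qed

lemma SUP_mult_incseq_ennreal:
  fixes f g :: "nat \<Rightarrow> ennreal"
  assumes "incseq f" "incseq g"
  shows "(SUP n. f n * g n) = (SUP n. f n) * (SUP n. g n)"
proof (rule antisym)
  show "(SUP n. f n * g n) \<le> (SUP n. f n) * (SUP n. g n)"
    by (intro SUP_least mult_mono SUP_upper) auto
  have "(SUP n. f n) * (SUP n. g n) = (SUP n. SUP m. f m * g n)"
    unfolding SUP_mult_left_ennreal SUP_mult_right_ennreal ..
  also have "\<dots> \<le> (SUP n. f n * g n)"
  proof (intro SUP_least)
    fix m n
    have "f m * g n \<le> f (max m n) * g (max m n)"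
      using assms by (intro mult_mono) (auto simp: incseq_def)
    also have "\<dots> \<le> (SUP n. f n * g n)" by (intro SUP_upper) simp
    finally show "f m * g n \<le> (SUP n. f n * g n)" .
  qed
  finally show "(SUP n. f n) * (SUP n. g n) \<le> (SUP n. f n * g n)" .
qed

definition bellman :: "('x, 'a) mdp \<Rightarrow> real \<Rightarrow> ('x \<Rightarrow> ennreal) \<Rightarrow> 'x \<Rightarrow> ennreal" where
  "bellman M \<alpha> w x = (INF a\<in>feasible M x. eta M \<alpha> w (x, a))"

locale S_star_mdp = markov_decision_process M
  for M :: "('x::polish_space, 'a::polish_space) mdp" +
  assumes S_star: "assumption_S_star M"
begin

abbreviation "parameters \<equiv> restrict_space borel (states M \<times> {0..1::real})"

lemma transition_prob:
  assumes "p \<in> graph M"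
  shows "prob_space (transition M p)" "sets (transition M p) = sets (state_space M)"
    "space (transition M p) = states M"
proof -
  have "transition M p \<in> space (prob_algebra (state_space M))"
    by (rule measurable_space[OF transition_kernel]) (use assms in \<open>simp add: space_restrict_space\<close>)
  then show "prob_space (transition M p)" and s: "sets (transition M p) = sets (state_space M)"
    by (simp_all add: space_prob_algebra)
  show "space (transition M p) = states M"
    using sets_eq_imp_space_eq[OF s] by (simp add: space_restrict_space)
qed

lemma eta_cong:
  assumes "p \<in> graph M" "\<And>z. z \<in> states M \<Longrightarrow> w z = w' z"
  shows "eta M \<alpha> w p = eta M \<alpha> w' p"
proof -
  have "(\<integral>\<^sup>+z. w z \<partial>transition M p) = (\<integral>\<^sup>+z. w' z \<partial>transition M p)"
    using assms transition_prob(3)[OF assms(1)] by (intro nn_integral_cong) simp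
  then show ?thesis by (simp add: eta_def)
qed

lemma eta_mono:
  assumes "p \<in> graph M" "0 \<le> \<alpha>" "\<alpha> \<le> \<beta>" "\<And>z. z \<in> states M \<Longrightarrow> w z \<le> w' z"
  shows "eta M \<alpha> w p \<le> eta M \<beta> w' p"
proof -
  have "(\<integral>\<^sup>+z. w z \<partial>transition M p) \<le> (\<integral>\<^sup>+z. w' z \<partial>transition M p)"
    using assms(4) transition_prob(3)[OF assms(1)] by (intro nn_integral_mono) simp
  moreover have "ennreal \<alpha> \<le> ennreal \<beta>"
    using assms(3) by (rule ennreal_leI)
  ultimately show ?thesis
    unfolding eta_def by (intro add_left_mono mult_mono) simp_all
qed

lemma bellman_mono:
  assumes "x \<in> states M" "0 \<le> \<alpha>" "\<alpha> \<le> \<beta>" "\<And>z. z \<in> states M \<Longrightarrow> w z \<le> w' z"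
  shows "bellman M \<alpha> w x \<le> bellman M \<beta> w' x"
  unfolding bellman_def
proof (rule INF_greatest)
  fix a assume a: "a \<in> feasible M x"
  then have "eta M \<alpha> w (x, a) \<le> eta M \<beta> w' (x, a)"
    using assms by (intro eta_mono) (auto simp: graph_def)
  then show "(INF a\<in>feasible M x. eta M \<alpha> w (x, a)) \<le> eta M \<beta> w' (x, a)"
    using a by (rule INF_lower2[rotated])
qed

lemma bellman_le: "a \<in> feasible M x \<Longrightarrow> bellman M \<alpha> w x \<le> eta M \<alpha> w (x, a)"
  unfolding bellman_def by (rule INF_lower)

lemma inf_compact_cost:
  assumes "x \<in> states M"
  shows "inf_compact (feasible M x) (\<lambda>a. cost M (x, a))"
  unfolding inf_compact_def
proof (intro allI impI)
  fix l :: ennreal assume "l < \<infinity>"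
  then obtain r where r: "l = ennreal r" "0 \<le> r" by (cases l) auto
  have "enn2ereal (cost M (x, a)) \<le> ereal r \<longleftrightarrow> cost M (x, a) \<le> l" for a
    using r by (metis enn2ereal_ennreal less_eq_ennreal.rep_eq)
  then have "{a \<in> feasible M x. cost M (x, a) \<le> l} = {a \<in> feasible M x. enn2ereal (cost M (x, a)) \<le> ereal r}"
    by simp
  then show "compact {a \<in> feasible M x. cost M (x, a) \<le> l}"
    using S_star assms by (simp add: assumption_S_star_def inf_compact_on_def)
qed

text \<open>
  Setwise continuity speaks about bounded functions, so \<open>w\<close> is approximated by its truncations
  \<open>min(w, k)\<close>: each of them contributes a continuous function of the action, and the supremum over \<open>k\<close>
  preserves inf-compactness.
\<close>
lemma inf_compact_eta:
  assumes x: "x \<in> states M" and w [measurable]: "w \<in> borel_measurable (state_space M)" and \<alpha>: "0 \<le> \<alpha>"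
  shows "inf_compact (feasible M x) (\<lambda>a. eta M \<alpha> w (x, a))"
proof -
  define g where "g k z = min (w z) (of_nat k)" for k :: nat and z
  have gk: "g k z = ennreal (enn2real (g k z))" "enn2real (g k z) \<le> k" for k z
  proof -
    have "g k z \<le> of_nat k" by (simp add: g_def)
    then show "g k z = ennreal (enn2real (g k z))"
      by (metis ennreal_enn2real ennreal_of_nat_eq_real_of_nat ennreal_less_top le_less_trans)
    then show "enn2real (g k z) \<le> k"
      using \<open>g k z \<le> of_nat k\<close> by (metis ennreal_le_iff ennreal_of_nat_eq_real_of_nat of_nat_0_le_iff)
  qed
  have [measurable]: "g k \<in> borel_measurable (state_space M)" for k
    unfolding g_def by measurable
  define h where "h k a = (\<integral>z. enn2real (g k z) \<partial>transition M (x, a))" for k a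
  have h_cont: "continuous_on (feasible M x) (h k)" for k
  proof -
    have "(\<lambda>z. enn2real (g k z)) \<in> borel_measurable (state_space M)" by measurable
    moreover have "bounded ((\<lambda>z. enn2real (g k z)) ` states M)"
      using gk(2) by (intro boundedI[of _ "real k"]) auto
    ultimately show ?thesis
      using S_star x unfolding assumption_S_star_def h_def by blast
  qed
  have h_nonneg: "0 \<le> h k a" for k a
    unfolding h_def by (intro integral_nonneg_AE) simp
  have h_eq: "ennreal (h k a) = (\<integral>\<^sup>+z. g k z \<partial>transition M (x, a))" if "a \<in> feasible M x" for k a
  proof -
    have p: "(x, a) \<in> graph M" using x that by (simp add: graph_def)
    interpret T: prob_space "transition M (x, a)" by (rule transition_prob[OF p])
    note [measurable_cong] = transition_prob(2)[OF p]
    have "integrable (transition M (x, a)) (\<lambda>z. enn2real (g k z))"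
      using gk(2) by (intro T.integrable_const_bound[where B = "real k"]) auto
    then have "ennreal (h k a) = (\<integral>\<^sup>+z. ennreal (enn2real (g k z)) \<partial>transition M (x, a))"
      unfolding h_def by (intro nn_integral_eq_integral[symmetric]) auto
    then show ?thesis using gk(1) by simp
  qed
  have SUP_g: "(SUP k. g k z) = w z" for z
  proof (rule antisym)
    show "(SUP k. g k z) \<le> w z" by (intro SUP_least) (simp add: g_def)
    have "w z = min (w z) (SUP k. of_nat k)" by (simp add: ennreal_SUP_of_nat_eq_top)
    also have "\<dots> = (SUP k. g k z)"
      by (simp add: g_def inf_min[symmetric] inf_SUP)
    finally show "w z \<le> (SUP k. g k z)" by simp
  qed
  have mono_g: "incseq (\<lambda>k. g k z)" for z
    by (auto simp: incseq_def g_def min_le_iff_disj)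
  have eta_SUP: "eta M \<alpha> w (x, a) = (SUP k. cost M (x, a) + ennreal (\<alpha> * h k a))"
    if a: "a \<in> feasible M x" for a
  proof -
    have p: "(x, a) \<in> graph M" using x that by (simp add: graph_def)
    note [measurable_cong] = transition_prob(2)[OF p]
    have "(\<integral>\<^sup>+z. w z \<partial>transition M (x, a)) = (\<integral>\<^sup>+z. (SUP k. g k z) \<partial>transition M (x, a))"
      by (simp add: SUP_g)
    also have "\<dots> = (SUP k. \<integral>\<^sup>+z. g k z \<partial>transition M (x, a))"
      using mono_g by (intro nn_integral_monotone_convergence_SUP) (auto simp: incseq_def le_fun_def)
    also have "\<dots> = (SUP k. ennreal (h k a))" by (simp add: h_eq[OF a])
    finally show ?thesis
      using \<alpha> h_nonneg unfolding eta_def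
      by (simp add: ennreal_mult SUP_mult_left_ennreal ennreal_SUP_add_right)
  qed
  have "inf_compact (feasible M x) (\<lambda>a. SUP k. cost M (x, a) + ennreal (\<alpha> * h k a))"
    using \<alpha> h_nonneg
    by (intro inf_compact_SUP inf_compact_add_continuous inf_compact_cost x continuous_intros h_cont) simp
  then show ?thesis
    unfolding inf_compact_def using eta_SUP by (simp cong: conj_cong)
qed

lemma eta_SUP:
  assumes p: "p \<in> graph M"
    and w: "\<And>n. w n \<in> borel_measurable (state_space M)"
    and w_mono: "\<And>n z. z \<in> states M \<Longrightarrow> w n z \<le> w (Suc n) z"
    and \<alpha>: "incseq (\<lambda>n. ennreal (\<alpha> n))" "ennreal \<beta> = (SUP n. ennreal (\<alpha> n))"
    and v: "\<And>z. z \<in> states M \<Longrightarrow> v z = (SUP n. w n z)"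
  shows "eta M \<beta> v p = (SUP n. eta M (\<alpha> n) (w n) p)"
proof -
  note s = transition_prob(2,3)[OF p]
  have int_mono: "incseq (\<lambda>n. \<integral>\<^sup>+z. w n z \<partial>transition M p)"
    using w_mono s(2) by (intro incseq_SucI nn_integral_mono) auto
  have "(\<integral>\<^sup>+z. v z \<partial>transition M p) = (\<integral>\<^sup>+z. (SUP n. w n z) \<partial>transition M p)"
    using v s(2) by (intro nn_integral_cong) simp
  also have "\<dots> = (SUP n. \<integral>\<^sup>+z. w n z \<partial>transition M p)"
    using w w_mono s by (intro nn_integral_monotone_convergence_SUP_AE) (auto simp: measurable_cong_sets[OF s(1) refl])
  finally have "ennreal \<beta> * (\<integral>\<^sup>+z. v z \<partial>transition M p) = (SUP n. ennreal (\<alpha> n) * (\<integral>\<^sup>+z. w n z \<partial>transition M p))"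
    using SUP_mult_incseq_ennreal[OF \<alpha>(1) int_mono] \<alpha>(2) by simp
  then show ?thesis
    unfolding eta_def by (simp add: ennreal_SUP_add_right)
qed

text \<open>
  This continuity along increasing sequences yields both the infinite-horizon optimality equation
  (constant discount factors) and left continuity of the values in the discount factor.  The
  conditions concern the state space only, where the transition probabilities live.
\<close>
lemma bellman_SUP:
  assumes x: "x \<in> states M"
    and w: "\<And>n. w n \<in> borel_measurable (state_space M)"
    and w_mono: "\<And>n z. z \<in> states M \<Longrightarrow> w n z \<le> w (Suc n) z"
    and \<alpha>_nonneg: "\<And>n. 0 \<le> \<alpha> n" and \<alpha>: "incseq \<alpha>" "ennreal \<beta> = (SUP n. ennreal (\<alpha> n))"
    and v: "\<And>z. z \<in> states M \<Longrightarrow> v z = (SUP n. w n z)"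
  shows "bellman M \<beta> v x = (SUP n. bellman M (\<alpha> n) (w n) x)"
proof -
  have "incseq (\<lambda>n. ennreal (\<alpha> n))"
    using \<alpha>(1) by (auto simp: incseq_def intro: ennreal_leI)
  then have "bellman M \<beta> v x = (INF a\<in>feasible M x. SUP n. eta M (\<alpha> n) (w n) (x, a))"
    unfolding bellman_def using x w w_mono \<alpha> v by (intro INF_cong refl eta_SUP) (auto simp: graph_def)
  also have "\<dots> = (SUP n. INF a\<in>feasible M x. eta M (\<alpha> n) (w n) (x, a))"
  proof (rule INF_SUP_inf_compact)
    show "eta M (\<alpha> n) (w n) (x, a) \<le> eta M (\<alpha> (Suc n)) (w (Suc n)) (x, a)" if "a \<in> feasible M x" for n a
      using that x \<alpha>(1) by (intro eta_mono w_mono \<alpha>_nonneg) (auto simp: graph_def incseq_Suc_iff)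
  qed (use x w \<alpha>_nonneg feasible_nonempty in \<open>auto intro: inf_compact_eta\<close>)
  finally show ?thesis unfolding bellman_def .
qed

end

section \<open>Measurable minimizers of the one-step operator\<close>

primrec value_iteration :: "('x, 'a) mdp \<Rightarrow> nat \<Rightarrow> real \<Rightarrow> 'x \<Rightarrow> ennreal" where
  "value_iteration M 0 = (\<lambda>\<alpha> x. 0)"
| "value_iteration M (Suc t) = (\<lambda>\<alpha>. bellman M \<alpha> (value_iteration M t \<alpha>))"

context S_star_mdp
begin

lemma discount_section_measurable:
  assumes w: "(\<lambda>(x, \<alpha>). w \<alpha> x) \<in> parameters \<rightarrow>\<^sub>M N" and \<alpha>: "\<alpha> \<in> {0..1}"
  shows "w \<alpha> \<in> state_space M \<rightarrow>\<^sub>M N"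
proof -
  have "(\<lambda>x. (x, \<alpha>)) \<in> state_space M \<rightarrow>\<^sub>M parameters"
  proof (rule measurable_restrict_space2)
    show "(\<lambda>x. (x, \<alpha>)) \<in> space (state_space M) \<rightarrow> states M \<times> {0..1}"
      using \<alpha> by (simp add: space_restrict_space)
    show "(\<lambda>x. (x, \<alpha>)) \<in> borel_measurable (state_space M)"
      by (intro borel_measurable_Pair measurable_restrict_space1) simp_all
  qed
  from measurable_compose[OF this w] show ?thesis by simp
qed

definition feasible_parameters :: "(('x \<times> real) \<times> 'a) set" where
  "feasible_parameters = {q. fst (fst q) \<in> states M \<and> snd (fst q) \<in> {0..1} \<and> snd q \<in> feasible M (fst (fst q))}"

text \<open>
  The value \<open>\<infinity>\<close> at infeasible triples leaves finite sublevel sets unchanged, and hence the minimum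
  over the feasible actions.
\<close>
definition eta_total :: "(real \<Rightarrow> 'x \<Rightarrow> ennreal) \<Rightarrow> ('x \<times> real) \<times> 'a \<Rightarrow> ennreal" where
  "eta_total w q = (if q \<in> feasible_parameters
     then eta M (snd (fst q)) (w (snd (fst q))) (fst (fst q), snd q) else \<infinity>)"

lemma graph_borel_UNIV: "graph M \<in> sets borel"
proof -
  have "states M \<times> actions M \<in> sets borel"
    by (rule borel_Times[OF states_borel actions_borel])
  then show ?thesis
    using graph_borel by (subst (asm) sets_restrict_space_iff) auto
qed

lemma state_action_measurable:
  "(\<lambda>q :: ('x \<times> real) \<times> 'a. (fst (fst q), snd q)) \<in> borel_measurable borel"
  by (intro borel_measurable_continuous_onI continuous_intros)

lemma discount_measurable: "(\<lambda>q :: ('x \<times> real) \<times> 'a. snd (fst q)) \<in> borel_measurable borel"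
  by (intro borel_measurable_continuous_onI continuous_intros)

lemma feasible_parameters_borel: "feasible_parameters \<in> sets borel"
proof -
  have "feasible_parameters = (\<lambda>q. (fst (fst q), snd q)) -` graph M \<inter> (\<lambda>q. snd (fst q)) -` {0..1}"
    by (auto simp: feasible_parameters_def graph_def)
  then show ?thesis
    using measurable_sets[OF state_action_measurable graph_borel_UNIV]
      measurable_sets[OF discount_measurable, of "{0..1}"] by simp
qed

lemma eta_total_measurable:
  assumes w: "(\<lambda>(x, \<alpha>). w \<alpha> x) \<in> borel_measurable parameters"
  shows "eta_total w \<in> borel_measurable borel"
proof -
  let ?S = "restrict_space borel feasible_parameters :: (('x \<times> real) \<times> 'a) measure"
  have sa: "(\<lambda>q. (fst (fst q), snd q)) \<in> ?S \<rightarrow>\<^sub>M restrict_space borel (graph M)"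
    by (intro measurable_restrict_space2 measurable_restrict_space1 state_action_measurable)
      (auto simp: space_restrict_space feasible_parameters_def graph_def)
  have d [measurable]: "(\<lambda>q. snd (fst q)) \<in> borel_measurable ?S"
    by (intro measurable_restrict_space1 discount_measurable)
  have c [measurable]: "(\<lambda>q. cost M (fst (fst q), snd q)) \<in> borel_measurable ?S"
    by (rule measurable_compose[OF sa cost_borel])
  have k: "(\<lambda>q. transition M (fst (fst q), snd q)) \<in> ?S \<rightarrow>\<^sub>M subprob_algebra (state_space M)"
    by (rule measurable_compose[OF sa measurable_prob_algebraD[OF transition_kernel]])
  have "(\<lambda>p. (snd p, snd (fst (fst p)))) \<in> ?S \<Otimes>\<^sub>M state_space M \<rightarrow>\<^sub>M parameters"
  proof (rule measurable_restrict_space2)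
    show "(\<lambda>p. (snd p, snd (fst (fst p)))) \<in> space (?S \<Otimes>\<^sub>M state_space M) \<rightarrow> states M \<times> {0..1}"
      by (auto simp: space_pair_measure space_restrict_space feasible_parameters_def)
    have "(\<lambda>p. snd (fst (fst p))) \<in> borel_measurable (?S \<Otimes>\<^sub>M state_space M)"
      by (rule measurable_compose[OF measurable_fst d])
    moreover have "snd \<in> ?S \<Otimes>\<^sub>M state_space M \<rightarrow>\<^sub>M (borel :: 'x measure)"
      by (rule measurable_compose[OF measurable_snd measurable_restrict_space1]) simp
    ultimately show "(\<lambda>p. (snd p, snd (fst (fst p)))) \<in> borel_measurable (?S \<Otimes>\<^sub>M state_space M)"
      by (intro borel_measurable_Pair)
  qed
  from measurable_compose[OF this w]
  have "(\<lambda>(q, z). w (snd (fst q)) z) \<in> borel_measurable (?S \<Otimes>\<^sub>M state_space M)"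
    by (simp add: split_beta)
  from nn_integral_measurable_subprob_algebra2[OF this k]
  have [measurable]: "(\<lambda>q. \<integral>\<^sup>+z. w (snd (fst q)) z \<partial>transition M (fst (fst q), snd q)) \<in> borel_measurable ?S" .
  have "(\<lambda>q. eta M (snd (fst q)) (w (snd (fst q))) (fst (fst q), snd q)) \<in> borel_measurable ?S"
    unfolding eta_def by measurable
  then show ?thesis
    unfolding eta_total_def[abs_def]
    using feasible_parameters_borel by (subst (asm) measurable_restrict_space_iff[where c = \<infinity>]) auto
qed

lemma inf_compact_eta_total:
  assumes w: "(\<lambda>(x, \<alpha>). w \<alpha> x) \<in> borel_measurable parameters"
  shows "inf_compact UNIV (\<lambda>a. eta_total w (p, a))"
  unfolding inf_compact_def
proof (intro allI impI)
  fix l :: ennreal assume l: "l < \<infinity>"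
  obtain x \<alpha> where p: "p = (x, \<alpha>)" by (cases p)
  show "compact {a \<in> UNIV. eta_total w (p, a) \<le> l}"
  proof (cases "x \<in> states M \<and> \<alpha> \<in> {0..1}")
    case True
    then have "{a \<in> UNIV. eta_total w (p, a) \<le> l} = {a \<in> feasible M x. eta M \<alpha> (w \<alpha>) (x, a) \<le> l}"
      using l by (auto simp: eta_total_def feasible_parameters_def p top_unique)
    then show ?thesis
      using inf_compact_eta[of x "w \<alpha>" \<alpha>] discount_section_measurable[OF w, of \<alpha>] True l
      by (simp add: inf_compact_def)
  next
    case False
    then have "{a \<in> UNIV. eta_total w (p, a) \<le> l} = {}"
      using l by (auto simp: eta_total_def feasible_parameters_def p top_unique)
    then show ?thesis by simp
  qed
qed

lemma INF_eta_total:
  assumes "x \<in> states M" "\<alpha> \<in> {0..1}"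
  shows "(INF a. eta_total w ((x, \<alpha>), a)) = bellman M \<alpha> (w \<alpha>) x"
  unfolding bellman_def
proof (rule antisym)
  show "(INF a. eta_total w ((x, \<alpha>), a)) \<le> (INF a\<in>feasible M x. eta M \<alpha> (w \<alpha>) (x, a))"
  proof (rule INF_greatest)
    fix a assume "a \<in> feasible M x"
    then have "eta_total w ((x, \<alpha>), a) = eta M \<alpha> (w \<alpha>) (x, a)"
      using assms by (simp add: eta_total_def feasible_parameters_def)
    then show "(INF a. eta_total w ((x, \<alpha>), a)) \<le> eta M \<alpha> (w \<alpha>) (x, a)"
      by (metis INF_lower UNIV_I)
  qed
  show "(INF a\<in>feasible M x. eta M \<alpha> (w \<alpha>) (x, a)) \<le> (INF a. eta_total w ((x, \<alpha>), a))"
  proof (rule INF_greatest)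
    fix a
    show "(INF a\<in>feasible M x. eta M \<alpha> (w \<alpha>) (x, a)) \<le> eta_total w ((x, \<alpha>), a)"
      using INF_lower[of a "feasible M x" "\<lambda>a. eta M \<alpha> (w \<alpha>) (x, a)"]
      by (auto simp: eta_total_def feasible_parameters_def)
  qed
qed

text \<open>
  The general minimum theorem is applied with the pair \<open>(x, \<alpha>)\<close> as parameter, which makes the
  minimizers jointly measurable in the state and the discount factor.
\<close>
theorem bellman_measurable_selection:
  assumes w: "(\<lambda>(x, \<alpha>). w \<alpha> x) \<in> borel_measurable parameters"
  shows "(\<lambda>(x, \<alpha>). bellman M \<alpha> (w \<alpha>) x) \<in> borel_measurable parameters"
    and "{(x, \<alpha>, a). x \<in> states M \<and> \<alpha> \<in> {0..1} \<and> a \<in> feasible M x \<and>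
        bellman M \<alpha> (w \<alpha>) x = eta M \<alpha> (w \<alpha>) (x, a)}
      \<in> sets (restrict_space borel (states M \<times> {0..1} \<times> actions M))"
    and "\<exists>\<sigma>. (\<lambda>(x, \<alpha>). \<sigma> \<alpha> x) \<in> parameters \<rightarrow>\<^sub>M action_space M \<and>
      (\<forall>\<alpha>\<in>{0..1}. \<sigma> \<alpha> \<in> selectors M \<and>
        (\<forall>x\<in>states M. eta M \<alpha> (w \<alpha>) (x, \<sigma> \<alpha> x) = bellman M \<alpha> (w \<alpha>) x))"
proof -
  define m where "m p = (INF a. eta_total w (p, a))" for p
  obtain s where s: "s \<in> borel_measurable borel" and m: "m \<in> borel_measurable borel"
    and ms: "\<And>p. m p < \<infinity> \<Longrightarrow> eta_total w (p, s p) = m p"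
    using inf_compact_borel_minimum[OF eta_total_measurable[OF w] inf_compact_eta_total[OF w]]
    unfolding m_def by blast
  have m_eq: "m (x, \<alpha>) = bellman M \<alpha> (w \<alpha>) x" if "x \<in> states M" "\<alpha> \<in> {0..1}" for x \<alpha>
    unfolding m_def by (rule INF_eta_total[OF that])
  have m_par: "m \<in> borel_measurable parameters"
    by (rule measurable_restrict_space1[OF m])
  then show 1: "(\<lambda>(x, \<alpha>). bellman M \<alpha> (w \<alpha>) x) \<in> borel_measurable parameters"
    by (subst measurable_cong[where g = m]) (auto simp: space_restrict_space m_eq)
  show "{(x, \<alpha>, a). x \<in> states M \<and> \<alpha> \<in> {0..1} \<and> a \<in> feasible M x \<and>
        bellman M \<alpha> (w \<alpha>) x = eta M \<alpha> (w \<alpha>) (x, a)}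
      \<in> sets (restrict_space borel (states M \<times> {0..1} \<times> actions M))" (is "?T \<in> _")
  proof -
    define k :: "'x \<times> real \<times> 'a \<Rightarrow> ('x \<times> real) \<times> 'a" where "k = (\<lambda>r. ((fst r, fst (snd r)), snd (snd r)))"
    define Q where "Q = feasible_parameters \<inter> {q \<in> space borel. eta_total w q = m (fst q)}"
    have "(\<lambda>q :: ('x \<times> real) \<times> 'a. m (fst q)) \<in> borel_measurable borel"
      using fst_borel_measurable m by (rule measurable_compose)
    then have "{q \<in> space borel. eta_total w q = m (fst q)} \<in> sets borel"
      using eta_total_measurable[OF w] by measurable
    then have "Q \<in> sets borel"
      unfolding Q_def using feasible_parameters_borel by (rule sets.Int[rotated])
    moreover have "k \<in> borel_measurable borel"
      unfolding k_def by (intro borel_measurable_continuous_onI continuous_intros)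
    ultimately have "k -` Q \<in> sets borel"
      using measurable_sets[of k borel borel Q] by simp
    moreover have "?T = k -` Q"
    proof (intro set_eqI iffI)
      fix r assume "r \<in> ?T"
      then show "r \<in> k -` Q"
        by (auto simp: Q_def k_def eta_total_def feasible_parameters_def m_eq)
    next
      fix r assume "r \<in> k -` Q"
      moreover obtain x \<alpha> a where "r = (x, \<alpha>, a)" by (cases r) auto
      ultimately show "r \<in> ?T"
        using m_eq[of x \<alpha>] by (auto simp: Q_def k_def eta_total_def feasible_parameters_def)
    qed
    moreover have "?T \<subseteq> states M \<times> {0..1} \<times> actions M"
      using graph_subset by (auto simp: graph_def)
    moreover have "states M \<times> {0..1::real} \<times> actions M \<in> sets borel"
      by (intro borel_Times states_borel actions_borel) simp
    ultimately show ?thesis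
      by (subst sets_restrict_space_iff) auto
  qed
  obtain \<phi> where \<phi>: "\<phi> \<in> selectors M" using selector_exists by blast
  \<comment> \<open>Where the minimum is infinite every feasible action attains it; the given Borel selector provides one.\<close>
  define \<sigma> where "\<sigma> \<alpha> x = (if m (x, \<alpha>) < \<infinity> then s (x, \<alpha>) else \<phi> x)" for \<alpha> x
  have \<sigma>: "\<sigma> \<alpha> x \<in> feasible M x \<and> eta M \<alpha> (w \<alpha>) (x, \<sigma> \<alpha> x) = bellman M \<alpha> (w \<alpha>) x"
    if x: "x \<in> states M" and \<alpha>: "\<alpha> \<in> {0..1}" for x \<alpha>
  proof (cases "m (x, \<alpha>) < \<infinity>")
    case True
    then have "eta_total w ((x, \<alpha>), \<sigma> \<alpha> x) = m (x, \<alpha>)"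
      using ms[of "(x, \<alpha>)"] by (simp add: \<sigma>_def)
    moreover from this have "((x, \<alpha>), \<sigma> \<alpha> x) \<in> feasible_parameters"
      using True by (auto simp: eta_total_def split: if_splits)
    ultimately show ?thesis
      using m_eq[OF x \<alpha>] by (simp add: eta_total_def feasible_parameters_def)
  next
    case False
    then have \<sigma>x: "\<sigma> \<alpha> x = \<phi> x" and top: "bellman M \<alpha> (w \<alpha>) x = \<infinity>"
      using m_eq[OF x \<alpha>] by (simp_all add: \<sigma>_def less_top[symmetric])
    have f: "\<phi> x \<in> feasible M x" using \<phi> x by (simp add: selectors_def)
    then have "bellman M \<alpha> (w \<alpha>) x \<le> eta M \<alpha> (w \<alpha>) (x, \<phi> x)"
      by (rule bellman_le)
    then show ?thesis using f \<sigma>x top by (simp add: top_unique)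
  qed
  have \<sigma>_meas: "(\<lambda>(x, \<alpha>). \<sigma> \<alpha> x) \<in> parameters \<rightarrow>\<^sub>M action_space M"
  proof (rule measurable_restrict_space2)
    show "(\<lambda>(x, \<alpha>). \<sigma> \<alpha> x) \<in> space parameters \<rightarrow> actions M"
      using \<sigma> graph_subset by (fastforce simp: space_restrict_space graph_def)
    have fst_par: "fst \<in> parameters \<rightarrow>\<^sub>M state_space M"
      by (intro measurable_restrict_space2 measurable_restrict_space1 fst_borel_measurable)
        (auto simp: space_restrict_space)
    have "\<phi> \<in> state_space M \<rightarrow>\<^sub>M action_space M" using \<phi> by (simp add: selectors_def)
    from measurable_compose[OF measurable_compose[OF fst_par this] measurable_restrict_space1[OF measurable_ident]]
    have [measurable]: "(\<lambda>p. \<phi> (fst p)) \<in> borel_measurable parameters" by simp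
    have [measurable]: "s \<in> borel_measurable parameters" by (rule measurable_restrict_space1[OF s])
    note m_par[measurable]
    have "(\<lambda>p. if m p < \<infinity> then s p else \<phi> (fst p)) \<in> borel_measurable parameters"
      by measurable
    moreover have "(\<lambda>(x, \<alpha>). \<sigma> \<alpha> x) = (\<lambda>p. if m p < \<infinity> then s p else \<phi> (fst p))"
      by (auto simp: \<sigma>_def fun_eq_iff)
    ultimately show "(\<lambda>(x, \<alpha>). \<sigma> \<alpha> x) \<in> borel_measurable parameters" by simp
  qed
  have "\<sigma> \<alpha> \<in> selectors M" if "\<alpha> \<in> {0..1}" for \<alpha>
    using discount_section_measurable[OF \<sigma>_meas that] \<sigma> that by (simp add: selectors_def)
  with \<sigma> \<sigma>_meas show "\<exists>\<sigma>. (\<lambda>(x, \<alpha>). \<sigma> \<alpha> x) \<in> parameters \<rightarrow>\<^sub>M action_space M \<and>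
      (\<forall>\<alpha>\<in>{0..1}. \<sigma> \<alpha> \<in> selectors M \<and>
        (\<forall>x\<in>states M. eta M \<alpha> (w \<alpha>) (x, \<sigma> \<alpha> x) = bellman M \<alpha> (w \<alpha>) x))"
    by (intro exI[of _ \<sigma>]) simp
qed

lemma bellman_minimizers:
  assumes x: "x \<in> states M" and w: "w \<in> borel_measurable (state_space M)" and \<alpha>: "0 \<le> \<alpha>"
  defines "A \<equiv> {a \<in> feasible M x. bellman M \<alpha> w x = eta M \<alpha> w (x, a)}"
  shows "is_minimum (bellman M \<alpha> w x) (feasible M x) (\<lambda>a. eta M \<alpha> w (x, a))"
    and "A \<noteq> {}"
    and "bellman M \<alpha> w x = \<infinity> \<Longrightarrow> A = feasible M x"
    and "bellman M \<alpha> w x < \<infinity> \<Longrightarrow> compact A"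
proof -
  note ic = inf_compact_eta[OF x w \<alpha>]
  obtain a where a: "a \<in> feasible M x" "eta M \<alpha> w (x, a) = bellman M \<alpha> w x"
    using inf_compact_attains[OF ic feasible_nonempty[OF x]] unfolding bellman_def by blast
  then show "is_minimum (bellman M \<alpha> w x) (feasible M x) (\<lambda>a. eta M \<alpha> w (x, a))"
    using bellman_le unfolding is_minimum_def by blast
  show "A \<noteq> {}" using a unfolding A_def by force
  show "A = feasible M x" if "bellman M \<alpha> w x = \<infinity>"
    using bellman_le[of _ x \<alpha> w] that unfolding A_def by (force simp: top_unique)
  show "compact A" if "bellman M \<alpha> w x < \<infinity>"
  proof -
    have "A = {a \<in> feasible M x. eta M \<alpha> w (x, a) \<le> bellman M \<alpha> w x}"
      unfolding A_def using bellman_le by (auto intro: antisym)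
    then show ?thesis using ic that by (simp add: inf_compact_def)
  qed
qed

end

section \<open>Value iteration and optimal policies\<close>

text \<open>
  For a nondecreasing function, lower semicontinuity is a condition at the left of each point only,
  and void at the left end of the interval.
\<close>
lemma lsc_on_if_left_approximable:
  fixes f :: "real \<Rightarrow> ennreal"
  assumes mono: "mono_on {0..1} f"
    and left: "\<And>\<beta>. \<beta> \<in> {0<..1} \<Longrightarrow>
      \<exists>\<alpha> :: nat \<Rightarrow> real. (\<forall>n. 0 \<le> \<alpha> n \<and> \<alpha> n < \<beta>) \<and> f \<beta> \<le> (SUP n. f (\<alpha> n))"
  shows "lsc_on {0..1} f"
  unfolding lsc_on_def
proof (intro ballI le_Liminf_iff[THEN iffD2] allI impI)
  fix \<beta> y assume \<beta>: "\<beta> \<in> {0..1::real}" and y: "y < f \<beta>"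
  show "\<forall>\<^sub>F \<gamma> in at \<beta> within {0..1}. y < f \<gamma>"
  proof (cases "\<beta> = 0")
    case True
    have "y < f \<gamma>" if "\<gamma> \<in> {0..1}" for \<gamma>
      using y True that mono_onD[OF mono, of 0 \<gamma>] by (auto intro: less_le_trans)
    then show ?thesis by (auto simp: eventually_at_filter)
  next
    case False
    then obtain \<alpha> :: "nat \<Rightarrow> real" where \<alpha>: "\<And>n. 0 \<le> \<alpha> n" "\<And>n. \<alpha> n < \<beta>" "f \<beta> \<le> (SUP n. f (\<alpha> n))"
      using left[of \<beta>] \<beta> by auto
    have "y < (SUP n. f (\<alpha> n))"
      using y \<alpha>(3) by (rule less_le_trans)
    then obtain n where n: "y < f (\<alpha> n)"
      unfolding less_SUP_iff by blast
    have "y < f \<gamma>" if "\<gamma> \<in> {0..1}" "\<alpha> n < \<gamma>" for \<gamma>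
      using n that \<alpha>(1)[of n] mono_onD[OF mono, of "\<alpha> n" \<gamma>] by (auto intro: less_le_trans)
    then show ?thesis
      unfolding eventually_at_topological using \<alpha>(2)[of n] by (intro exI[of _ "{\<alpha> n<..}"]) auto
  qed
qed

context S_star_mdp
begin

definition value_limit :: "real \<Rightarrow> 'x \<Rightarrow> ennreal" where
  "value_limit \<alpha> x = (SUP t. value_iteration M t \<alpha> x)"

lemma value_iteration_measurable:
  "(\<lambda>(x, \<alpha>). value_iteration M t \<alpha> x) \<in> borel_measurable parameters"
proof (induction t)
  case 0
  then show ?case by (simp add: split_beta)
next
  case (Suc t)
  from bellman_measurable_selection(1)[OF Suc] show ?case by simp
qed

lemma value_limit_measurable: "(\<lambda>(x, \<alpha>). value_limit \<alpha> x) \<in> borel_measurable parameters"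
proof -
  have "(\<lambda>p. SUP t. (case p of (x, \<alpha>) \<Rightarrow> value_iteration M t \<alpha> x)) \<in> borel_measurable parameters"
    by (intro borel_measurable_SUP value_iteration_measurable) simp
  moreover have "(\<lambda>p. SUP t. (case p of (x, \<alpha>) \<Rightarrow> value_iteration M t \<alpha> x)) = (\<lambda>(x, \<alpha>). value_limit \<alpha> x)"
    by (auto simp: value_limit_def fun_eq_iff)
  ultimately show ?thesis by simp
qed

lemma value_iteration_state_measurable:
  "\<alpha> \<in> {0..1} \<Longrightarrow> value_iteration M t \<alpha> \<in> borel_measurable (state_space M)"
  by (rule discount_section_measurable[OF value_iteration_measurable])

lemma value_limit_state_measurable:
  "\<alpha> \<in> {0..1} \<Longrightarrow> value_limit \<alpha> \<in> borel_measurable (state_space M)"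
  by (rule discount_section_measurable[OF value_limit_measurable])

lemma value_iteration_Suc_le:
  assumes "\<alpha> \<in> {0..1}" "x \<in> states M"
  shows "value_iteration M t \<alpha> x \<le> value_iteration M (Suc t) \<alpha> x"
  using assms(2)
proof (induction t arbitrary: x)
  case (Suc t)
  have "bellman M \<alpha> (value_iteration M t \<alpha>) x \<le> bellman M \<alpha> (value_iteration M (Suc t) \<alpha>) x"
    by (rule bellman_mono[OF Suc.prems _ order_refl Suc.IH]) (use assms(1) in simp)
  then show ?case by simp
qed simp

lemma incseq_value_iteration:
  "\<alpha> \<in> {0..1} \<Longrightarrow> x \<in> states M \<Longrightarrow> incseq (\<lambda>t. value_iteration M t \<alpha> x)"
  by (intro incseq_SucI value_iteration_Suc_le)

text \<open>
  The one-step operator commutes with the increasing limit of value iteration.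
\<close>
lemma value_limit_fixed_point:
  assumes \<alpha>: "\<alpha> \<in> {0..1}" and x: "x \<in> states M"
  shows "bellman M \<alpha> (value_limit \<alpha>) x = value_limit \<alpha> x"
proof -
  have "bellman M \<alpha> (value_limit \<alpha>) x = (SUP t. bellman M \<alpha> (value_iteration M t \<alpha>) x)"
  proof (rule bellman_SUP[OF x])
    show "value_iteration M n \<alpha> \<in> borel_measurable (state_space M)" for n
      by (rule value_iteration_state_measurable[OF \<alpha>])
    show "value_iteration M n \<alpha> z \<le> value_iteration M (Suc n) \<alpha> z" if "z \<in> states M" for n z
      by (rule value_iteration_Suc_le[OF \<alpha> that])
  qed (use \<alpha> in \<open>auto simp: value_limit_def\<close>)
  also have "\<dots> = (SUP t. value_iteration M (Suc t) \<alpha> x)" by simp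
  also have "\<dots> = value_limit \<alpha> x"
    unfolding value_limit_def
    using LIMSEQ_unique[OF LIMSEQ_Suc[OF LIMSEQ_SUP[OF incseq_value_iteration[OF \<alpha> x]]]
      LIMSEQ_SUP[of "\<lambda>t. value_iteration M (Suc t) \<alpha> x"]] incseq_value_iteration[OF \<alpha> x]
    by (simp add: incseq_Suc_iff del: value_iteration.simps)
  finally show ?thesis .
qed

lemma value_iteration_mono_discount:
  assumes "0 \<le> \<alpha>" "\<alpha> \<le> \<beta>" "x \<in> states M"
  shows "value_iteration M t \<alpha> x \<le> value_iteration M t \<beta> x"
  using assms(3)
proof (induction t arbitrary: x)
  case (Suc t)
  show ?case
    using bellman_mono[OF Suc.prems assms(1,2) Suc.IH] by simp
qed simp

text \<open>
  Induction over the horizon: the values of the previous stage at the increasing discount factors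
  converge, and the one-step operator is continuous along increasing sequences in both arguments.
\<close>
lemma value_iteration_left_continuous:
  assumes \<beta>: "\<beta> \<in> {0..1}" and x: "x \<in> states M"
  shows "value_iteration M t \<beta> x = (SUP n. value_iteration M t (\<beta> * (1 - 1 / Suc n)) x)"
  using x
proof (induction t arbitrary: x)
  case 0
  then show ?case by simp
next
  case (Suc t)
  define \<alpha> :: "nat \<Rightarrow> real" where "\<alpha> n = \<beta> * (1 - 1 / Suc n)" for n
  have r: "0 \<le> 1 - 1 / Suc n" "1 - 1 / Suc n \<le> (1::real)" for n by simp_all
  have \<alpha>: "\<alpha> n \<in> {0..1}" for n
    using \<beta> r[of n] mult_mono[of \<beta> 1 "1 - 1 / Suc n" 1] by (auto simp: \<alpha>_def)
  have inc: "incseq \<alpha>"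
    unfolding \<alpha>_def using \<beta> by (intro incseq_SucI mult_left_mono diff_left_mono frac_le) auto
  have "\<alpha> \<longlonglongrightarrow> \<beta> * (1 - 0)"
    unfolding \<alpha>_def by (intro tendsto_intros LIMSEQ_Suc[OF lim_1_over_n])
  then have "(\<lambda>n. ennreal (\<alpha> n)) \<longlonglongrightarrow> ennreal \<beta>"
    by (intro tendsto_ennrealI) simp
  moreover have "incseq (\<lambda>n. ennreal (\<alpha> n))"
    using inc by (auto simp: incseq_def intro: ennreal_leI)
  ultimately have sup: "ennreal \<beta> = (SUP n. ennreal (\<alpha> n))"
    using LIMSEQ_SUP LIMSEQ_unique by blast
  have "bellman M \<beta> (value_iteration M t \<beta>) x = (SUP n. bellman M (\<alpha> n) (value_iteration M t (\<alpha> n)) x)"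
  proof (rule bellman_SUP[OF Suc.prems])
    show "value_iteration M t (\<alpha> n) \<in> borel_measurable (state_space M)" for n
      by (rule value_iteration_state_measurable[OF \<alpha>])
    show "value_iteration M t (\<alpha> n) z \<le> value_iteration M t (\<alpha> (Suc n)) z" if "z \<in> states M" for n z
      using \<alpha>[of n] inc that by (intro value_iteration_mono_discount) (auto simp: incseq_Suc_iff)
    show "0 \<le> \<alpha> n" for n using \<alpha>[of n] by simp
    show "value_iteration M t \<beta> z = (SUP n. value_iteration M t (\<alpha> n) z)" if "z \<in> states M" for z
      unfolding \<alpha>_def by (rule Suc.IH[OF that])
  qed (rule inc, rule sup)
  then show ?case by (simp add: \<alpha>_def)
qed

lemma value_limit_left_continuous:
  assumes \<beta>: "\<beta> \<in> {0..1}" and x: "x \<in> states M"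
  shows "value_limit \<beta> x = (SUP n. value_limit (\<beta> * (1 - 1 / Suc n)) x)"
proof -
  have "value_limit \<beta> x = (SUP t. SUP n. value_iteration M t (\<beta> * (1 - 1 / Suc n)) x)"
    unfolding value_limit_def using value_iteration_left_continuous[OF \<beta> x] by simp
  also have "\<dots> = (SUP n. SUP t. value_iteration M t (\<beta> * (1 - 1 / Suc n)) x)"
    by (rule SUP_commute)
  finally show ?thesis by (simp add: value_limit_def)
qed

lemma mono_on_value_iteration: "x \<in> states M \<Longrightarrow> mono_on {0..1} (\<lambda>\<alpha>. value_iteration M t \<alpha> x)"
  by (auto intro!: mono_onI value_iteration_mono_discount)

lemma mono_on_value_limit: "x \<in> states M \<Longrightarrow> mono_on {0..1} (\<lambda>\<alpha>. value_limit \<alpha> x)"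
  unfolding value_limit_def by (auto intro!: mono_onI SUP_mono' value_iteration_mono_discount)

lemma lsc_on_if_left_continuous:
  fixes f :: "real \<Rightarrow> ennreal"
  assumes "mono_on {0..1} f" "\<And>\<beta>. \<beta> \<in> {0..1} \<Longrightarrow> f \<beta> = (SUP n. f (\<beta> * (1 - 1 / Suc n)))"
  shows "lsc_on {0..1} f"
proof (rule lsc_on_if_left_approximable[OF assms(1)])
  fix \<beta> :: real assume \<beta>: "\<beta> \<in> {0<..1}"
  have "\<beta> * (1 - 1 / Suc n) < \<beta> * 1" for n
    using \<beta> by (intro mult_strict_left_mono) auto
  moreover have "0 \<le> \<beta> * (1 - 1 / Suc n)" for n
    using \<beta> by (intro mult_nonneg_nonneg) auto
  moreover have "f \<beta> \<le> (SUP n. f (\<beta> * (1 - 1 / Suc n)))"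
    using assms(2)[of \<beta>] \<beta> by simp
  ultimately show "\<exists>\<alpha> :: nat \<Rightarrow> real. (\<forall>n. 0 \<le> \<alpha> n \<and> \<alpha> n < \<beta>) \<and> f \<beta> \<le> (SUP n. f (\<alpha> n))"
    by (intro exI[of _ "\<lambda>n. \<beta> * (1 - 1 / Suc n)"]) simp
qed

lemma controlled_processI:
  "\<pi> \<in> policies M \<Longrightarrow> x \<in> states M \<Longrightarrow> controlled_process M \<pi> x"
  by (intro controlled_process.intro markov_decision_process_axioms controlled_process_axioms.intro)

text \<open>
  At epoch \<open>k\<close> of a problem with horizon \<open>T\<close> there remain \<open>T - k\<close> decisions, so the telescoping sum is
  used with the iterates in reversed order.
\<close>
lemma value_iteration_le_fin_cost:
  assumes \<pi>: "\<pi> \<in> policies M" and \<alpha>: "\<alpha> \<in> {0..1}" and x: "x \<in> states M"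
  shows "value_iteration M T \<alpha> x \<le> fin_cost M \<pi> T \<alpha> x"
proof -
  interpret controlled_process M \<pi> x by (rule controlled_processI[OF \<pi> x])
  let ?w = "\<lambda>k. value_iteration M (T - k) \<alpha>"
  have "?w 0 x \<le> fin_cost M \<pi> T \<alpha> x + ennreal (\<alpha> ^ T) * (\<integral>\<^sup>+\<omega>. ?w T (fst (\<omega> T)) \<partial>P)"
  proof (rule cost_lower_bound)
    show "?w k \<in> borel_measurable (state_space M)" for k
      by (rule value_iteration_state_measurable[OF \<alpha>])
    fix k y a assume "k < T" "(y, a) \<in> graph M"
    then have "T - k = Suc (T - Suc k)" "a \<in> feasible M y" by (auto simp: graph_def)
    then show "?w k y \<le> eta M \<alpha> (?w (Suc k)) (y, a)"
      by (simp add: bellman_le)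
  qed (use \<alpha> in simp)
  then show ?thesis by simp
qed

lemma markov_fin_cost:
  assumes \<pi>: "\<pi> \<in> policies M" and \<alpha>: "\<alpha> \<in> {0..1}" and x: "x \<in> states M"
    and \<phi>: "\<And>k. k < T \<Longrightarrow> \<phi> k \<in> selectors M" and follows: "follows_until M T \<phi> \<pi>"
    and opt: "\<And>t y. t < T \<Longrightarrow> y \<in> states M \<Longrightarrow>
      value_iteration M (Suc t) \<alpha> y = eta M \<alpha> (value_iteration M t \<alpha>) (y, \<phi> (T - 1 - t) y)"
  shows "fin_cost M \<pi> T \<alpha> x = value_iteration M T \<alpha> x"
proof -
  interpret controlled_process M \<pi> x by (rule controlled_processI[OF \<pi> x])
  let ?w = "\<lambda>k. value_iteration M (T - k) \<alpha>"
  have "?w 0 x = fin_cost M \<pi> T \<alpha> x + ennreal (\<alpha> ^ T) * (\<integral>\<^sup>+\<omega>. ?w T (fst (\<omega> T)) \<partial>P)"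
  proof (rule cost_markov[OF _ _ _ \<phi> follows])
    show "?w k \<in> borel_measurable (state_space M)" for k
      by (rule value_iteration_state_measurable[OF \<alpha>])
    fix k y assume k: "k < T" and y: "y \<in> states M"
    have "T - 1 - (T - Suc k) = k" "Suc (T - Suc k) = T - k" using k by simp_all
    with opt[OF _ y, of "T - Suc k"] k show "?w k y = eta M \<alpha> (?w (Suc k)) (y, \<phi> k y)"
      by (simp del: value_iteration.simps)
  qed (use \<alpha> in simp_all)
  then show ?thesis by simp
qed

lemma policy_following:
  assumes \<phi>: "\<And>k. k < T \<Longrightarrow> \<phi> k \<in> selectors M"
  obtains \<pi> where "\<pi> \<in> policies M" "follows_until M T \<phi> \<pi>"
proof -
  obtain \<phi>\<^sub>0 where \<phi>\<^sub>0: "\<phi>\<^sub>0 \<in> selectors M" using selector_exists by blast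
  let ?\<phi> = "\<lambda>t. if t < T then \<phi> t else \<phi>\<^sub>0"
  have "markov_policy M ?\<phi> \<in> policies M"
    using \<phi> \<phi>\<^sub>0 feasible_borel by (intro markov_policy_in_policies) auto
  moreover have "follows_until M T \<phi> (markov_policy M ?\<phi>)"
    by (simp add: follows_until_def markov_policy_def)
  ultimately show thesis by (rule that)
qed

text \<open>
  One measurable minimizer for each number of remaining steps; an optimal policy for any horizon
  uses these rules in reversed order.
\<close>
definition finite_selector :: "nat \<Rightarrow> real \<Rightarrow> 'x \<Rightarrow> 'a" where
  "finite_selector t = (SOME \<sigma>. (\<lambda>(x, \<alpha>). \<sigma> \<alpha> x) \<in> parameters \<rightarrow>\<^sub>M action_space M \<and>
      (\<forall>\<alpha>\<in>{0..1}. \<sigma> \<alpha> \<in> selectors M \<and>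
        (\<forall>x\<in>states M. eta M \<alpha> (value_iteration M t \<alpha>) (x, \<sigma> \<alpha> x) = value_iteration M (Suc t) \<alpha> x)))"

lemma finite_selector:
  shows "(\<lambda>(x, \<alpha>). finite_selector t \<alpha> x) \<in> parameters \<rightarrow>\<^sub>M action_space M"
    and "\<alpha> \<in> {0..1} \<Longrightarrow> finite_selector t \<alpha> \<in> selectors M"
    and "\<alpha> \<in> {0..1} \<Longrightarrow> x \<in> states M \<Longrightarrow>
      eta M \<alpha> (value_iteration M t \<alpha>) (x, finite_selector t \<alpha> x) = value_iteration M (Suc t) \<alpha> x"
proof -
  have "\<exists>\<sigma>. (\<lambda>(x, \<alpha>). \<sigma> \<alpha> x) \<in> parameters \<rightarrow>\<^sub>M action_space M \<and>
      (\<forall>\<alpha>\<in>{0..1}. \<sigma> \<alpha> \<in> selectors M \<and>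
        (\<forall>x\<in>states M. eta M \<alpha> (value_iteration M t \<alpha>) (x, \<sigma> \<alpha> x) = value_iteration M (Suc t) \<alpha> x))"
    using bellman_measurable_selection(3)[OF value_iteration_measurable[of t]] by simp
  from someI_ex[OF this] show "(\<lambda>(x, \<alpha>). finite_selector t \<alpha> x) \<in> parameters \<rightarrow>\<^sub>M action_space M"
    "\<alpha> \<in> {0..1} \<Longrightarrow> finite_selector t \<alpha> \<in> selectors M"
    "\<alpha> \<in> {0..1} \<Longrightarrow> x \<in> states M \<Longrightarrow>
      eta M \<alpha> (value_iteration M t \<alpha>) (x, finite_selector t \<alpha> x) = value_iteration M (Suc t) \<alpha> x"
    unfolding finite_selector_def[symmetric] by blast+
qed

lemma fin_value_eq:
  assumes \<alpha>: "\<alpha> \<in> {0..1}" and x: "x \<in> states M"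
  shows "fin_value M T \<alpha> x = value_iteration M T \<alpha> x"
proof (rule antisym)
  show "value_iteration M T \<alpha> x \<le> fin_value M T \<alpha> x"
    unfolding fin_value_def by (intro INF_greatest value_iteration_le_fin_cost \<alpha> x)
  let ?\<phi> = "\<lambda>k. finite_selector (T - 1 - k) \<alpha>"
  obtain \<pi> where \<pi>: "\<pi> \<in> policies M" "follows_until M T ?\<phi> \<pi>"
    using policy_following[of T ?\<phi>] finite_selector(2)[OF \<alpha>] by blast
  have "fin_cost M \<pi> T \<alpha> x = value_iteration M T \<alpha> x"
  proof (rule markov_fin_cost[OF \<pi>(1) \<alpha> x _ \<pi>(2)])
    show "?\<phi> k \<in> selectors M" for k by (rule finite_selector(2)[OF \<alpha>])
    fix t y assume "t < T" "y \<in> states M"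
    moreover from \<open>t < T\<close> have "T - 1 - (T - 1 - t) = t" by simp
    ultimately show "value_iteration M (Suc t) \<alpha> y = eta M \<alpha> (value_iteration M t \<alpha>) (y, ?\<phi> (T - 1 - t) y)"
      using finite_selector(3)[OF \<alpha>, of y t] by simp
  qed
  then show "fin_value M T \<alpha> x \<le> value_iteration M T \<alpha> x"
    unfolding fin_value_def using \<pi>(1) by (metis INF_lower)
qed

lemma eta_fin_value:
  assumes "\<alpha> \<in> {0..1}" "p \<in> graph M"
  shows "eta M \<alpha> (fin_value M t \<alpha>) p = eta M \<alpha> (value_iteration M t \<alpha>) p"
  using assms by (intro eta_cong fin_value_eq)

lemma fin_opt_actions_eq:
  assumes "\<alpha> \<in> {0..1}" "x \<in> states M"
  shows "fin_opt_actions M t \<alpha> x = {a \<in> feasible M x.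
    bellman M \<alpha> (value_iteration M t \<alpha>) x = eta M \<alpha> (value_iteration M t \<alpha>) (x, a)}"
  unfolding fin_opt_actions_def using assms
  by (auto simp: fin_value_eq eta_fin_value graph_def)

lemma value_limit_le_inf_cost:
  assumes \<pi>: "\<pi> \<in> policies M" and \<alpha>: "\<alpha> \<in> {0..1}" and x: "x \<in> states M"
  shows "value_limit \<alpha> x \<le> inf_cost M \<pi> \<alpha> x"
proof -
  interpret controlled_process M \<pi> x by (rule controlled_processI[OF \<pi> x])
  show ?thesis
    unfolding inf_cost_eq_SUP value_limit_def
    by (intro SUP_mono' value_iteration_le_fin_cost \<pi> \<alpha> x)
qed

lemma stationary_policy: "\<phi> \<in> selectors M \<Longrightarrow> markov_policy M (\<lambda>_. \<phi>) \<in> policies M"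
  by (intro markov_policy_in_policies feasible_borel)

text \<open>
  A solution \<open>w\<close> of the policy's equation equals the cost of \<open>T\<close> epochs plus the discounted
  expectation of \<open>w\<close>, which is nonnegative.  In general \<open>w\<close> may be larger than the cost, since that
  remainder need not vanish.
\<close>
lemma stationary_cost_le:
  assumes \<alpha>: "\<alpha> \<in> {0..1}" and \<phi>: "\<phi> \<in> selectors M" and x: "x \<in> states M"
    and w: "w \<in> borel_measurable (state_space M)"
    and eq: "\<And>y. y \<in> states M \<Longrightarrow> w y = eta M \<alpha> w (y, \<phi> y)"
  shows "inf_cost M (markov_policy M (\<lambda>_. \<phi>)) \<alpha> x \<le> w x"
proof -
  interpret controlled_process M "markov_policy M (\<lambda>_. \<phi>)" x
    by (rule controlled_processI[OF stationary_policy[OF \<phi>] x])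
  have "fin_cost M (markov_policy M (\<lambda>_. \<phi>)) T \<alpha> x \<le> w x" for T
  proof -
    have "w x = fin_cost M (markov_policy M (\<lambda>_. \<phi>)) T \<alpha> x + ennreal (\<alpha> ^ T) * (\<integral>\<^sup>+\<omega>. w (fst (\<omega> T)) \<partial>P)"
      using \<alpha> \<phi> by (intro cost_markov[where w = "\<lambda>_. w" and \<phi> = "\<lambda>_. \<phi>"] w eq) (auto simp: follows_until_def)
    then show ?thesis by (metis le_iff_add)
  qed
  then show ?thesis
    unfolding inf_cost_eq_SUP by (intro SUP_least)
qed

text \<open>
  The cost of \<open>n\<close> epochs is \<open>u n\<close>, obtained by \<open>n\<close> applications of \<open>w \<mapsto> \<eta>\<^sup>\<alpha>\<^sub>w(\<cdot>, \<phi>(\<cdot>))\<close> to zero, and increases to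
  the infinite-horizon cost; monotone convergence passes the recursion to the limit.
\<close>
lemma stationary_cost_equation:
  assumes \<alpha>: "\<alpha> \<in> {0..1}" and \<phi>: "\<phi> \<in> selectors M" and x: "x \<in> states M"
  shows "inf_cost M (markov_policy M (\<lambda>_. \<phi>)) \<alpha> x =
    eta M \<alpha> (inf_cost M (markov_policy M (\<lambda>_. \<phi>)) \<alpha>) (x, \<phi> x)"
proof -
  define u where "u = rec_nat (\<lambda>_. 0) (\<lambda>_ w y. eta_ext \<alpha> w (y, \<phi> y))"
  have u: "u 0 = (\<lambda>_. 0)" "u (Suc n) = (\<lambda>y. eta_ext \<alpha> (u n) (y, \<phi> y))" for n
    by (simp_all add: u_def)
  have \<phi>_meas: "(\<lambda>y. (y, \<phi> y)) \<in> state_space M \<rightarrow>\<^sub>M step_space M"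
    using \<phi> by (intro measurable_Pair) (simp_all add: selectors_def)
  have u_meas: "u n \<in> borel_measurable (state_space M)" for n
  proof (induction n)
    case (Suc n)
    show ?case unfolding u by (rule measurable_compose[OF \<phi>_meas eta_ext_measurable[OF Suc]])
  qed (simp add: u)
  have in_graph: "(y, \<phi> y) \<in> graph M" if "y \<in> states M" for y
    using \<phi> that by (simp add: graph_def selectors_def)
  have u_Suc: "u (Suc n) y = eta M \<alpha> (u n) (y, \<phi> y)" if "y \<in> states M" for n y
    using eta_ext_eq[OF in_graph[OF that]] by (simp add: u)
  have u_mono: "u n y \<le> u (Suc n) y" if "y \<in> states M" for n y
    using that
  proof (induction n arbitrary: y)
    case (Suc n)
    then show ?case
      unfolding u_Suc[OF Suc.prems] using \<alpha> by (intro eta_mono in_graph) auto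
  qed (simp add: u)
  have cost: "fin_cost M (markov_policy M (\<lambda>_. \<phi>)) T \<alpha> y = u T y" if y: "y \<in> states M" for T y
  proof -
    interpret controlled_process M "markov_policy M (\<lambda>_. \<phi>)" y
      by (rule controlled_processI[OF stationary_policy[OF \<phi>] y])
    have "u (T - 0) y = fin_cost M (markov_policy M (\<lambda>_. \<phi>)) T \<alpha> y +
        ennreal (\<alpha> ^ T) * (\<integral>\<^sup>+\<omega>. u (T - T) (fst (\<omega> T)) \<partial>P)"
    proof (rule cost_markov[where w = "\<lambda>k. u (T - k)" and \<phi> = "\<lambda>_. \<phi>"])
      fix k z assume "k < T" "z \<in> states M"
      moreover from \<open>k < T\<close> have "T - k = Suc (T - Suc k)" by simp
      ultimately show "u (T - k) z = eta M \<alpha> (u (T - Suc k)) (z, \<phi> z)"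
        using u_Suc[of z "T - Suc k"] by simp
    qed (use \<alpha> \<phi> u_meas in \<open>auto simp: follows_until_def\<close>)
    then show ?thesis by (simp add: u)
  qed
  have cost_SUP: "inf_cost M (markov_policy M (\<lambda>_. \<phi>)) \<alpha> y = (SUP n. u n y)" if y: "y \<in> states M" for y
    using controlled_process.inf_cost_eq_SUP[OF controlled_processI[OF stationary_policy[OF \<phi>] y]] cost[OF y]
    by simp
  have "eta M \<alpha> (inf_cost M (markov_policy M (\<lambda>_. \<phi>)) \<alpha>) (x, \<phi> x) = (SUP n. eta M \<alpha> (u n) (x, \<phi> x))"
    by (rule eta_SUP[OF in_graph[OF x] u_meas u_mono _ _ cost_SUP]) auto
  also have "\<dots> = (SUP n. u (Suc n) x)" using u_Suc[OF x] by simp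
  also have "\<dots> = (SUP n. u n x)"
  proof (rule LIMSEQ_unique)
    have inc: "incseq (\<lambda>n. u n x)" by (intro incseq_SucI u_mono x)
    show "(\<lambda>n. u (Suc n) x) \<longlonglongrightarrow> (SUP n. u n x)"
      by (rule LIMSEQ_Suc[OF LIMSEQ_SUP[OF inc]])
    show "(\<lambda>n. u (Suc n) x) \<longlonglongrightarrow> (SUP n. u (Suc n) x)"
      by (intro LIMSEQ_SUP incseq_SucI u_mono x)
  qed
  finally show ?thesis using cost_SUP[OF x] by simp
qed

lemma inf_value_eq:
  assumes \<alpha>: "\<alpha> \<in> {0..1}" and x: "x \<in> states M"
  shows "inf_value M \<alpha> x = value_limit \<alpha> x"
proof (rule antisym)
  show "value_limit \<alpha> x \<le> inf_value M \<alpha> x"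
    unfolding inf_value_def by (intro INF_greatest value_limit_le_inf_cost \<alpha> x)
  obtain \<sigma> where \<sigma>: "\<sigma> \<alpha> \<in> selectors M"
      "\<And>y. y \<in> states M \<Longrightarrow> eta M \<alpha> (value_limit \<alpha>) (y, \<sigma> \<alpha> y) = bellman M \<alpha> (value_limit \<alpha>) y"
    using bellman_measurable_selection(3)[OF value_limit_measurable] \<alpha> by blast
  have "inf_cost M (markov_policy M (\<lambda>_. \<sigma> \<alpha>)) \<alpha> x \<le> value_limit \<alpha> x"
    using \<sigma> value_limit_fixed_point[OF \<alpha>] value_limit_state_measurable[OF \<alpha>]
    by (intro stationary_cost_le[OF \<alpha> _ x]) auto
  then show "inf_value M \<alpha> x \<le> value_limit \<alpha> x"
    unfolding inf_value_def using stationary_policy[OF \<sigma>(1)] by (rule INF_lower2[rotated])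
qed

lemma eta_inf_value:
  assumes "\<alpha> \<in> {0..1}" "p \<in> graph M"
  shows "eta M \<alpha> (inf_value M \<alpha>) p = eta M \<alpha> (value_limit \<alpha>) p"
  using assms by (intro eta_cong inf_value_eq)

lemma inf_opt_actions_eq:
  assumes "\<alpha> \<in> {0..1}" "x \<in> states M"
  shows "inf_opt_actions M \<alpha> x = {a \<in> feasible M x.
    bellman M \<alpha> (value_limit \<alpha>) x = eta M \<alpha> (value_limit \<alpha>) (x, a)}"
  unfolding inf_opt_actions_def using assms
  by (auto simp: inf_value_eq eta_inf_value value_limit_fixed_point graph_def)

text \<open>
  An optimal stationary policy has the value as its cost, so its cost equation says that its actions
  are minimizers.  Conversely, minimizers make the value a solution of the policy's cost equation,
  which therefore dominates the cost.
\<close>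
lemma stationary_optimal_iff:
  assumes \<alpha>: "\<alpha> \<in> {0..1}" and \<phi>: "\<phi> \<in> selectors M"
  shows "stationary_optimal M \<alpha> \<phi> \<longleftrightarrow> (\<forall>x\<in>states M. \<phi> x \<in> inf_opt_actions M \<alpha> x)"
proof
  assume opt: "stationary_optimal M \<alpha> \<phi>"
  show "\<forall>x\<in>states M. \<phi> x \<in> inf_opt_actions M \<alpha> x"
  proof
    fix x assume x: "x \<in> states M"
    have f: "\<phi> x \<in> feasible M x" using \<phi> x by (simp add: selectors_def)
    have "inf_value M \<alpha> x = eta M \<alpha> (inf_cost M (markov_policy M (\<lambda>_. \<phi>)) \<alpha>) (x, \<phi> x)"
      using opt x stationary_cost_equation[OF \<alpha> \<phi> x] by (simp add: stationary_optimal_def)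
    also have "\<dots> = eta M \<alpha> (inf_value M \<alpha>) (x, \<phi> x)"
      using opt x f by (intro eta_cong) (auto simp: graph_def stationary_optimal_def)
    finally show "\<phi> x \<in> inf_opt_actions M \<alpha> x"
      using f by (simp add: inf_opt_actions_def)
  qed
next
  assume opt: "\<forall>x\<in>states M. \<phi> x \<in> inf_opt_actions M \<alpha> x"
  show "stationary_optimal M \<alpha> \<phi>"
    unfolding stationary_optimal_def
  proof
    fix x assume x: "x \<in> states M"
    have "value_limit \<alpha> y = eta M \<alpha> (value_limit \<alpha>) (y, \<phi> y)" if "y \<in> states M" for y
    proof -
      have "\<phi> y \<in> inf_opt_actions M \<alpha> y" using opt that by simp
      then show ?thesis
        unfolding inf_opt_actions_eq[OF \<alpha> that] value_limit_fixed_point[OF \<alpha> that] by simp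
    qed
    then have "inf_cost M (markov_policy M (\<lambda>_. \<phi>)) \<alpha> x \<le> value_limit \<alpha> x"
      by (intro stationary_cost_le[OF \<alpha> \<phi> x] value_limit_state_measurable[OF \<alpha>])
    moreover have "value_limit \<alpha> x \<le> inf_cost M (markov_policy M (\<lambda>_. \<phi>)) \<alpha> x"
      by (rule value_limit_le_inf_cost[OF stationary_policy[OF \<phi>] \<alpha> x])
    ultimately show "inf_cost M (markov_policy M (\<lambda>_. \<phi>)) \<alpha> x = inf_value M \<alpha> x"
      by (simp add: inf_value_eq[OF \<alpha> x])
  qed
qed

lemma horizon_optimal_if:
  assumes \<alpha>: "\<alpha> \<in> {0..1}" and \<phi>: "is_horizon_markov M T \<phi>"
    and opt: "\<And>x t. x \<in> states M \<Longrightarrow> t < T \<Longrightarrow> \<phi> (T - 1 - t) x \<in> fin_opt_actions M t \<alpha> x"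
  shows "horizon_optimal M T \<alpha> \<phi>"
  unfolding horizon_optimal_def
proof (intro ballI impI)
  fix \<pi> x assume \<pi>: "\<pi> \<in> policies M" "follows_until M T \<phi> \<pi>" and x: "x \<in> states M"
  have "fin_cost M \<pi> T \<alpha> x = value_iteration M T \<alpha> x"
  proof (rule markov_fin_cost[OF \<pi>(1) \<alpha> x _ \<pi>(2)])
    show "\<phi> k \<in> selectors M" if "k < T" for k
      using \<phi> that by (simp add: is_horizon_markov_def)
    show "value_iteration M (Suc t) \<alpha> y = eta M \<alpha> (value_iteration M t \<alpha>) (y, \<phi> (T - 1 - t) y)"
      if "t < T" "y \<in> states M" for t y
      using opt[OF that(2,1)] by (simp add: fin_opt_actions_eq[OF \<alpha> that(2)])
  qed
  then show "fin_cost M \<pi> T \<alpha> x = fin_value M T \<alpha> x"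
    by (simp add: fin_value_eq[OF \<alpha> x])
qed

lemma finite_selector_optimal:
  assumes "\<alpha> \<in> {0..1}" "x \<in> states M"
  shows "finite_selector t \<alpha> x \<in> fin_opt_actions M t \<alpha> x"
  using finite_selector(2)[OF assms(1), of t] finite_selector(3)[OF assms, of t] assms
  by (simp add: fin_opt_actions_eq selectors_def)

lemma fin_value_measurable: "(\<lambda>(x, \<alpha>). fin_value M t \<alpha> x) \<in> nonneg_borel (states M \<times> {0..1})"
proof -
  have "(\<lambda>(x, \<alpha>). fin_value M t \<alpha> x) \<in> borel_measurable parameters \<longleftrightarrow>
      (\<lambda>(x, \<alpha>). value_iteration M t \<alpha> x) \<in> borel_measurable parameters"
    by (rule measurable_cong) (auto simp: space_restrict_space fin_value_eq)
  then show ?thesis using value_iteration_measurable by (simp add: nonneg_borel_def)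
qed

lemma inf_value_measurable: "(\<lambda>(x, \<alpha>). inf_value M \<alpha> x) \<in> nonneg_borel (states M \<times> {0..1})"
proof -
  have "(\<lambda>(x, \<alpha>). inf_value M \<alpha> x) \<in> borel_measurable parameters \<longleftrightarrow>
      (\<lambda>(x, \<alpha>). value_limit \<alpha> x) \<in> borel_measurable parameters"
    by (rule measurable_cong) (auto simp: space_restrict_space inf_value_eq)
  then show ?thesis using value_limit_measurable by (simp add: nonneg_borel_def)
qed

lemma fin_value_incseq_tendsto:
  assumes \<alpha>: "\<alpha> \<in> {0..1}" and x: "x \<in> states M"
  shows "incseq (\<lambda>t. fin_value M t \<alpha> x)" "(\<lambda>t. fin_value M t \<alpha> x) \<longlonglongrightarrow> inf_value M \<alpha> x"
  using incseq_value_iteration[OF \<alpha> x] LIMSEQ_SUP[OF incseq_value_iteration[OF \<alpha> x]]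
  by (simp_all add: fin_value_eq[OF \<alpha> x] inf_value_eq[OF \<alpha> x] value_limit_def)

lemma fin_value_mono_lsc:
  assumes x: "x \<in> states M"
  shows "mono_on {0..1} (\<lambda>\<alpha>. fin_value M t \<alpha> x)" "lsc_on {0..1} (\<lambda>\<alpha>. fin_value M t \<alpha> x)"
proof -
  show mono: "mono_on {0..1} (\<lambda>\<alpha>. fin_value M t \<alpha> x)"
    using mono_on_value_iteration[OF x, of t] by (simp add: mono_on_def fin_value_eq[OF _ x])
  show "lsc_on {0..1} (\<lambda>\<alpha>. fin_value M t \<alpha> x)"
  proof (rule lsc_on_if_left_continuous[OF mono])
    fix \<beta> :: real assume \<beta>: "\<beta> \<in> {0..1}"
    have "\<beta> * (1 - 1 / Suc n) \<in> {0..1}" for n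
      using \<beta> by (auto intro!: mult_nonneg_nonneg mult_le_one)
    then show "fin_value M t \<beta> x = (SUP n. fin_value M t (\<beta> * (1 - 1 / Suc n)) x)"
      using value_iteration_left_continuous[OF \<beta> x, of t] \<beta> by (simp add: fin_value_eq x)
  qed
qed

lemma inf_value_mono_lsc:
  assumes x: "x \<in> states M"
  shows "mono_on {0..1} (\<lambda>\<alpha>. inf_value M \<alpha> x)" "lsc_on {0..1} (\<lambda>\<alpha>. inf_value M \<alpha> x)"
proof -
  show mono: "mono_on {0..1} (\<lambda>\<alpha>. inf_value M \<alpha> x)"
    using mono_on_value_limit[OF x] by (simp add: mono_on_def inf_value_eq[OF _ x])
  show "lsc_on {0..1} (\<lambda>\<alpha>. inf_value M \<alpha> x)"
  proof (rule lsc_on_if_left_continuous[OF mono])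
    fix \<beta> :: real assume \<beta>: "\<beta> \<in> {0..1}"
    have "\<beta> * (1 - 1 / Suc n) \<in> {0..1}" for n
      using \<beta> by (auto intro!: mult_nonneg_nonneg mult_le_one)
    then show "inf_value M \<beta> x = (SUP n. inf_value M (\<beta> * (1 - 1 / Suc n)) x)"
      using value_limit_left_continuous[OF \<beta> x] \<beta> by (simp add: inf_value_eq x)
  qed
qed

lemma finite_horizon_optimality_equation:
  assumes \<alpha>: "\<alpha> \<in> {0..1}" and x: "x \<in> states M"
  shows "is_minimum (fin_value M (Suc t) \<alpha> x) (feasible M x) (\<lambda>a. eta M \<alpha> (fin_value M t \<alpha>) (x, a))"
    and "fin_opt_actions M t \<alpha> x \<noteq> {}"
    and "fin_value M (Suc t) \<alpha> x = \<infinity> \<Longrightarrow> fin_opt_actions M t \<alpha> x = feasible M x"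
    and "fin_value M (Suc t) \<alpha> x < \<infinity> \<Longrightarrow> compact (fin_opt_actions M t \<alpha> x)"
proof -
  have "0 \<le> \<alpha>" using \<alpha> by simp
  note min = bellman_minimizers[OF x value_iteration_state_measurable[OF \<alpha>, of t] this]
  have v: "fin_value M (Suc t) \<alpha> x = bellman M \<alpha> (value_iteration M t \<alpha>) x"
    by (simp add: fin_value_eq[OF \<alpha> x])
  show "is_minimum (fin_value M (Suc t) \<alpha> x) (feasible M x) (\<lambda>a. eta M \<alpha> (fin_value M t \<alpha>) (x, a))"
    using min(1) x by (simp add: v is_minimum_def eta_fin_value[OF \<alpha>] graph_def)
  show "fin_opt_actions M t \<alpha> x \<noteq> {}"
    "fin_value M (Suc t) \<alpha> x = \<infinity> \<Longrightarrow> fin_opt_actions M t \<alpha> x = feasible M x"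
    "fin_value M (Suc t) \<alpha> x < \<infinity> \<Longrightarrow> compact (fin_opt_actions M t \<alpha> x)"
    using min(2,3,4) unfolding v fin_opt_actions_eq[OF \<alpha> x] by blast+
qed

lemma infinite_horizon_optimality_equation:
  assumes \<alpha>: "\<alpha> \<in> {0..1}" and x: "x \<in> states M"
  shows "is_minimum (inf_value M \<alpha> x) (feasible M x) (\<lambda>a. eta M \<alpha> (inf_value M \<alpha>) (x, a))"
    and "inf_opt_actions M \<alpha> x \<noteq> {}"
    and "inf_value M \<alpha> x = \<infinity> \<Longrightarrow> inf_opt_actions M \<alpha> x = feasible M x"
    and "inf_value M \<alpha> x < \<infinity> \<Longrightarrow> compact (inf_opt_actions M \<alpha> x)"
proof -
  have "0 \<le> \<alpha>" using \<alpha> by simp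
  note min = bellman_minimizers[OF x value_limit_state_measurable[OF \<alpha>] this]
  have v: "inf_value M \<alpha> x = bellman M \<alpha> (value_limit \<alpha>) x"
    by (simp add: inf_value_eq[OF \<alpha> x] value_limit_fixed_point[OF \<alpha> x])
  show "is_minimum (inf_value M \<alpha> x) (feasible M x) (\<lambda>a. eta M \<alpha> (inf_value M \<alpha>) (x, a))"
    using min(1) x by (simp add: v is_minimum_def eta_inf_value[OF \<alpha>] graph_def)
  show "inf_opt_actions M \<alpha> x \<noteq> {}"
    "inf_value M \<alpha> x = \<infinity> \<Longrightarrow> inf_opt_actions M \<alpha> x = feasible M x"
    "inf_value M \<alpha> x < \<infinity> \<Longrightarrow> compact (inf_opt_actions M \<alpha> x)"
    using min(2,3,4) unfolding v inf_opt_actions_eq[OF \<alpha> x] by blast+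
qed

lemma fin_opt_actions_borel:
  "{(x, \<alpha>, a). x \<in> states M \<and> \<alpha> \<in> {0..1} \<and> a \<in> fin_opt_actions M t \<alpha> x}
    \<in> sets (restrict_space borel (states M \<times> {0..1} \<times> actions M))"
proof -
  have "{(x, \<alpha>, a). x \<in> states M \<and> \<alpha> \<in> {0..1} \<and> a \<in> fin_opt_actions M t \<alpha> x} =
      {(x, \<alpha>, a). x \<in> states M \<and> \<alpha> \<in> {0..1} \<and> a \<in> feasible M x \<and>
        bellman M \<alpha> (value_iteration M t \<alpha>) x = eta M \<alpha> (value_iteration M t \<alpha>) (x, a)}"
    by (auto simp: fin_opt_actions_eq)
  then show ?thesis
    using bellman_measurable_selection(2)[OF value_iteration_measurable[of t]] by simp
qed

lemma inf_opt_actions_borel: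
  "{(x, \<alpha>, a). x \<in> states M \<and> \<alpha> \<in> {0..1} \<and> a \<in> inf_opt_actions M \<alpha> x}
    \<in> sets (restrict_space borel (states M \<times> {0..1} \<times> actions M))"
proof -
  have "{(x, \<alpha>, a). x \<in> states M \<and> \<alpha> \<in> {0..1} \<and> a \<in> inf_opt_actions M \<alpha> x} =
      {(x, \<alpha>, a). x \<in> states M \<and> \<alpha> \<in> {0..1} \<and> a \<in> feasible M x \<and>
        bellman M \<alpha> (value_limit \<alpha>) x = eta M \<alpha> (value_limit \<alpha>) (x, a)}"
    by (auto simp: inf_opt_actions_eq)
  then show ?thesis
    using bellman_measurable_selection(2)[OF value_limit_measurable] by simp
qed

lemma optimal_horizon_policies_exist:
  "\<exists>\<phi> :: real \<Rightarrow> nat \<Rightarrow> 'x \<Rightarrow> 'a.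
    (\<forall>\<alpha>\<in>{0..1}. is_horizon_markov M T (\<phi> \<alpha>) \<and> horizon_optimal M T \<alpha> (\<phi> \<alpha>)) \<and>
    (\<forall>t<T. (\<lambda>(x, \<alpha>). \<phi> \<alpha> t x) \<in> parameters \<rightarrow>\<^sub>M action_space M)"
proof (intro exI[of _ "\<lambda>\<alpha> t. finite_selector (T - 1 - t) \<alpha>"] conjI ballI allI impI)
  fix \<alpha> :: real assume \<alpha>: "\<alpha> \<in> {0..1}"
  show m: "is_horizon_markov M T (\<lambda>t. finite_selector (T - 1 - t) \<alpha>)"
    using finite_selector(2)[OF \<alpha>] by (simp add: is_horizon_markov_def)
  show "horizon_optimal M T \<alpha> (\<lambda>t. finite_selector (T - 1 - t) \<alpha>)"
  proof (rule horizon_optimal_if[OF \<alpha> m])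
    fix x t assume x: "x \<in> states M" and "t < T"
    then have "T - 1 - (T - 1 - t) = t" by simp
    then show "finite_selector (T - 1 - (T - 1 - t)) \<alpha> x \<in> fin_opt_actions M t \<alpha> x"
      using finite_selector_optimal[OF \<alpha> x, of t] by simp
  qed
qed (rule finite_selector(1))

lemma optimal_stationary_policies_exist:
  "\<exists>\<phi> :: real \<Rightarrow> 'x \<Rightarrow> 'a.
    (\<forall>\<alpha>\<in>{0..1}. \<phi> \<alpha> \<in> selectors M \<and> stationary_optimal M \<alpha> (\<phi> \<alpha>)) \<and>
    (\<lambda>(x, \<alpha>). \<phi> \<alpha> x) \<in> parameters \<rightarrow>\<^sub>M action_space M"
proof -
  obtain \<sigma> where \<sigma>: "(\<lambda>(x, \<alpha>). \<sigma> \<alpha> x) \<in> parameters \<rightarrow>\<^sub>M action_space M"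
      "\<And>\<alpha>. \<alpha> \<in> {0..1} \<Longrightarrow> \<sigma> \<alpha> \<in> selectors M"
      "\<And>\<alpha> x. \<alpha> \<in> {0..1} \<Longrightarrow> x \<in> states M \<Longrightarrow>
        eta M \<alpha> (value_limit \<alpha>) (x, \<sigma> \<alpha> x) = bellman M \<alpha> (value_limit \<alpha>) x"
    using bellman_measurable_selection(3)[OF value_limit_measurable] by blast
  have "\<sigma> \<alpha> x \<in> inf_opt_actions M \<alpha> x" if "\<alpha> \<in> {0..1}" "x \<in> states M" for \<alpha> x
    using \<sigma>(2)[OF that(1)] \<sigma>(3)[OF that] that by (simp add: inf_opt_actions_eq selectors_def)
  then show ?thesis
    using \<sigma>(1,2) by (intro exI[of _ \<sigma>]) (simp add: stationary_optimal_iff)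
qed

end

theorem theorem3p1:
  fixes M :: "('x::polish_space, 'a::polish_space) mdp"
  assumes "markov_decision_process M" and "assumption_S_star M"
  shows
    \<comment> \<open>(i)\<close>
    "((\<lambda>(x, \<alpha>). inf_value M \<alpha> x) \<in> nonneg_borel (states M \<times> {0..1}) \<and>
      (\<forall>t. (\<lambda>(x, \<alpha>). fin_value M t \<alpha> x) \<in> nonneg_borel (states M \<times> {0..1})) \<and>
      (\<forall>x\<in>states M. \<forall>\<alpha>\<in>{0..1}. incseq (\<lambda>t. fin_value M t \<alpha> x) \<and>
         (\<lambda>t. fin_value M t \<alpha> x) \<longlonglongrightarrow> inf_value M \<alpha> x)) \<and>
     \<comment> \<open>(ii)\<close>
     (\<forall>x\<in>states M.
        mono_on {0..1} (\<lambda>\<alpha>. inf_value M \<alpha> x) \<and> lsc_on {0..1} (\<lambda>\<alpha>. inf_value M \<alpha> x) \<and>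
        (\<forall>t\<ge>1. mono_on {0..1} (\<lambda>\<alpha>. fin_value M t \<alpha> x) \<and>
                lsc_on {0..1} (\<lambda>\<alpha>. fin_value M t \<alpha> x))) \<and>
     \<comment> \<open>(iii)\<close>
     (\<forall>t.
        (\<forall>\<alpha>\<in>{0..1}. \<forall>x\<in>states M.
           is_minimum (fin_value M (Suc t) \<alpha> x) (feasible M x)
             (\<lambda>a. eta M \<alpha> (fin_value M t \<alpha>) (x, a)) \<and>
           fin_opt_actions M t \<alpha> x \<noteq> {} \<and>
           (fin_value M (Suc t) \<alpha> x = \<infinity> \<longrightarrow> fin_opt_actions M t \<alpha> x = feasible M x) \<and>
           (fin_value M (Suc t) \<alpha> x < \<infinity> \<longrightarrow> compact (fin_opt_actions M t \<alpha> x))) \<and>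
        {(x, \<alpha>, a). x \<in> states M \<and> \<alpha> \<in> {0..1} \<and> a \<in> fin_opt_actions M t \<alpha> x}
          \<in> sets (restrict_space borel (states M \<times> {0..1} \<times> actions M))) \<and>
     \<comment> \<open>(iv)\<close>
     (\<forall>T\<ge>1.
        (\<forall>\<alpha>\<in>{0..1}. \<forall>\<phi>. is_horizon_markov M T \<phi> \<and>
             (\<forall>x\<in>states M. \<forall>t<T. \<phi> (T - 1 - t) x \<in> fin_opt_actions M t \<alpha> x) \<longrightarrow>
           horizon_optimal M T \<alpha> \<phi>) \<and>
        (\<exists>\<phi> :: real \<Rightarrow> nat \<Rightarrow> 'x \<Rightarrow> 'a.
           (\<forall>\<alpha>\<in>{0..1}. is_horizon_markov M T (\<phi> \<alpha>) \<and> horizon_optimal M T \<alpha> (\<phi> \<alpha>)) \<and>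
           (\<forall>t<T. (\<lambda>(x, \<alpha>). \<phi> \<alpha> t x) \<in>
              restrict_space borel (states M \<times> {0..1}) \<rightarrow>\<^sub>M action_space M))) \<and>
     \<comment> \<open>(v)\<close>
     ((\<forall>\<alpha>\<in>{0..1}. \<forall>x\<in>states M.
         is_minimum (inf_value M \<alpha> x) (feasible M x)
           (\<lambda>a. eta M \<alpha> (inf_value M \<alpha>) (x, a)) \<and>
         inf_opt_actions M \<alpha> x \<noteq> {} \<and>
         (inf_value M \<alpha> x = \<infinity> \<longrightarrow> inf_opt_actions M \<alpha> x = feasible M x) \<and>
         (inf_value M \<alpha> x < \<infinity> \<longrightarrow> compact (inf_opt_actions M \<alpha> x))) \<and>
      {(x, \<alpha>, a). x \<in> states M \<and> \<alpha> \<in> {0..1} \<and> a \<in> inf_opt_actions M \<alpha> x}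
        \<in> sets (restrict_space borel (states M \<times> {0..1} \<times> actions M))) \<and>
     \<comment> \<open>(vi)\<close>
     ((\<forall>\<alpha>\<in>{0..1}. \<forall>\<phi>\<in>selectors M.
         stationary_optimal M \<alpha> \<phi> \<longleftrightarrow> (\<forall>x\<in>states M. \<phi> x \<in> inf_opt_actions M \<alpha> x)) \<and>
      (\<exists>\<phi> :: real \<Rightarrow> 'x \<Rightarrow> 'a.
         (\<forall>\<alpha>\<in>{0..1}. \<phi> \<alpha> \<in> selectors M \<and> stationary_optimal M \<alpha> (\<phi> \<alpha>)) \<and>
         (\<lambda>(x, \<alpha>). \<phi> \<alpha> x) \<in>
           restrict_space borel (states M \<times> {0..1}) \<rightarrow>\<^sub>M action_space M))"
proof -
  interpret S_star_mdp M
    using assms by (intro S_star_mdp.intro S_star_mdp_axioms.intro)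
  show ?thesis
    by (intro conjI ballI allI impI; (elim conjE)?;
        (rule inf_value_measurable fin_value_measurable fin_value_incseq_tendsto inf_value_mono_lsc
          fin_value_mono_lsc finite_horizon_optimality_equation fin_opt_actions_borel horizon_optimal_if
          optimal_horizon_policies_exist infinite_horizon_optimality_equation inf_opt_actions_borel
          stationary_optimal_iff optimal_stationary_policies_exist; (assumption | blast)))
qed

end
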